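(* Let $(M,g)$ and $(\bar M,\bar g)$ be Riemannian manifolds and let $\iota:(M,g)\to(\bar M,\bar g)$ be an isometric immersion (so $g=\iota^*\bar g$), with second fundamental form $B$. Let $g_S$ and $\bar g_S$ be the Sasaki metrics on $TM$ and $T\bar M$ associated with $g$ and $\bar g$. Then at every point $u\in TM$, $$(\iota_* )^*\bar g_S=g_S+\bar g\circ(\oplus^2B_u),$$ that is, for all $X,Y\in T_uTM$, $$\big((\iota_* )^*\bar g_S\big)(X,Y)=g_S(X,Y)+\bar g\big(B(u,(\pi_M)_*X),\,B(u,(\pi_M)_*Y)\big).$$
   Context: Notation: for a manifold $M$, $\pi_M:TM\to M$ is the projection, and a smooth map $f$ has differential $f_*$; $\iota_*:TM\to T\bar M$ is the differential of $\iota$. For $u,v\in T_pM$, $\mathfrak{I}(u,v)\in T_uTM$ denotes the vertical vector $\frac{d}{dt}\big|_{t=0}(u+tv)$. For a Riemannian manifold $(M,g)$ with Levi-Civita connection $\nabla$, and $u,x\in T_pM$, $C(u,x)\in T_uTM$ denotes the horizontal lift of $x$ at $u$, characterized by $C(Y(p),x)=Y_*x-\mathfrak{I}(Y(p),\nabla_xY)$ for every vector field $Y$ on $M$. One has $T_uTM=C(\{u\}\times T_pM)\oplus\mathfrak{I}(\{u\}\times T_pM)$ (horizontal plus vertical). The Sasaki metric $g_S$ on the manifold $TM$ is the Riemannian metric determined by: for all $p\in M$ and $u,v,w\in T_pM$, $$g_S(C(u,v),C(u,w))=g(v,w),\quad g_S(\mathfrak{I}(u,v),\mathfrak{I}(u,w))=g(v,w),\quad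 g_S(\mathfrak{I}(u,v),C(u,w))=0.$$ The Sasaki metric $\bar g_S$ on $T\bar M$ is defined in the same way from $\bar g$. The second fundamental form $B:\oplus^2TM=TM\oplus TM\to T\bar M$ is $B(x,y)=\bar\nabla_{\iota_*x}Y-\iota_*\nabla_xy$, where $x\in T_pM$, $y$ is a vector field on $M$, $Y$ is a vector field on $\bar M$ (local, near the image of a neighbourhood of $p$ on which $\iota$ is an embedding) with $Y\circ\iota=\iota_*\circ y$, and $\nabla,\bar\nabla$ are the Levi-Civita connections of $g,\bar g$. It depends only on $x$ and $y(p)$. For $u\in T_pM$ and $X\in T_uTM$, $B_u(X)$ means $B(u,(\pi_M)_*X)$. *)

theory Defs
  imports "HOL-Analysis.Analysis"
begin

section \<open>Smooth maps between open subsets of Euclidean spaces\<close>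

text \<open>For an open set \<open>S\<close>, \<open>Ck k S f\<close> says that \<open>f\<close> is of class \<open>C\<^sup>k\<close> on \<open>S\<close>: in finite
  dimension the derivative is a \<open>C\<^sup>k\<close> map iff all its evaluations at fixed vectors are.\<close>

primrec Ck :: "nat \<Rightarrow> 'e::euclidean_space set \<Rightarrow> ('e \<Rightarrow> 'f::euclidean_space) \<Rightarrow> bool" where
  "Ck 0 S f \<longleftrightarrow> continuous_on S f"
| "Ck (Suc k) S f \<longleftrightarrow>
     (\<exists>f'. (\<forall>x\<in>S. (f has_derivative f' x) (at x)) \<and> (\<forall>v. Ck k S (\<lambda>x. f' x v)))"

definition smooth_on :: "'e::euclidean_space set \<Rightarrow> ('e \<Rightarrow> 'f::euclidean_space) \<Rightarrow> bool" where
  "smooth_on S f \<longleftrightarrow> (\<forall>k. Ck k S f)"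


section \<open>Smooth manifolds\<close>

text \<open>A chart is a pair of a domain and a coordinate map, whose values outside the domain are
  irrelevant. A manifold is given by an atlas: its underlying set is the union of the chart
  domains, and its topology is the one for which the charts are homeomorphisms. The atlas need
  not be maximal; compatible charts may be added without changing any of the notions below.\<close>

type_synonym ('a, 'e) chart = "'a set \<times> ('a \<Rightarrow> 'e)"
type_synonym ('a, 'e) atlas = "('a, 'e) chart set"

definition points :: "('a, 'e) atlas \<Rightarrow> 'a set" where
  "points A = (\<Union>c\<in>A. fst c)"

definition charts_at :: "('a, 'e) atlas \<Rightarrow> 'a \<Rightarrow> ('a, 'e) chart set" where
  "charts_at A p = {c \<in> A. p \<in> fst c}"

definition inv_chart :: "('a, 'e) chart \<Rightarrow> 'e \<Rightarrow> 'a" where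
  "inv_chart c = inv_into (fst c) (snd c)"

definition manifold_topology :: "('a, 'e::euclidean_space) atlas \<Rightarrow> 'a topology" where
  "manifold_topology A =
     topology (\<lambda>W. W \<subseteq> points A \<and> (\<forall>c\<in>A. open (snd c ` (W \<inter> fst c))))"

definition second_countable_space :: "'a topology \<Rightarrow> bool" where
  "second_countable_space X \<longleftrightarrow>
     (\<exists>\<B>. countable \<B> \<and> (\<forall>V\<in>\<B>. openin X V) \<and>
        (\<forall>W x. openin X W \<and> x \<in> W \<longrightarrow> (\<exists>V\<in>\<B>. x \<in> V \<and> V \<subseteq> W)))"

definition smooth_manifold :: "('a, 'e::euclidean_space) atlas \<Rightarrow> bool" where
  "smooth_manifold A \<longleftrightarrow>
     (\<forall>c\<in>A. inj_on (snd c) (fst c) \<and> open (snd c ` fst c)) \<and>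
     (\<forall>c\<in>A. \<forall>d\<in>A. open (snd c ` (fst c \<inter> fst d)) \<and>
        smooth_on (snd c ` (fst c \<inter> fst d)) (snd d \<circ> inv_chart c)) \<and>
     Hausdorff_space (manifold_topology A) \<and> second_countable_space (manifold_topology A)"

definition smooth_map_on ::
  "('a, 'e::euclidean_space) atlas \<Rightarrow> 'a set \<Rightarrow> ('b, 'f::euclidean_space) atlas \<Rightarrow> ('a \<Rightarrow> 'b) \<Rightarrow> bool"
where
  "smooth_map_on A W B f \<longleftrightarrow> f ` W \<subseteq> points B \<and>
     (\<forall>c\<in>A. \<forall>d\<in>B. open (snd c ` (W \<inter> fst c \<inter> f -` fst d)) \<and>
        smooth_on (snd c ` (W \<inter> fst c \<inter> f -` fst d)) (snd d \<circ> f \<circ> inv_chart c))"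

definition real_line :: "(real, real) atlas" where
  "real_line = {(UNIV, \<lambda>t. t)}"


section \<open>Tangent vectors, the tangent bundle, differentials\<close>

text \<open>A tangent vector at \<open>p\<close> is a pair \<open>(p, v)\<close>, where \<open>v c\<close> is the coordinate vector in the
  chart \<open>c\<close>; the coordinate vectors in different charts at \<open>p\<close> are related by the derivative of
  the change of coordinates. The value \<open>0\<close> at charts that do not contain \<open>p\<close> is a convention
  that makes the representation unique. The projection of the tangent bundle is \<open>fst\<close>.\<close>

type_synonym ('a, 'e) tvec = "'a \<times> (('a, 'e) chart \<Rightarrow> 'e)"

definition tangent_space :: "('a, 'e::euclidean_space) atlas \<Rightarrow> 'a \<Rightarrow> ('a, 'e) tvec set" where
  "tangent_space A p =
     {(p, v) | v. (\<forall>c\<in>charts_at A p. \<forall>d\<in>charts_at A p.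
          v d = frechet_derivative (snd d \<circ> inv_chart c) (at (snd c p)) (v c)) \<and>
        (\<forall>c. c \<notin> charts_at A p \<longrightarrow> v c = 0)}"

definition tzero :: "'a \<Rightarrow> ('a, 'e::euclidean_space) tvec" where
  "tzero p = (p, \<lambda>c. 0)"

text \<open>The following operations are meant for vectors with the same base point.\<close>

definition tadd :: "('a, 'e::euclidean_space) tvec \<Rightarrow> ('a, 'e) tvec \<Rightarrow> ('a, 'e) tvec" where
  "tadd u v = (fst u, \<lambda>c. snd u c + snd v c)"

definition tdiff :: "('a, 'e::euclidean_space) tvec \<Rightarrow> ('a, 'e) tvec \<Rightarrow> ('a, 'e) tvec" where
  "tdiff u v = (fst u, \<lambda>c. snd u c - snd v c)"

definition tscale :: "real \<Rightarrow> ('a, 'e::euclidean_space) tvec \<Rightarrow> ('a, 'e) tvec" where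
  "tscale r u = (fst u, \<lambda>c. r *\<^sub>R snd u c)"

text \<open>The tangent bundle is again a manifold, so that the constructions below can be iterated.\<close>

definition tangent_chart ::
  "('a, 'e::euclidean_space) atlas \<Rightarrow> ('a, 'e) chart \<Rightarrow> (('a, 'e) tvec, 'e \<times> 'e) chart" where
  "tangent_chart A c = (\<Union>p\<in>fst c. tangent_space A p, \<lambda>u. (snd c (fst u), snd u c))"

definition tangent_bundle ::
  "('a, 'e::euclidean_space) atlas \<Rightarrow> (('a, 'e) tvec, 'e \<times> 'e) atlas" where
  "tangent_bundle A = tangent_chart A ` A"

text \<open>\<open>differential A B f\<close> is the map \<open>f\<^sub>*\<close>. It depends on \<open>f\<close> only near the base point, and
  not on the choice of the chart.\<close>

definition differential ::
  "('a, 'e::euclidean_space) atlas \<Rightarrow> ('b, 'f::euclidean_space) atlas \<Rightarrow> ('a \<Rightarrow> 'b) \<Rightarrow>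
     ('a, 'e) tvec \<Rightarrow> ('b, 'f) tvec"
where
  "differential A B f u =
     (let p = fst u; c = (SOME c. c \<in> charts_at A p)
      in (f p, \<lambda>d. if d \<in> charts_at B (f p)
                   then frechet_derivative (snd d \<circ> f \<circ> inv_chart c) (at (snd c p)) (snd u c)
                   else 0))"

definition velocity :: "('a, 'e::euclidean_space) atlas \<Rightarrow> (real \<Rightarrow> 'a) \<Rightarrow> real \<Rightarrow> ('a, 'e) tvec" where
  "velocity A \<gamma> t =
     (\<gamma> t, \<lambda>c. if c \<in> charts_at A (\<gamma> t) then vector_derivative (snd c \<circ> \<gamma>) (at t) else 0)"

text \<open>\<open>dir_deriv A x f\<close> is the derivative \<open>x f\<close> of the real function \<open>f\<close> along \<open>x\<close>.\<close>

definition dir_deriv ::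
  "('a, 'e::euclidean_space) atlas \<Rightarrow> ('a, 'e) tvec \<Rightarrow> ('a \<Rightarrow> real) \<Rightarrow> real" where
  "dir_deriv A x f = snd (differential A real_line f x) (UNIV, \<lambda>t. t)"

definition smooth_fun_on ::
  "('a, 'e::euclidean_space) atlas \<Rightarrow> 'a set \<Rightarrow> ('a \<Rightarrow> real) \<Rightarrow> bool" where
  "smooth_fun_on A W f \<longleftrightarrow> smooth_map_on A W real_line f"

definition vector_field_on ::
  "('a, 'e::euclidean_space) atlas \<Rightarrow> 'a set \<Rightarrow> ('a \<Rightarrow> ('a, 'e) tvec) \<Rightarrow> bool" where
  "vector_field_on A W Y \<longleftrightarrow>
     (\<forall>q\<in>W. Y q \<in> tangent_space A q) \<and> smooth_map_on A W (tangent_bundle A) Y"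


section \<open>Riemannian metrics and the Levi-Civita connection\<close>

type_synonym ('a, 'e) metric_tensor = "('a, 'e) tvec \<Rightarrow> ('a, 'e) tvec \<Rightarrow> real"

definition riemannian_metric ::
  "('a, 'e::euclidean_space) atlas \<Rightarrow> ('a, 'e) metric_tensor \<Rightarrow> bool" where
  "riemannian_metric A g \<longleftrightarrow>
     (\<forall>p\<in>points A. \<forall>u\<in>tangent_space A p. \<forall>v\<in>tangent_space A p.
        g u v = g v u \<and>
        (\<forall>w\<in>tangent_space A p. g (tadd u v) w = g u w + g v w) \<and>
        (\<forall>r. g (tscale r u) v = r * g u v) \<and>
        (u \<noteq> tzero p \<longrightarrow> g u u > 0)) \<and>
     (\<forall>W X Y. openin (manifold_topology A) W \<and> vector_field_on A W X \<and> vector_field_on A W Y \<longrightarrow>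
        smooth_fun_on A W (\<lambda>q. g (X q) (Y q)))"

definition riemannian_manifold ::
  "('a, 'e::euclidean_space) atlas \<Rightarrow> ('a, 'e) metric_tensor \<Rightarrow> bool" where
  "riemannian_manifold A g \<longleftrightarrow> smooth_manifold A \<and> riemannian_metric A g"

text \<open>Covariant derivatives act on local vector fields: for a tangent vector \<open>x\<close> at \<open>p\<close> and a
  vector field \<open>Y\<close> on an open set around \<open>p\<close>, \<open>D x Y\<close> stands for \<open>\<nabla>\<^sub>x Y\<close>. The second clause
  says that \<open>D x Y\<close> depends only on the germ of \<open>Y\<close> at \<open>p\<close>, so that \<open>D\<close> is the same datum as an
  ordinary affine connection together with its usual extension to local fields.\<close>

type_synonym ('a, 'e) cov_deriv = "('a, 'e) tvec \<Rightarrow> ('a \<Rightarrow> ('a, 'e) tvec) \<Rightarrow> ('a, 'e) tvec"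

definition affine_connection ::
  "('a, 'e::euclidean_space) atlas \<Rightarrow> ('a, 'e) cov_deriv \<Rightarrow> bool" where
  "affine_connection A D \<longleftrightarrow>
     (\<forall>W Y. openin (manifold_topology A) W \<and> vector_field_on A W Y \<longrightarrow>
        (\<forall>p\<in>W. \<forall>x\<in>tangent_space A p. D x Y \<in> tangent_space A p) \<and>
        (\<forall>Z. vector_field_on A W Z \<and> (\<forall>q\<in>W. Y q = Z q) \<longrightarrow>
           (\<forall>p\<in>W. \<forall>x\<in>tangent_space A p. D x Y = D x Z)) \<and>
        (\<forall>p\<in>W. \<forall>x\<in>tangent_space A p. \<forall>x'\<in>tangent_space A p. \<forall>r s.
           D (tadd (tscale r x) (tscale s x')) Y = tadd (tscale r (D x Y)) (tscale s (D x' Y))) \<and>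
        (\<forall>Z. vector_field_on A W Z \<longrightarrow>
           (\<forall>p\<in>W. \<forall>x\<in>tangent_space A p. D x (\<lambda>q. tadd (Y q) (Z q)) = tadd (D x Y) (D x Z))) \<and>
        (\<forall>f. smooth_fun_on A W f \<longrightarrow>
           (\<forall>p\<in>W. \<forall>x\<in>tangent_space A p.
              D x (\<lambda>q. tscale (f q) (Y q)) =
                tadd (tscale (dir_deriv A x f) (Y p)) (tscale (f p) (D x Y)))) \<and>
        (\<forall>X. vector_field_on A W X \<longrightarrow> vector_field_on A W (\<lambda>q. D (X q) Y)))"

text \<open>Torsion-freeness \<open>\<nabla>\<^sub>X Y - \<nabla>\<^sub>Y X = [X, Y]\<close>, where \<open>[X, Y]\<close> is the vector field with
  \<open>[X, Y] f = X (Y f) - Y (X f)\<close> for all smooth functions \<open>f\<close>.\<close>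

definition torsion_free ::
  "('a, 'e::euclidean_space) atlas \<Rightarrow> ('a, 'e) cov_deriv \<Rightarrow> bool" where
  "torsion_free A D \<longleftrightarrow>
     (\<forall>W X Y f. openin (manifold_topology A) W \<and> vector_field_on A W X \<and> vector_field_on A W Y \<and>
        smooth_fun_on A W f \<longrightarrow>
        (\<forall>p\<in>W. dir_deriv A (tdiff (D (X p) Y) (D (Y p) X)) f =
           dir_deriv A (X p) (\<lambda>q. dir_deriv A (Y q) f) -
           dir_deriv A (Y p) (\<lambda>q. dir_deriv A (X q) f)))"

definition metric_connection ::
  "('a, 'e::euclidean_space) atlas \<Rightarrow> ('a, 'e) metric_tensor \<Rightarrow> ('a, 'e) cov_deriv \<Rightarrow> bool" where
  "metric_connection A g D \<longleftrightarrow>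
     (\<forall>W Y Z. openin (manifold_topology A) W \<and> vector_field_on A W Y \<and> vector_field_on A W Z \<longrightarrow>
        (\<forall>p\<in>W. \<forall>x\<in>tangent_space A p.
           dir_deriv A x (\<lambda>q. g (Y q) (Z q)) = g (D x Y) (Z p) + g (Y p) (D x Z)))"

definition levi_civita ::
  "('a, 'e::euclidean_space) atlas \<Rightarrow> ('a, 'e) metric_tensor \<Rightarrow> ('a, 'e) cov_deriv \<Rightarrow> bool" where
  "levi_civita A g D \<longleftrightarrow>
     affine_connection A D \<and> torsion_free A D \<and> metric_connection A g D"


section \<open>The Sasaki metric\<close>

definition vertical ::
  "('a, 'e::euclidean_space) atlas \<Rightarrow> ('a, 'e) tvec \<Rightarrow> ('a, 'e) tvec \<Rightarrow> (('a, 'e) tvec, 'e \<times> 'e) tvec"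
where
  "vertical A u v = velocity (tangent_bundle A) (\<lambda>t. tadd u (tscale t v)) 0"

definition horizontal ::
  "('a, 'e::euclidean_space) atlas \<Rightarrow> ('a, 'e) cov_deriv \<Rightarrow> ('a, 'e) tvec \<Rightarrow> ('a, 'e) tvec \<Rightarrow>
     (('a, 'e) tvec, 'e \<times> 'e) tvec"
where
  "horizontal A D u x =
     (THE \<xi>. \<xi> \<in> tangent_space (tangent_bundle A) u \<and>
        (\<forall>W Y. openin (manifold_topology A) W \<and> fst u \<in> W \<and> vector_field_on A W Y \<and> Y (fst u) = u \<longrightarrow>
           \<xi> = tdiff (differential A (tangent_bundle A) Y x) (vertical A u (D x Y))))"

text \<open>\<open>D\<close> is intended to be the Levi-Civita connection of \<open>g\<close>.\<close>

definition sasaki_metric ::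
  "('a, 'e::euclidean_space) atlas \<Rightarrow> ('a, 'e) metric_tensor \<Rightarrow> ('a, 'e) cov_deriv \<Rightarrow>
     (('a, 'e) tvec, 'e \<times> 'e) metric_tensor \<Rightarrow> bool"
where
  "sasaki_metric A g D G \<longleftrightarrow>
     riemannian_metric (tangent_bundle A) G \<and>
     (\<forall>p\<in>points A. \<forall>u\<in>tangent_space A p. \<forall>v\<in>tangent_space A p. \<forall>w\<in>tangent_space A p.
        G (horizontal A D u v) (horizontal A D u w) = g v w \<and>
        G (vertical A u v) (vertical A u w) = g v w \<and>
        G (vertical A u v) (horizontal A D u w) = 0)"


section \<open>Isometric immersions and the second fundamental form\<close>

definition pullback ::
  "('a, 'e::euclidean_space) atlas \<Rightarrow> ('b, 'f::euclidean_space) atlas \<Rightarrow> ('a \<Rightarrow> 'b) \<Rightarrow>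
     ('b, 'f) metric_tensor \<Rightarrow> ('a, 'e) metric_tensor"
where
  "pullback A B f h = (\<lambda>u v. h (differential A B f u) (differential A B f v))"

definition immersion ::
  "('a, 'e::euclidean_space) atlas \<Rightarrow> ('b, 'f::euclidean_space) atlas \<Rightarrow> ('a \<Rightarrow> 'b) \<Rightarrow> bool" where
  "immersion A B f \<longleftrightarrow> smooth_map_on A (points A) B f \<and>
     (\<forall>p\<in>points A. inj_on (differential A B f) (tangent_space A p))"

definition isometric_immersion ::
  "('a, 'e::euclidean_space) atlas \<Rightarrow> ('a, 'e) metric_tensor \<Rightarrow>
     ('b, 'f::euclidean_space) atlas \<Rightarrow> ('b, 'f) metric_tensor \<Rightarrow> ('a \<Rightarrow> 'b) \<Rightarrow> bool"
where
  "isometric_immersion A g B h f \<longleftrightarrow> immersion A B f \<and>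
     (\<forall>p\<in>points A. \<forall>u\<in>tangent_space A p. \<forall>v\<in>tangent_space A p. g u v = pullback A B f h u v)"

text \<open>For \<open>x, v\<close> in the same tangent space of the source, the value is
  \<open>\<nabla>'\<^bsub>f\<^sub>* x\<^esub> Y - f\<^sub>* (\<nabla>\<^sub>x y)\<close> for any local vector fields \<open>y\<close> and \<open>Y\<close> with
  \<open>Y \<circ> f = f\<^sub>* \<circ> y\<close> and \<open>y p = v\<close>. Requiring in addition that \<open>f\<close> is an embedding on \<open>W\<close> would
  not change the set of admissible values, since \<open>W\<close> may always be shrunk around \<open>p\<close>.\<close>

definition second_fundamental_form ::
  "('a, 'e::euclidean_space) atlas \<Rightarrow> ('a, 'e) cov_deriv \<Rightarrow>
     ('b, 'f::euclidean_space) atlas \<Rightarrow> ('b, 'f) cov_deriv \<Rightarrow> ('a \<Rightarrow> 'b) \<Rightarrow>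
     ('a, 'e) tvec \<Rightarrow> ('a, 'e) tvec \<Rightarrow> ('b, 'f) tvec"
where
  "second_fundamental_form A D B D' f x v =
     (THE b. \<exists>W V y Y.
        openin (manifold_topology A) W \<and> fst x \<in> W \<and>
        openin (manifold_topology B) V \<and> f ` W \<subseteq> V \<and>
        vector_field_on A W y \<and> y (fst x) = v \<and> vector_field_on B V Y \<and>
        (\<forall>q\<in>W. Y (f q) = differential A B f (y q)) \<and>
        b = tdiff (D' (differential A B f x) Y) (differential A B f (D x y)))"

end

(*
  Write F for the differential of \<iota>, as a map of tangent bundles, and dF for its differential.

  By torsion-freeness, the coordinates of D x Y in a chart are the derivative of the coordinates of
  Y along x plus a term that depends only on x and Y p. So dY x - vertical (D x Y) depends only on
  Y p, which makes the horizontal lift well defined.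

  Since \<iota> has a smooth local left inverse, every tangent vector of M extends to a field y that is
  \<iota>-related to a field Y near the image. For related pairs (y, Y), (z, Z), torsion-freeness on both
  sides gives D' (F y) Z - F (D y z) = D' (F z) Y - F (D z y); hence B is well defined and symmetric.
  Metric compatibility on both sides makes h (B x y) (F z) antisymmetric in y and z, and a form that
  is symmetric in x, y and antisymmetric in y, z vanishes: B is normal to the image of F.

  Applying dF to horizontal u x = dy x - vertical (D x y), where y p = u, gives
  horizontal (F u) (F x) + vertical (B u x), while dF maps the vertical vector of w at u to that of
  F w at F u. Expanding the Sasaki metrics, the mixed terms vanish because B is normal.
*)

theory Submission
  imports Defs
begin

section \<open>Calculus of smooth maps\<close>

text \<open>The horizontal lift and the second fundamental form are both given by
  \<open>THE\<close>. Such a description is usable only once some local field realises it and all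
  fields agree. Both agreements rest on torsion-freeness: one compares a field with a
  constant-coefficient field of a chart, the other exchanges the two arguments. Since
  torsion-freeness is stated through functions, it is tested on chart coordinates, whose derivatives
  along a vector are the coordinates of that vector.

  Fields are only local, so the related extensions live on one pair of open sets that serves all
  vectors at a point: the argument for normality permutes three fields. An extension must be smooth
  on an open set of the target and not just along the image; this calls for a smooth left inverse,
  hence for an inverse function theorem in the classes \<open>Ck\<close>. These see a derivative
  only through its values at fixed vectors, so much of the calculus passes from fixed to moving
  vectors.

  The formula lives in the tangent spaces of the tangent bundle. There, too, equality is decided in
  a single chart, by a base and a fibre coordinate.\<close>

lemma Ck_SucI:
  assumes "\<And>x. x \<in> S \<Longrightarrow> (f has_derivative f' x) (at x)" "\<And>v. Ck k S (\<lambda>x. f' x v)"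
  shows "Ck (Suc k) S f"
  using assms by auto

lemma Ck_SucE:
  assumes "Ck (Suc k) S f"
  obtains f' where "\<And>x. x \<in> S \<Longrightarrow> (f has_derivative f' x) (at x)" "\<And>v. Ck k S (\<lambda>x. f' x v)"
  using assms by auto

text \<open>Derivatives are taken \<open>at x\<close>, not within \<open>S\<close>; openness turns
  agreement on \<open>S\<close> into agreement near each of its points.\<close>

lemma Ck_cong:
  assumes "open S" "\<And>x. x \<in> S \<Longrightarrow> f x = g x" "Ck k S f"
  shows "Ck k S g"
proof (cases k)
  case 0
  then show ?thesis using assms by (metis Ck.simps(1) continuous_on_cong)
next
  case (Suc m)
  then obtain f' where f': "\<And>x. x \<in> S \<Longrightarrow> (f has_derivative f' x) (at x)" "\<And>v. Ck m S (\<lambda>x. f' x v)"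
    using assms(3) Ck_SucE by metis
  show ?thesis unfolding Suc
  proof (rule Ck_SucI[OF _ f'(2)])
    show "(g has_derivative f' x) (at x)" if "x \<in> S" for x
      using has_derivative_transform_within_open[OF f'(1)[OF that] assms(1) that assms(2)] .
  qed
qed

lemma Ck_Suc_imp_Ck: "Ck (Suc k) S f \<Longrightarrow> Ck k S f"
proof (induction k arbitrary: f)
  case 0
  then obtain f' where "\<And>x. x \<in> S \<Longrightarrow> (f has_derivative f' x) (at x)" using Ck_SucE by metis
  then show ?case unfolding Ck.simps
    by (intro continuous_at_imp_continuous_on ballI) (rule has_derivative_continuous)
next
  case (Suc k)
  obtain f' where "\<And>x. x \<in> S \<Longrightarrow> (f has_derivative f' x) (at x)" "\<And>v. Ck (Suc k) S (\<lambda>x. f' x v)"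
    using Ck_SucE[OF Suc.prems] by metis
  then show ?case by (intro Ck_SucI) (auto intro: Suc.IH)
qed

lemma Ck_imp_continuous_on: "Ck k S f \<Longrightarrow> continuous_on S f"
proof (induction k)
  case (Suc k)
  then show ?case using Ck_Suc_imp_Ck by blast
qed simp

lemma Ck_subset: "Ck k S f \<Longrightarrow> T \<subseteq> S \<Longrightarrow> Ck k T f"
proof (induction k arbitrary: f)
  case 0
  then show ?case using continuous_on_subset by auto
next
  case (Suc k)
  obtain f' where "\<And>x. x \<in> S \<Longrightarrow> (f has_derivative f' x) (at x)" "\<And>v. Ck k S (\<lambda>x. f' x v)"
    using Ck_SucE[OF Suc.prems(1)] by metis
  then show ?case using Suc.prems(2) Suc.IH by (intro Ck_SucI[where f' = f']) blast+
qed

lemma Ck_const: "Ck k S (\<lambda>x. a)"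
proof (induction k arbitrary: a)
  case (Suc k)
  show ?case by (rule Ck_SucI[OF has_derivative_const Suc])
qed simp

lemma Ck_ident: "Ck k S (\<lambda>x. x)"
proof (cases k)
  case (Suc k)
  show ?thesis unfolding Suc by (rule Ck_SucI[OF has_derivative_ident Ck_const])
qed simp

lemma Ck_add: "Ck k S f \<Longrightarrow> Ck k S g \<Longrightarrow> Ck k S (\<lambda>x. f x + g x)"
proof (induction k arbitrary: f g)
  case 0
  then show ?case by (auto intro: continuous_intros)
next
  case (Suc k)
  obtain f' where f': "\<And>x. x \<in> S \<Longrightarrow> (f has_derivative f' x) (at x)" "\<And>v. Ck k S (\<lambda>x. f' x v)"
    using Ck_SucE[OF Suc.prems(1)] by metis
  obtain g' where g': "\<And>x. x \<in> S \<Longrightarrow> (g has_derivative g' x) (at x)" "\<And>v. Ck k S (\<lambda>x. g' x v)"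
    using Ck_SucE[OF Suc.prems(2)] by metis
  show ?case
    by (rule Ck_SucI[OF has_derivative_add[OF f'(1) g'(1)] Suc.IH[OF f'(2) g'(2)]])
qed

lemma Ck_bounded_linear: "bounded_linear L \<Longrightarrow> Ck k S f \<Longrightarrow> Ck k S (\<lambda>x. L (f x))"
proof (induction k arbitrary: f)
  case 0
  then show ?case using bounded_linear.continuous_on by auto
next
  case (Suc k)
  obtain f' where f': "\<And>x. x \<in> S \<Longrightarrow> (f has_derivative f' x) (at x)" "\<And>v. Ck k S (\<lambda>x. f' x v)"
    using Ck_SucE[OF Suc.prems(2)] by metis
  show ?case
    by (rule Ck_SucI[OF bounded_linear.has_derivative[OF Suc.prems(1) f'(1)]
        Suc.IH[OF Suc.prems(1) f'(2)]])
qed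

lemma Ck_bilinear:
  assumes "bounded_bilinear (prd :: 'a::euclidean_space \<Rightarrow> 'b::euclidean_space \<Rightarrow> 'c::euclidean_space)"
  shows "Ck k S f \<Longrightarrow> Ck k S g \<Longrightarrow> Ck k S (\<lambda>x. prd (f x) (g x))"
proof (induction k arbitrary: f g)
  case 0
  then show ?case using bounded_bilinear.continuous_on[OF assms] by auto
next
  case (Suc k)
  obtain f' where f': "\<And>x. x \<in> S \<Longrightarrow> (f has_derivative f' x) (at x)" "\<And>v. Ck k S (\<lambda>x. f' x v)"
    using Ck_SucE[OF Suc.prems(1)] by metis
  obtain g' where g': "\<And>x. x \<in> S \<Longrightarrow> (g has_derivative g' x) (at x)" "\<And>v. Ck k S (\<lambda>x. g' x v)"
    using Ck_SucE[OF Suc.prems(2)] by metis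
  have "Ck k S (\<lambda>x. prd (f x) (g' x v) + prd (f' x v) (g x))" for v
    by (rule Ck_add[OF Suc.IH[OF Ck_Suc_imp_Ck[OF Suc.prems(1)] g'(2)]
          Suc.IH[OF f'(2) Ck_Suc_imp_Ck[OF Suc.prems(2)]]])
  with bounded_bilinear.FDERIV[OF assms f'(1) g'(1)] show ?case
    by (intro Ck_SucI)
qed

lemma Ck_sum: "(\<And>i. i \<in> I \<Longrightarrow> Ck k S (f i)) \<Longrightarrow> Ck k S (\<lambda>x. \<Sum>i\<in>I. f i x)"
proof (induction I rule: infinite_finite_induct)
  case (insert i I)
  then show ?case by (simp add: Ck_add)
qed (simp_all add: Ck_const)

lemma linear_sum_Basis:
  assumes "linear (f :: 'a::euclidean_space \<Rightarrow> 'b::real_vector)"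
  shows "f a = (\<Sum>b\<in>Basis. (a \<bullet> b) *\<^sub>R f b)"
proof -
  have "f a = f (\<Sum>b\<in>Basis. (a \<bullet> b) *\<^sub>R b)" by (simp add: euclidean_representation)
  also have "\<dots> = (\<Sum>b\<in>Basis. (a \<bullet> b) *\<^sub>R f b)"
    using assms by (simp add: linear_sum linear_scale)
  finally show ?thesis .
qed

text \<open>\<open>Ck\<close> controls the operators \<open>A x\<close> only at fixed vectors.
  Expanding the moving vector \<open>w x\<close> in the basis leaves finitely many products of a
  scalar coordinate with a value at a fixed basis vector.\<close>

lemma Ck_apply_linear:
  fixes A :: "'a::euclidean_space \<Rightarrow> 'b::euclidean_space \<Rightarrow> 'c::euclidean_space"
  assumes "open S" "\<And>x. x \<in> S \<Longrightarrow> linear (A x)" "\<And>v. Ck k S (\<lambda>x. A x v)" "Ck k S w"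
  shows "Ck k S (\<lambda>x. A x (w x))"
proof (rule Ck_cong)
  show "(\<Sum>b\<in>Basis. (w x \<bullet> b) *\<^sub>R A x b) = A x (w x)" if "x \<in> S" for x
    by (rule linear_sum_Basis[OF assms(2)[OF that], symmetric])
  show "Ck k S (\<lambda>x. \<Sum>b\<in>Basis. (w x \<bullet> b) *\<^sub>R A x b)"
    using Ck_bilinear[OF bounded_bilinear_scaleR
        Ck_bounded_linear[OF bounded_linear_inner_left assms(4)] assms(3)]
    by (intro Ck_sum)
qed fact

text \<open>In the chain rule \<open>g' (f x) (f' x v)\<close> both the operator and its argument
  move with \<open>x\<close>. The induction replaces \<open>g\<close> by its derivative and keeps
  \<open>f\<close>, merely demoted by one class.\<close>

lemma Ck_compose:
  fixes f :: "'a::euclidean_space \<Rightarrow> 'b::euclidean_space" and g :: "'b \<Rightarrow> 'c::euclidean_space"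
  shows "open S \<Longrightarrow> Ck k T g \<Longrightarrow> Ck k S f \<Longrightarrow> f ` S \<subseteq> T \<Longrightarrow> Ck k S (\<lambda>x. g (f x))"
proof (induction k arbitrary: g)
  case 0
  then show ?case by (simp add: continuous_on_compose2)
next
  case (Suc k)
  obtain f' where f': "\<And>x. x \<in> S \<Longrightarrow> (f has_derivative f' x) (at x)" "\<And>v. Ck k S (\<lambda>x. f' x v)"
    using Ck_SucE[OF Suc.prems(3)] by metis
  obtain g' where g': "\<And>x. x \<in> T \<Longrightarrow> (g has_derivative g' x) (at x)" "\<And>v. Ck k T (\<lambda>x. g' x v)"
    using Ck_SucE[OF Suc.prems(2)] by metis
  have fT: "f x \<in> T" if "x \<in> S" for x
    using that Suc.prems(4) by blast
  have "Ck k S (\<lambda>x. g' (f x) (f' x v))" for v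
  proof (rule Ck_apply_linear[where A = "\<lambda>x. g' (f x)"])
    show "linear (g' (f x))" if "x \<in> S" for x
      using g'(1)[OF fT[OF that]] has_derivative_linear by blast
    show "Ck k S (\<lambda>x. g' (f x) w)" for w
      by (rule Suc.IH[OF Suc.prems(1) g'(2) Ck_Suc_imp_Ck[OF Suc.prems(3)] Suc.prems(4)])
  qed (rule Suc.prems(1) f'(2))+
  with has_derivative_compose[OF f'(1) g'(1)[OF fT]] show ?case
    by (intro Ck_SucI)
qed

lemma Ck_frechet_derivative:
  assumes "open S" "Ck (Suc k) S f"
  shows "Ck k S (\<lambda>x. frechet_derivative f (at x) v)"
proof -
  obtain f' where f': "\<And>x. x \<in> S \<Longrightarrow> (f has_derivative f' x) (at x)" "\<And>v. Ck k S (\<lambda>x. f' x v)"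
    using Ck_SucE[OF assms(2)] by metis
  show ?thesis
  proof (rule Ck_cong[OF assms(1)])
    show "f' x v = frechet_derivative f (at x) v" if "x \<in> S" for x
      using f'(1) that frechet_derivative_at by metis
  qed (use f'(2) in blast)
qed

lemma Ck_Suc_frechetI:
  assumes "\<And>x. x \<in> S \<Longrightarrow> f differentiable (at x)"
    and "\<And>v. Ck k S (\<lambda>x. frechet_derivative f (at x) v)"
  shows "Ck (Suc k) S f"
  using assms by (intro Ck_SucI[OF _ assms(2)]) (simp add: frechet_derivative_works)

text \<open>The derivatives witnessing \<open>Ck\<close> on the various \<open>U\<close> are chosen
  separately. Replacing them by \<open>frechet_derivative\<close> makes them one function, to which
  the induction applies.\<close>

lemma Ck_local:
  assumes "\<And>x. x \<in> S \<Longrightarrow> \<exists>U. open U \<and> x \<in> U \<and> Ck k U f"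
  shows "Ck k S f"
  using assms
proof (induction k arbitrary: f)
  case 0
  show ?case unfolding Ck.simps
  proof (rule continuous_at_imp_continuous_on, rule ballI)
    fix x assume "x \<in> S"
    with 0 obtain U where "open U" "x \<in> U" "continuous_on U f" by auto
    then show "isCont f x" using continuous_on_eq_continuous_at by blast
  qed
next
  case (Suc k)
  show ?case
  proof (rule Ck_Suc_frechetI)
    fix x assume "x \<in> S"
    with Suc.prems obtain U where "open U" "x \<in> U" "Ck (Suc k) U f" by blast
    then show "f differentiable (at x)" using Ck_SucE unfolding differentiable_def by metis
  next
    show "Ck k S (\<lambda>x. frechet_derivative f (at x) v)" for v
      using Suc.IH Suc.prems Ck_frechet_derivative by metis
  qed
qed

section \<open>Smooth dependence of the inverse operator\<close>

text \<open>A product rule that asks only continuity of \<open>\<beta>\<close>, at the price of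
  \<open>\<phi> p = 0\<close>. The product splits into \<open>\<phi> x *\<^sub>R \<beta> p\<close>
  and \<open>\<phi> x *\<^sub>R (\<beta> x - \<beta> p)\<close>; the second is of higher order,
  since \<open>\<phi> x\<close> is bounded near \<open>p\<close> by a multiple of
  \<open>norm (x - p)\<close>. This makes it possible to differentiate an inverse operator before
  its differentiability is known.\<close>

lemma has_derivative_scaleR_zero:
  fixes \<phi> :: "'a::euclidean_space \<Rightarrow> real" and \<beta> :: "'a \<Rightarrow> 'c::euclidean_space"
  assumes "(\<phi> has_derivative \<phi>') (at p)" "\<phi> p = 0" "isCont \<beta> p"
  shows "((\<lambda>x. \<phi> x *\<^sub>R \<beta> x) has_derivative (\<lambda>v. \<phi>' v *\<^sub>R \<beta> p)) (at p)"
proof -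
  have 1: "((\<lambda>x. \<phi> x *\<^sub>R \<beta> p) has_derivative (\<lambda>v. \<phi>' v *\<^sub>R \<beta> p)) (at p)"
    using assms by (auto intro: derivative_eq_intros)
  have 2: "((\<lambda>x. \<phi> x *\<^sub>R (\<beta> x - \<beta> p)) has_derivative (\<lambda>v. 0)) (at p)"
  proof -
    obtain K where K: "\<And>v. \<bar>\<phi>' v\<bar> \<le> norm v * K" "K > 0"
      using has_derivative_bounded_linear[OF assms(1)] bounded_linear.pos_bounded real_norm_def by metis
    have l: "((\<lambda>x. (\<phi> x - \<phi>' (x - p)) / norm (x - p)) \<longlongrightarrow> 0) (at p)"
      using assms(1,2) by (auto simp: has_derivative_at_within tendsto_iff divide_inverse mult.commute)
    \<comment> \<open>\<open>K\<close> bounds the derivative and the remainder is eventually below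
      \<open>norm (x - p)\<close>; the two add up to \<open>1 + K\<close>.\<close>
    have "eventually (\<lambda>x. norm (\<phi> x / norm (x - p)) \<le> 1 + K) (at p)"
    proof -
      have "eventually (\<lambda>x. norm ((\<phi> x - \<phi>' (x - p)) / norm (x - p)) < 1) (at p)"
        using l by (auto simp: tendsto_iff dest!: spec[of _ 1])
      moreover have "eventually (\<lambda>x. x \<noteq> p) (at p)" by (simp add: eventually_at_filter)
      ultimately show ?thesis
      proof eventually_elim
        case (elim x)
        have "\<bar>\<phi> x\<bar> \<le> \<bar>\<phi> x - \<phi>' (x - p)\<bar> + norm (x - p) * K"
          using K(1)[of "x - p"] by linarith
        moreover have "\<bar>\<phi> x - \<phi>' (x - p)\<bar> < norm (x - p)"
          using elim by (simp add: divide_simps)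
        ultimately have "\<bar>\<phi> x\<bar> \<le> (1 + K) * norm (x - p)" by (simp add: algebra_simps)
        then show ?case using elim by (simp add: divide_simps)
      qed
    qed
    then have "Bfun (\<lambda>x. \<phi> x / norm (x - p)) (at p)" by (rule BfunI)
    moreover have "((\<lambda>x. \<beta> x - \<beta> p) \<longlongrightarrow> 0) (at p)"
      using assms(3) by (simp add: isCont_def LIM_zero)
    ultimately have "((\<lambda>x. (\<phi> x / norm (x - p)) *\<^sub>R (\<beta> x - \<beta> p)) \<longlongrightarrow> 0) (at p)"
      using bounded_bilinear.Bfun_prod_Zfun[OF bounded_bilinear_scaleR] by (simp add: tendsto_Zfun_iff)
    then show ?thesis using assms(2)
      by (simp add: has_derivative_at_within divide_inverse mult.commute)
  qed
  from has_derivative_add[OF 1 2] show ?thesis by (simp add: algebra_simps)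
qed

text \<open>The identity \<open>B x v - B p v = B x (A p (B p v) - A x (B p v))\<close> has an
  argument on the right that tends to 0, so a bound on \<open>B x\<close> that is uniform near
  \<open>p\<close> suffices.\<close>

lemma isCont_inverse_operator:
  fixes A B :: "'a::euclidean_space \<Rightarrow> 'b::euclidean_space \<Rightarrow> 'b"
  assumes S: "open S" and lA: "\<And>x. x \<in> S \<Longrightarrow> linear (A x)" and lB: "\<And>x. x \<in> S \<Longrightarrow> linear (B x)"
    and BA: "\<And>x v. x \<in> S \<Longrightarrow> B x (A x v) = v" and AB: "\<And>x v. x \<in> S \<Longrightarrow> A x (B x v) = v"
    and A: "\<And>v. continuous_on S (\<lambda>x. A x v)" and p: "p \<in> S"
  shows "isCont (\<lambda>x. B x v) p"
proof -
  obtain K where K: "\<And>v. norm (B p v) \<le> norm v * K" "K > 0"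
    using lB[OF p] by (metis bounded_linear.pos_bounded linear_conv_bounded_linear)
  have ev: "eventually (\<lambda>x. x \<in> S) (at p)"
    using S p by (simp add: eventually_at_in_open')
  have lim: "((\<lambda>x. A x v - A p v) \<longlongrightarrow> 0) (at p)" for v
    using A[of v] S p by (simp add: continuous_on_eq_continuous_at isCont_def LIM_zero)
  have "((\<lambda>x. \<Sum>b\<in>Basis. norm (A x b - A p b)) \<longlongrightarrow> 0) (at p)"
    using tendsto_sum[of Basis "\<lambda>b x. norm (A x b - A p b)" "\<lambda>_. 0"] lim tendsto_norm_zero by force
  \<comment> \<open>\<open>K\<close> bounds \<open>B p\<close>. If \<open>A x\<close> is this close
    to \<open>A p\<close>, the error in estimating \<open>norm a\<close> is at most
    \<open>norm a / 2\<close>; absorbing it on the left doubles the constant, whence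
    \<open>2 * K\<close> for \<open>B x\<close>.\<close>
  then have "eventually (\<lambda>x. (\<Sum>b\<in>Basis. norm (A x b - A p b)) < 1 / (2 * K)) (at p)"
    using K by (intro order_tendstoD) auto
  with ev have bd: "eventually (\<lambda>x. \<forall>w. norm (B x w) \<le> 2 * K * norm w) (at p)"
  proof eventually_elim
    case (elim x)
    show ?case
    proof
      fix w
      define a where "a = B x w"
      have lin: "linear (\<lambda>a. A x a - A p a)" using lA elim p by (intro linear_compose_sub) auto
      have "norm (A x a - A p a) = norm (\<Sum>b\<in>Basis. (a \<bullet> b) *\<^sub>R (A x b - A p b))"
        using linear_sum_Basis[OF lin, of a] by simp
      also have "\<dots> \<le> (\<Sum>b\<in>Basis. norm a * norm (A x b - A p b))"
        by (rule sum_norm_le) (simp add: Basis_le_norm mult_right_mono)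
      also have "\<dots> \<le> norm a * (1 / (2 * K))"
        unfolding sum_distrib_left[symmetric] using elim by (intro mult_left_mono) auto
      finally have 1: "norm (A x a - A p a) \<le> norm a / (2 * K)" by simp
      have "norm a \<le> norm (A p a) * K" using K(1)[of "A p a"] BA[OF p] by simp
      also have "\<dots> \<le> (norm (A x a) + norm (A x a - A p a)) * K"
        using K(2) norm_triangle_ineq4[of "A x a" "A x a - A p a"] by (intro mult_right_mono) auto
      also have "\<dots> \<le> (norm w + norm a / (2 * K)) * K"
        using 1 AB[of x w] elim K(2) by (intro mult_right_mono) (auto simp: a_def)
      also have "\<dots> = norm w * K + norm a / 2" using K(2) by (simp add: field_simps)
      finally show "norm (B x w) \<le> 2 * K * norm w" by (simp add: a_def field_simps)
    qed
  qed
  have "((\<lambda>x. 2 * K * norm (A x (B p v) - A p (B p v))) \<longlongrightarrow> 2 * K * 0) (at p)"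
    by (intro tendsto_intros tendsto_norm_zero lim)
  then have z: "((\<lambda>x. 2 * K * norm (A x (B p v) - A p (B p v))) \<longlongrightarrow> 0) (at p)" by simp
  have "eventually (\<lambda>x. norm (B x v - B p v) \<le> 2 * K * norm (A x (B p v) - A p (B p v))) (at p)"
    using ev bd
  proof eventually_elim
    case (elim x)
    have "B x v - B p v = B x (A p (B p v) - A x (B p v))"
      using elim BA AB lB[of x] p by (simp add: linear_diff)
    also have "norm \<dots> \<le> 2 * K * norm (A p (B p v) - A x (B p v))" using elim by blast
    finally show ?case by (simp add: norm_minus_commute)
  qed
  from Lim_null_comparison[OF this z] show ?thesis
    by (simp add: isCont_def LIM_zero_iff)
qed

text \<open>The derivative of \<open>x \<mapsto> B x v\<close> at \<open>p\<close> comes from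
  \<open>B x v - B p v = - B x ((A x - A p) (B p v))\<close>.\<close>

lemma Ck_inverse_operator:
  fixes A B :: "'a::euclidean_space \<Rightarrow> 'b::euclidean_space \<Rightarrow> 'b"
  assumes S: "open S" and lA: "\<And>x. x \<in> S \<Longrightarrow> linear (A x)" and lB: "\<And>x. x \<in> S \<Longrightarrow> linear (B x)"
    and BA: "\<And>x v. x \<in> S \<Longrightarrow> B x (A x v) = v" and AB: "\<And>x v. x \<in> S \<Longrightarrow> A x (B x v) = v"
    and A: "\<And>v. Ck k S (\<lambda>x. A x v)"
  shows "Ck k S (\<lambda>x. B x v)"
  using A
proof (induction k arbitrary: v)
  case 0
  have "isCont (\<lambda>x. B x v) x" if "x \<in> S" for x
    by (rule isCont_inverse_operator[where A = A and S = S]) (use assms that 0 in auto)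
  then show ?case by (simp add: continuous_at_imp_continuous_on)
next
  case (Suc k)
  define A' where "A' w x = frechet_derivative (\<lambda>x. A x w) (at x)" for w x
  have A': "((\<lambda>x. A x w) has_derivative A' w x) (at x)" if "x \<in> S" for w x
    unfolding A'_def frechet_derivative_works[symmetric] differentiable_def
    using Ck_SucE[OF Suc.prems] that by metis
  have A'k: "Ck k S (\<lambda>x. A' w x \<xi>)" for w \<xi>
    unfolding A'_def by (rule Ck_frechet_derivative[OF S Suc.prems])
  have IH: "Ck k S (\<lambda>x. B x v)" for v
    by (rule Suc.IH[OF Ck_Suc_imp_Ck[OF Suc.prems]])
  have cB: "isCont (\<lambda>x. B x v) x" if "x \<in> S" for x v
    by (rule isCont_inverse_operator[where A = A and S = S])
      (use assms that Suc.prems Ck_imp_continuous_on in blast)+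
  have D: "((\<lambda>x. B x v) has_derivative (\<lambda>\<xi>. - B p (A' (B p v) p \<xi>))) (at p)" if p: "p \<in> S" for p
  proof -
    define w where "w = B p v"
    \<comment> \<open>\<open>h\<close> vanishes at \<open>p\<close>, so the products of its
      coordinates with \<open>B x b\<close> are differentiable at \<open>p\<close> although
      \<open>B\<close> is only known to be continuous there.\<close>
    define h where "h x = A x w - A p w" for x
    have "((\<lambda>x. \<Sum>b\<in>Basis. (h x \<bullet> b) *\<^sub>R B x b) has_derivative
       (\<lambda>\<xi>. \<Sum>b\<in>Basis. (A' w p \<xi> \<bullet> b) *\<^sub>R B p b)) (at p)"
    proof (rule has_derivative_sum)
      fix b :: 'b assume "b \<in> Basis"
      have "((\<lambda>x. h x \<bullet> b) has_derivative (\<lambda>\<xi>. (A' w p \<xi> - 0) \<bullet> b)) (at p)"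
        unfolding h_def by (rule has_derivative_inner_left[OF has_derivative_diff[OF A'[OF p] has_derivative_const]])
      then show "((\<lambda>x. (h x \<bullet> b) *\<^sub>R B x b) has_derivative (\<lambda>\<xi>. (A' w p \<xi> \<bullet> b) *\<^sub>R B p b)) (at p)"
        using has_derivative_scaleR_zero[OF _ _ cB[OF p]] by (simp add: h_def)
    qed
    then have "((\<lambda>x. B p v - (\<Sum>b\<in>Basis. (h x \<bullet> b) *\<^sub>R B x b)) has_derivative
       (\<lambda>\<xi>. - (\<Sum>b\<in>Basis. (A' w p \<xi> \<bullet> b) *\<^sub>R B p b))) (at p)"
      using has_derivative_diff[OF has_derivative_const] by fastforce
    then have "((\<lambda>x. B x v) has_derivative
       (\<lambda>\<xi>. - (\<Sum>b\<in>Basis. (A' w p \<xi> \<bullet> b) *\<^sub>R B p b))) (at p)"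
    proof (rule has_derivative_transform_within_open[OF _ S p])
      fix x assume x: "x \<in> S"
      have "(\<Sum>b\<in>Basis. (h x \<bullet> b) *\<^sub>R B x b) = B x (A x w - A p w)"
        using linear_sum_Basis[OF lB[OF x], of "h x"] by (simp add: h_def)
      also have "\<dots> = w - B x v"
        using BA[OF x] AB[OF p] lB[OF x] by (simp add: linear_diff w_def)
      finally show "B p v - (\<Sum>b\<in>Basis. (h x \<bullet> b) *\<^sub>R B x b) = B x v" by (simp add: w_def)
    qed
    then show ?thesis
      by (simp only: linear_sum_Basis[OF lB[OF p], symmetric] w_def)
  qed
  \<comment> \<open>Bootstrapping: \<open>B\<close> has class \<open>k\<close> by induction and
    \<open>A'\<close> has class \<open>k\<close> as a derivative of \<open>A\<close>. The vector
    \<open>B x v\<close> fed to \<open>A'\<close> moves with \<open>x\<close>, which is why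
    linearity of \<open>A'\<close> in that vector is established first.\<close>
  have "Ck k S (\<lambda>x. - B x (A' (B x v) x \<xi>))" for \<xi>
  proof -
    have "Ck k S (\<lambda>x. A' (B x v) x \<xi>)"
    proof (rule Ck_apply_linear[of _ "\<lambda>x w. A' w x \<xi>"])
      show "linear (\<lambda>w. A' w x \<xi>)" if x: "x \<in> S" for x
      proof (rule linearI)
        show "A' (a + b) x \<xi> = A' a x \<xi> + A' b x \<xi>" for a b
        proof -
          have "((\<lambda>x. A x (a + b)) has_derivative (\<lambda>\<xi>. A' a x \<xi> + A' b x \<xi>)) (at x)"
            by (rule has_derivative_transform_within_open[OF has_derivative_add[OF A'[OF x] A'[OF x]] S x])
              (simp add: lA linear_add)
          then show ?thesis using has_derivative_unique[OF A'[OF x]] by metis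
        qed
        show "A' (r *\<^sub>R a) x \<xi> = r *\<^sub>R A' a x \<xi>" for a r
        proof -
          have "((\<lambda>x. A x (r *\<^sub>R a)) has_derivative (\<lambda>\<xi>. r *\<^sub>R A' a x \<xi>)) (at x)"
            by (rule has_derivative_transform_within_open[OF has_derivative_scaleR_right[OF A'[OF x]] S x])
              (simp add: lA linear_scale)
          then show ?thesis using has_derivative_unique[OF A'[OF x]] by metis
        qed
      qed
    qed (use S A'k IH in auto)
    then have "Ck k S (\<lambda>x. B x (A' (B x v) x \<xi>))"
      using Ck_apply_linear[where A = B and w = "\<lambda>x. A' (B x v) x \<xi>" and S = S and k = k] S lB IH
      by blast
    then show ?thesis by (rule Ck_bounded_linear[OF bounded_linear_minus[OF bounded_linear_ident]])
  qed
  with D show ?case by (intro Ck_SucI)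
qed

section \<open>Closure properties of smooth maps\<close>

lemma smooth_on_Ck: "smooth_on S f \<Longrightarrow> Ck k S f"
  by (simp add: smooth_on_def)

lemma smooth_on_cong:
  "open S \<Longrightarrow> (\<And>x. x \<in> S \<Longrightarrow> f x = g x) \<Longrightarrow> smooth_on S f \<Longrightarrow> smooth_on S g"
  unfolding smooth_on_def using Ck_cong by metis

lemma smooth_on_subset: "smooth_on S f \<Longrightarrow> T \<subseteq> S \<Longrightarrow> smooth_on T f"
  unfolding smooth_on_def using Ck_subset by metis

lemma smooth_on_local:
  assumes "\<And>x. x \<in> S \<Longrightarrow> \<exists>U. open U \<and> x \<in> U \<and> smooth_on U f"
  shows "smooth_on S f"
  unfolding smooth_on_def by (intro allI Ck_local) (meson assms smooth_on_Ck)

lemma smooth_on_const: "smooth_on S (\<lambda>x. a)"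
  by (simp add: smooth_on_def Ck_const)

lemma smooth_on_ident: "smooth_on S (\<lambda>x. x)"
  by (simp add: smooth_on_def Ck_ident)

lemma smooth_on_add: "smooth_on S f \<Longrightarrow> smooth_on S g \<Longrightarrow> smooth_on S (\<lambda>x. f x + g x)"
  by (simp add: smooth_on_def Ck_add)

lemma smooth_on_bounded_linear: "bounded_linear L \<Longrightarrow> smooth_on S f \<Longrightarrow> smooth_on S (\<lambda>x. L (f x))"
  by (simp add: smooth_on_def Ck_bounded_linear)

lemma smooth_on_compose:
  "open S \<Longrightarrow> smooth_on T g \<Longrightarrow> smooth_on S f \<Longrightarrow> f ` S \<subseteq> T \<Longrightarrow> smooth_on S (\<lambda>x. g (f x))"
  unfolding smooth_on_def using Ck_compose by metis

lemma smooth_on_Pair: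
  fixes f :: "'a::euclidean_space \<Rightarrow> 'b::euclidean_space" and g :: "'a \<Rightarrow> 'c::euclidean_space"
  assumes "smooth_on S f" "smooth_on S g"
  shows "smooth_on S (\<lambda>x. (f x, g x))"
proof -
  have "bounded_linear (\<lambda>a::'b. (a, 0::'c))" "bounded_linear (\<lambda>b::'c. (0::'b, b))"
    by (intro bounded_linear_Pair bounded_linear_ident bounded_linear_zero)+
  from smooth_on_add[OF smooth_on_bounded_linear[OF this(1) assms(1)]
      smooth_on_bounded_linear[OF this(2) assms(2)]]
  show ?thesis by simp
qed

lemma smooth_on_continuous_on: "smooth_on S f \<Longrightarrow> continuous_on S f"
  using smooth_on_Ck Ck_imp_continuous_on by blast

lemma smooth_on_differentiable:
  assumes "smooth_on S f" "x \<in> S"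
  shows "f differentiable (at x)"
  using Ck_SucE[OF smooth_on_Ck[OF assms(1)]] assms(2) unfolding differentiable_def by metis

lemma smooth_on_has_derivative:
  "smooth_on S f \<Longrightarrow> x \<in> S \<Longrightarrow> (f has_derivative frechet_derivative f (at x)) (at x)"
  using smooth_on_differentiable frechet_derivative_works by blast

text \<open>A derivative at a moving point in a moving direction: the shape of the fibre coordinate
  of a differential, and of a coordinate change of the tangent bundle.\<close>

lemma smooth_on_frechet_derivative:
  assumes "open S" "smooth_on T f" "smooth_on S h" "h ` S \<subseteq> T" "smooth_on S w" "open T"
  shows "smooth_on S (\<lambda>x. frechet_derivative f (at (h x)) (w x))"
  unfolding smooth_on_def
proof
  fix k
  show "Ck k S (\<lambda>x. frechet_derivative f (at (h x)) (w x))"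
  proof (rule Ck_apply_linear[where A = "\<lambda>x. frechet_derivative f (at (h x))"])
    show "linear (frechet_derivative f (at (h x)))" if "x \<in> S" for x
    proof -
      have "h x \<in> T" using that assms(4) by blast
      then show ?thesis using smooth_on_has_derivative[OF assms(2)] has_derivative_linear by blast
    qed
    show "Ck k S (\<lambda>x. frechet_derivative f (at (h x)) v)" for v
      by (rule Ck_compose[OF assms(1) Ck_frechet_derivative[OF assms(6) smooth_on_Ck[OF assms(2)]]
            smooth_on_Ck[OF assms(3)] assms(4)])
  qed (use assms smooth_on_Ck in auto)
qed

section \<open>Local inverses of smooth maps\<close>

text \<open>The derivative of \<open>g\<close> at \<open>y\<close> is the inverse of the derivative
  of \<open>f\<close> at \<open>g y\<close>. So if \<open>g\<close> has class \<open>k\<close>,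
  operator inversion gives \<open>g'\<close> class \<open>k\<close>, and \<open>g\<close> gains one
  class; iterating gives smoothness. That the derivative at \<open>a\<close> is the identity is a
  normalisation achieved by composing with a linear map.\<close>

lemma inverse_function_theorem_smooth:
  fixes f :: "'a::euclidean_space \<Rightarrow> 'a"
  assumes S: "open S" and f: "smooth_on S f" and a: "a \<in> S"
    and id: "frechet_derivative f (at a) = id"
  obtains U V g where "open U" "a \<in> U" "U \<subseteq> S" "open V" "homeomorphism U V f g" "smooth_on V g"
proof -
  define f' where "f' x = Blinfun (frechet_derivative f (at x))" for x
  have f': "blinfun_apply (f' x) = frechet_derivative f (at x)" if "x \<in> S" for x
    using smooth_on_has_derivative[OF f that] unfolding f'_def
    by (simp add: bounded_linear_Blinfun_apply has_derivative_bounded_linear)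
  have der: "(f has_derivative blinfun_apply (f' x)) (at x)" if "x \<in> S" for x
    using smooth_on_has_derivative[OF f that] f'[OF that] by simp
  have sm: "smooth_on S (\<lambda>x. blinfun_apply (f' x) v)" for v
    by (rule smooth_on_cong[OF S _ smooth_on_frechet_derivative[OF S f smooth_on_ident _ smooth_on_const S]])
      (simp_all add: f')
  have cont: "continuous_on S f'"
    by (rule continuous_on_blinfun_componentwise) (rule smooth_on_continuous_on[OF sm])
  have inv: "id_blinfun o\<^sub>L f' a = id_blinfun"
    by (rule blinfun_eqI) (simp add: f' a id)
  obtain U V g g' where UV: "open U" "U \<subseteq> S" "a \<in> U" "open V" "homeomorphism U V f g"
    and g: "\<And>y. y \<in> V \<Longrightarrow> (g has_derivative g' y) (at y)"
      "\<And>y. y \<in> V \<Longrightarrow> g' y = Hilbert_Choice.inv (blinfun_apply (f' (g y)))"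
      "\<And>y. y \<in> V \<Longrightarrow> bij (blinfun_apply (f' (g y)))"
    using inverse_function_theorem[OF S der cont a inv] by metis
  have gV: "g ` V \<subseteq> S" using UV by (auto simp: homeomorphism_def)
  have "Ck k V g" for k
  proof (induction k)
    case 0
    then show ?case using UV by (simp add: homeomorphism_def)
  next
    case (Suc k)
    have "Ck k V (\<lambda>y. g' y v)" for v
    proof (rule Ck_inverse_operator[where A = "\<lambda>y. blinfun_apply (f' (g y))"])
      show "linear (blinfun_apply (f' (g y)))" if "y \<in> V" for y
        using blinfun.bounded_linear_right linear_conv_bounded_linear by blast
      show "linear (g' y)" if "y \<in> V" for y
        using g(1)[OF that] has_derivative_linear by blast
      show "g' y (blinfun_apply (f' (g y)) v) = v" "blinfun_apply (f' (g y)) (g' y v) = v" if "y \<in> V" for y v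
        using g(2,3)[OF that] by (simp_all add: bij_is_inj bij_is_surj surj_f_inv_f)
      show "Ck k V (\<lambda>y. blinfun_apply (f' (g y)) v)" for v
        by (rule Ck_compose[OF UV(4) smooth_on_Ck[OF sm] Suc gV])
    qed fact
    with g(1) show ?case by (intro Ck_SucI)
  qed
  then have "smooth_on V g" by (simp add: smooth_on_def)
  with UV show ?thesis by (intro that)
qed

text \<open>A linear left inverse \<open>L\<close> of the derivative at \<open>a\<close> makes the
  derivative of \<open>L \<circ> f\<close> the identity there; if \<open>g\<close> is its local
  inverse, then \<open>r\<close> is \<open>g \<circ> L\<close>. The domain of \<open>r\<close> is a
  preimage under \<open>L\<close>, hence open in the target, which is what extending fields off the
  image of \<open>f\<close> requires.\<close>

lemma smooth_left_inverse:
  fixes f :: "'a::euclidean_space \<Rightarrow> 'b::euclidean_space"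
  assumes S: "open S" and f: "smooth_on S f" and a: "a \<in> S"
    and inj: "inj (frechet_derivative f (at a))"
  obtains U V r where "open U" "a \<in> U" "U \<subseteq> S" "open V" "f ` U \<subseteq> V" "smooth_on V r" "r ` V \<subseteq> U"
    "\<And>x. x \<in> U \<Longrightarrow> r (f x) = x"
proof -
  have lin: "linear (frechet_derivative f (at a))"
    using smooth_on_has_derivative[OF f a] has_derivative_linear by blast
  obtain L where L: "linear L" "L \<circ> frechet_derivative f (at a) = id"
    using linear_injective_left_inverse[OF lin inj] by blast
  have bL: "bounded_linear L" using L(1) linear_conv_bounded_linear by blast
  have "((\<lambda>x. L (f x)) has_derivative (\<lambda>v. L (frechet_derivative f (at a) v))) (at a)"
    by (rule bounded_linear.has_derivative[OF bL smooth_on_has_derivative[OF f a]])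
  then have "frechet_derivative (\<lambda>x. L (f x)) (at a) = id"
    using frechet_derivative_at L(2) by (metis comp_def ext)
  from inverse_function_theorem_smooth[OF S smooth_on_bounded_linear[OF bL f] a this]
  obtain U V g where UV: "open U" "a \<in> U" "U \<subseteq> S" "open V" "homeomorphism U V (\<lambda>x. L (f x)) g" "smooth_on V g"
    by metis
  show ?thesis
  proof (rule that[of U "L -` V" "\<lambda>y. g (L y)"])
    show "open (L -` V)"
      using UV(4) bL by (simp add: open_vimage linear_continuous_on)
    then show "smooth_on (L -` V) (\<lambda>y. g (L y))"
      using smooth_on_compose[OF _ UV(6) smooth_on_bounded_linear[OF bL smooth_on_ident]] by blast
  qed (use UV in \<open>auto simp: homeomorphism_def\<close>)
qed

section \<open>Differentials in charts\<close>

text \<open>Functions that agree near \<open>x\<close> have the same candidate derivatives, so the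
  choice hidden in \<open>frechet_derivative\<close> falls on the same one, whether or not a
  derivative exists.\<close>

lemma frechet_derivative_cong_open:
  assumes "open S" "x \<in> S" "\<And>y. y \<in> S \<Longrightarrow> f y = g y"
  shows "frechet_derivative f (at x) = frechet_derivative g (at x)"
proof -
  have "(f has_derivative f') (at x) \<longleftrightarrow> (g has_derivative f') (at x)" for f'
    using has_derivative_transform_within_open[OF _ assms(1,2), of _ _ UNIV] assms(3) by metis
  then show ?thesis by (simp add: frechet_derivative_def)
qed

text \<open>\<open>smooth_manifold\<close> without its topological conditions, which then need not be verified for
  tangent bundles.\<close>

definition smooth_atlas :: "('a, 'e::euclidean_space) atlas \<Rightarrow> bool" where
  "smooth_atlas A \<longleftrightarrow>
     (\<forall>c\<in>A. inj_on (snd c) (fst c) \<and> open (snd c ` fst c)) \<and>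
     (\<forall>c\<in>A. \<forall>d\<in>A. open (snd c ` (fst c \<inter> fst d)) \<and>
        smooth_on (snd c ` (fst c \<inter> fst d)) (snd d \<circ> inv_chart c))"

text \<open>With the identity for \<open>f\<close> this is a change of coordinates, so the rules for
  transition maps become instances of the rules for smooth maps.\<close>

definition chart_rep :: "('a, 'e) chart \<Rightarrow> ('b, 'f) chart \<Rightarrow> ('a \<Rightarrow> 'b) \<Rightarrow> 'e \<Rightarrow> 'f" where
  "chart_rep c d f = snd d \<circ> f \<circ> inv_chart c"

definition chart_diff ::
  "('a, 'e::euclidean_space) chart \<Rightarrow> ('b, 'f::euclidean_space) chart \<Rightarrow> ('a \<Rightarrow> 'b) \<Rightarrow> 'a \<Rightarrow> 'e \<Rightarrow> 'f"
where
  "chart_diff c d f p = frechet_derivative (chart_rep c d f) (at (snd c p))"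

lemma smooth_manifold_imp_smooth_atlas: "smooth_manifold A \<Longrightarrow> smooth_atlas A"
  by (simp add: smooth_manifold_def smooth_atlas_def)

lemma charts_atD: "c \<in> charts_at A p \<Longrightarrow> c \<in> A" "c \<in> charts_at A p \<Longrightarrow> p \<in> fst c"
  by (simp_all add: charts_at_def)

lemma charts_atI: "c \<in> A \<Longrightarrow> p \<in> fst c \<Longrightarrow> c \<in> charts_at A p"
  by (simp add: charts_at_def)

lemma charts_at_imp_points: "c \<in> charts_at A p \<Longrightarrow> p \<in> points A"
  unfolding points_def charts_at_def by blast

lemma pointsE:
  assumes "p \<in> points A"
  obtains c where "c \<in> charts_at A p"
  using assms by (auto simp: points_def charts_at_def)

context
  fixes A :: "('a, 'e::euclidean_space) atlas"
  assumes A: "smooth_atlas A"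
begin

lemma inj_on_chart: "c \<in> A \<Longrightarrow> inj_on (snd c) (fst c)"
  using A by (simp add: smooth_atlas_def)

lemma open_chart_image: "c \<in> A \<Longrightarrow> open (snd c ` fst c)"
  using A by (simp add: smooth_atlas_def)

lemma inv_chart_chart: "c \<in> A \<Longrightarrow> p \<in> fst c \<Longrightarrow> inv_chart c (snd c p) = p"
  using A by (simp add: smooth_atlas_def inv_chart_def)

lemma chart_eq_iff: "c \<in> A \<Longrightarrow> p \<in> fst c \<Longrightarrow> q \<in> fst c \<Longrightarrow> snd c p = snd c q \<longleftrightarrow> p = q"
  using inj_on_chart inj_on_eq_iff by metis

lemma chart_mem_image_iff: "c \<in> A \<Longrightarrow> p \<in> fst c \<Longrightarrow> X \<subseteq> fst c \<Longrightarrow> snd c p \<in> snd c ` X \<longleftrightarrow> p \<in> X"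
  using inj_on_chart inj_on_image_mem_iff by metis

lemma chart_rep_chart: "c \<in> A \<Longrightarrow> p \<in> fst c \<Longrightarrow> chart_rep c d f (snd c p) = snd d (f p)"
  by (simp add: chart_rep_def inv_chart_chart)

lemma open_transition_domain: "c \<in> A \<Longrightarrow> d \<in> A \<Longrightarrow> open (snd c ` (fst c \<inter> fst d))"
  using A by (simp add: smooth_atlas_def)

lemma smooth_transition: "c \<in> A \<Longrightarrow> d \<in> A \<Longrightarrow> smooth_on (snd c ` (fst c \<inter> fst d)) (chart_rep c d (\<lambda>x. x))"
  using A by (simp add: smooth_atlas_def chart_rep_def comp_def)

lemma smooth_map_on_id: "smooth_map_on A (points A) A (\<lambda>x. x)"
proof -
  have "points A \<inter> fst c \<inter> (\<lambda>x. x) -` fst d = fst c \<inter> fst d" if "c \<in> A" for c d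
    using that by (auto simp: points_def)
  then show ?thesis
    unfolding smooth_map_on_def
    using open_transition_domain smooth_transition by (auto simp: chart_rep_def comp_def)
qed

text \<open>\<open>manifold_topology\<close> is built with \<open>topology\<close>, which has the
  intended open sets only for families closed under binary intersections and unions. Intersections
  pass through the chart images because charts are injective.\<close>

lemma istopology_manifold:
  "istopology (\<lambda>W. W \<subseteq> points A \<and> (\<forall>c\<in>A. open (snd c ` (W \<inter> fst c))))"
  unfolding istopology_def
proof (intro conjI allI impI)
  fix S T assume ST: "S \<subseteq> points A \<and> (\<forall>c\<in>A. open (snd c ` (S \<inter> fst c)))"
    "T \<subseteq> points A \<and> (\<forall>c\<in>A. open (snd c ` (T \<inter> fst c)))"
  then show "S \<inter> T \<subseteq> points A" by blast
  show "\<forall>c\<in>A. open (snd c ` (S \<inter> T \<inter> fst c))"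
  proof
    fix c assume c: "c \<in> A"
    have "snd c ` (S \<inter> T \<inter> fst c) = snd c ` (S \<inter> fst c) \<inter> snd c ` (T \<inter> fst c)"
      using inj_on_image_Int[OF inj_on_chart[OF c], of "S \<inter> fst c" "T \<inter> fst c"]
      by (simp add: Int_ac)
    then show "open (snd c ` (S \<inter> T \<inter> fst c))" using ST c by (simp add: open_Int)
  qed
next
  fix \<K> assume K: "\<forall>S\<in>\<K>. S \<subseteq> points A \<and> (\<forall>c\<in>A. open (snd c ` (S \<inter> fst c)))"
  then show "\<Union> \<K> \<subseteq> points A" by blast
  show "\<forall>c\<in>A. open (snd c ` (\<Union> \<K> \<inter> fst c))"
  proof
    fix c assume c: "c \<in> A"
    have "snd c ` (\<Union> \<K> \<inter> fst c) = (\<Union>S\<in>\<K>. snd c ` (S \<inter> fst c))" by blast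
    then show "open (snd c ` (\<Union> \<K> \<inter> fst c))" using K c by (simp add: open_UN)
  qed
qed

lemma openin_manifold:
  "openin (manifold_topology A) W \<longleftrightarrow> W \<subseteq> points A \<and> (\<forall>c\<in>A. open (snd c ` (W \<inter> fst c)))"
  unfolding manifold_topology_def using istopology_manifold by (simp add: topology_inverse')

lemma openin_chart_vimage:
  assumes "c \<in> A" "open U"
  shows "openin (manifold_topology A) (fst c \<inter> snd c -` U)"
  unfolding openin_manifold
proof (intro conjI ballI)
  show "fst c \<inter> snd c -` U \<subseteq> points A" using assms by (auto simp: points_def)
  fix d assume d: "d \<in> A"
  have "snd d ` (fst c \<inter> snd c -` U \<inter> fst d)
      = snd d ` (fst d \<inter> fst c) \<inter> chart_rep d c (\<lambda>x. x) -` U"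
    using d by (auto simp: chart_rep_chart)
  moreover have "open \<dots>"
    using continuous_open_preimage[OF smooth_on_continuous_on[OF smooth_transition[OF d assms(1)]]
        open_transition_domain[OF d assms(1)] assms(2)] .
  ultimately show "open (snd d ` (fst c \<inter> snd c -` U \<inter> fst d))" by simp
qed

lemma openin_chart: "c \<in> A \<Longrightarrow> openin (manifold_topology A) (fst c)"
  using openin_chart_vimage[of c UNIV] by simp

end

section \<open>Smooth maps between manifolds\<close>

lemma smooth_map_onD:
  assumes "smooth_map_on A W B f" "c \<in> A" "d \<in> B"
  shows "open (snd c ` (W \<inter> fst c \<inter> f -` fst d))"
    and "smooth_on (snd c ` (W \<inter> fst c \<inter> f -` fst d)) (chart_rep c d f)"
  using assms by (simp_all add: smooth_map_on_def chart_rep_def)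

lemma smooth_map_on_points: "smooth_map_on A W B f \<Longrightarrow> p \<in> W \<Longrightarrow> f p \<in> points B"
  by (auto simp: smooth_map_on_def)

text \<open>\<open>smooth_map_on\<close> speaks of all pairs of charts, but any two pairs around a
  point differ by transition maps, so one pair per point is enough. The inclusion of
  \<open>S\<close> in the image of \<open>W\<close> also carries the required openness.\<close>

lemma smooth_map_onI:
  assumes A: "smooth_atlas A" and B: "smooth_atlas B"
    and loc: "\<And>p. p \<in> W \<Longrightarrow> \<exists>c\<in>charts_at A p. \<exists>d\<in>charts_at B (f p). \<exists>S. open S \<and> snd c p \<in> S \<and>
       S \<subseteq> snd c ` (W \<inter> fst c \<inter> f -` fst d) \<and> smooth_on S (chart_rep c d f)"
  shows "smooth_map_on A W B f"
  unfolding smooth_map_on_def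
proof (intro conjI ballI)
  show "f ` W \<subseteq> points B" using loc charts_at_imp_points[of _ B] by fast
  fix c' d' assume c': "c' \<in> A" and d': "d' \<in> B"
  let ?T = "snd c' ` (W \<inter> fst c' \<inter> f -` fst d')"
  have main: "\<exists>Q. open Q \<and> x \<in> Q \<and> Q \<subseteq> ?T \<and> smooth_on Q (chart_rep c' d' f)" if x: "x \<in> ?T" for x
  proof -
    obtain p where p: "x = snd c' p" "p \<in> W" "p \<in> fst c'" "f p \<in> fst d'" using x by blast
    obtain c d S where c: "c \<in> A" "p \<in> fst c" and d: "d \<in> B" "f p \<in> fst d" and S: "open S" "snd c p \<in> S"
       "S \<subseteq> snd c ` (W \<inter> fst c \<inter> f -` fst d)" "smooth_on S (chart_rep c d f)"
      using loc[OF p(2)] charts_atD by metis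
    \<comment> \<open>To replace \<open>d\<close> by \<open>d'\<close> the image must lie in both
      domains, which cuts \<open>S\<close> down to \<open>S2\<close>; \<open>Q\<close> is then the
      part of \<open>S2\<close> seen in the chart \<open>c'\<close>.\<close>
    define S2 where "S2 = S \<inter> chart_rep c d f -` (snd d ` (fst d \<inter> fst d'))"
    have S2: "open S2" unfolding S2_def
      by (rule continuous_open_preimage[OF smooth_on_continuous_on[OF S(4)] S(1)
          open_transition_domain[OF B d(1) d']])
    define Q where "Q = snd c' ` (fst c' \<inter> fst c) \<inter> chart_rep c' c (\<lambda>x. x) -` S2"
    have Q: "open Q" unfolding Q_def
      by (rule continuous_open_preimage[OF smooth_on_continuous_on[OF smooth_transition[OF A c' c(1)]]
          open_transition_domain[OF A c' c(1)] S2])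
    have x: "x \<in> Q" using p c d S c' by (auto simp: Q_def S2_def chart_rep_chart[OF A])
    \<comment> \<open>Membership in \<open>Q\<close> is a condition on coordinates; injectivity of
      the charts turns it back into conditions on the point \<open>q\<close>.\<close>
    have elt: "\<exists>q. y = snd c' q \<and> q \<in> W \<and> q \<in> fst c' \<and> q \<in> fst c \<and> f q \<in> fst d \<and> f q \<in> fst d' \<and> snd c q \<in> S2"
      if y: "y \<in> Q" for y
    proof -
      obtain q where q: "y = snd c' q" "q \<in> fst c'" "q \<in> fst c" "snd c q \<in> S2"
        using y c' by (auto simp: Q_def chart_rep_chart[OF A])
      then have "snd c q \<in> snd c ` (W \<inter> fst c \<inter> f -` fst d)" using S(3) by (auto simp: S2_def)
      then have qW: "q \<in> W \<inter> fst c \<inter> f -` fst d"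
        using chart_mem_image_iff[OF A c(1) q(3), of "W \<inter> fst c \<inter> f -` fst d"] by blast
      have "snd d (f q) \<in> snd d ` (fst d \<inter> fst d')"
        using q(4) c(1) q(3) by (simp add: S2_def chart_rep_chart[OF A])
      then have "f q \<in> fst d'"
        using chart_mem_image_iff[OF B d(1), of "f q" "fst d \<inter> fst d'"] qW by blast
      with q qW show ?thesis by blast
    qed
    have "smooth_on Q (\<lambda>y. chart_rep c d f (chart_rep c' c (\<lambda>x. x) y))"
    proof (rule smooth_on_compose[OF Q S(4)])
      show "smooth_on Q (chart_rep c' c (\<lambda>x. x))"
        by (rule smooth_on_subset[OF smooth_transition[OF A c' c(1)]]) (auto simp: Q_def)
    qed (auto simp: Q_def S2_def)
    then have "smooth_on Q (\<lambda>y. chart_rep d d' (\<lambda>x. x) (chart_rep c d f (chart_rep c' c (\<lambda>x. x) y)))"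
      by (rule smooth_on_compose[OF Q smooth_transition[OF B d(1) d']]) (auto simp: Q_def S2_def)
    then have "smooth_on Q (chart_rep c' d' f)"
    proof (rule smooth_on_cong[OF Q, rotated])
      fix y assume "y \<in> Q"
      then obtain q where "y = snd c' q" "q \<in> W" "q \<in> fst c'" "q \<in> fst c" "f q \<in> fst d" using elt by blast
      then show "chart_rep d d' (\<lambda>x. x) (chart_rep c d f (chart_rep c' c (\<lambda>x. x) y)) = chart_rep c' d' f y"
        using c' c d by (simp add: chart_rep_chart[OF A] chart_rep_chart[OF B])
    qed
    moreover have "Q \<subseteq> ?T" using elt by blast
    ultimately show ?thesis using Q x by blast
  qed
  show "open ?T" using main by (subst open_subopen) blast
  show "smooth_on ?T (snd d' \<circ> f \<circ> inv_chart c')"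
    unfolding chart_rep_def[symmetric] using main by (intro smooth_on_local) blast
qed

lemma smooth_map_on_compose:
  assumes A: "smooth_atlas A" and B: "smooth_atlas B" and C: "smooth_atlas C"
    and f: "smooth_map_on A W B f" and g: "smooth_map_on B V C g" and fW: "f ` W \<subseteq> V"
    and W: "W \<subseteq> points A"
  shows "smooth_map_on A W C (\<lambda>q. g (f q))"
proof (rule smooth_map_onI[OF A C])
  fix p assume p: "p \<in> W"
  obtain c where c: "c \<in> charts_at A p" using p W by (blast elim: pointsE)
  obtain d where d: "d \<in> charts_at B (f p)" using smooth_map_on_points[OF f p] by (rule pointsE)
  have "f p \<in> V" using p fW by blast
  then obtain e where e: "e \<in> charts_at C (g (f p))"
    using smooth_map_on_points[OF g] by (blast elim: pointsE)
  note c' = charts_atD[OF c] and d' = charts_atD[OF d] and e' = charts_atD[OF e]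
  let ?S = "snd c ` (W \<inter> fst c \<inter> f -` fst d)"
  let ?T = "snd d ` (V \<inter> fst d \<inter> g -` fst e)"
  note f' = smooth_map_onD[OF f c'(1) d'(1)] and g' = smooth_map_onD[OF g d'(1) e'(1)]
  define Q where "Q = ?S \<inter> chart_rep c d f -` ?T"
  have Q: "open Q" unfolding Q_def
    by (rule continuous_open_preimage[OF smooth_on_continuous_on[OF f'(2)] f'(1) g'(1)])
  have elt: "\<exists>q. y = snd c q \<and> q \<in> W \<and> q \<in> fst c \<and> f q \<in> fst d \<and> g (f q) \<in> fst e" if y: "y \<in> Q" for y
  proof -
    obtain q where q: "y = snd c q" "q \<in> W" "q \<in> fst c" "f q \<in> fst d" "chart_rep c d f y \<in> ?T"
      using y by (auto simp: Q_def)
    then have "snd d (f q) \<in> ?T" using c'(1) by (simp add: chart_rep_chart[OF A])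
    then have "f q \<in> V \<inter> fst d \<inter> g -` fst e"
      using chart_mem_image_iff[OF B d'(1) q(4), of "V \<inter> fst d \<inter> g -` fst e"] by blast
    with q show ?thesis by blast
  qed
  have "smooth_on Q (\<lambda>y. chart_rep d e g (chart_rep c d f y))"
    by (rule smooth_on_compose[OF Q g'(2) smooth_on_subset[OF f'(2)]]) (auto simp: Q_def)
  then have "smooth_on Q (chart_rep c e (\<lambda>q. g (f q)))"
  proof (rule smooth_on_cong[OF Q, rotated])
    fix y assume "y \<in> Q"
    then obtain q where "y = snd c q" "q \<in> fst c" "f q \<in> fst d" using elt by blast
    then show "chart_rep d e g (chart_rep c d f y) = chart_rep c e (\<lambda>q. g (f q)) y"
      using c' d' by (simp add: chart_rep_chart[OF A] chart_rep_chart[OF B])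
  qed
  moreover have "Q \<subseteq> snd c ` (W \<inter> fst c \<inter> (\<lambda>q. g (f q)) -` fst e)" using elt by blast
  moreover have "snd c p \<in> Q"
    using p c' d' e' \<open>f p \<in> V\<close> by (auto simp: Q_def chart_rep_chart[OF A])
  ultimately show "\<exists>c\<in>charts_at A p. \<exists>d\<in>charts_at C (g (f p)). \<exists>S. open S \<and> snd c p \<in> S \<and>
       S \<subseteq> snd c ` (W \<inter> fst c \<inter> (\<lambda>q. g (f q)) -` fst d) \<and> smooth_on S (chart_rep c d (\<lambda>q. g (f q)))"
    using c e Q by blast
qed

lemma smooth_map_on_cong_open:
  assumes A: "smooth_atlas A" and f: "smooth_map_on A W B f"
    and W': "openin (manifold_topology A) W'" "W' \<subseteq> W" and fg: "\<And>q. q \<in> W' \<Longrightarrow> f q = g q"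
  shows "smooth_map_on A W' B g"
  unfolding smooth_map_on_def
proof (intro conjI ballI)
  show "g ` W' \<subseteq> points B"
    using smooth_map_on_points[OF f] W'(2) fg by (metis image_subsetI subsetD)
  fix c d assume c: "c \<in> A" and d: "d \<in> B"
  have "snd c ` (W' \<inter> fst c \<inter> g -` fst d) = snd c ` (W' \<inter> fst c) \<inter> snd c ` (W \<inter> fst c \<inter> f -` fst d)"
    (is "?T = _")
  proof -
    have "W' \<inter> fst c \<inter> g -` fst d = (W' \<inter> fst c) \<inter> (W \<inter> fst c \<inter> f -` fst d)" using W'(2) fg by auto
    moreover have "W' \<inter> fst c \<subseteq> fst c" "W \<inter> fst c \<inter> f -` fst d \<subseteq> fst c" by blast+
    ultimately show ?thesis using inj_on_image_Int[OF inj_on_chart[OF A c]] by metis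
  qed
  then have T: "open ?T" "?T \<subseteq> snd c ` (W \<inter> fst c \<inter> f -` fst d)"
    using W'(1) openin_manifold[OF A] c smooth_map_onD(1)[OF f c d] by auto
  show "open ?T" by fact
  show "smooth_on ?T (snd d \<circ> g \<circ> inv_chart c)"
    by (rule smooth_on_cong[OF T(1) _ smooth_on_subset[OF smooth_map_onD(2)[OF f c d] T(2)]])
      (auto simp: chart_rep_def inv_chart_chart[OF A c] fg)
qed

lemma smooth_map_on_subset:
  "smooth_atlas A \<Longrightarrow> smooth_map_on A W B f \<Longrightarrow> openin (manifold_topology A) W' \<Longrightarrow> W' \<subseteq> W \<Longrightarrow>
    smooth_map_on A W' B f"
  by (rule smooth_map_on_cong_open) auto

section \<open>Chart Jacobians and tangent vectors\<close>

lemma chart_rep_has_derivative: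
  assumes "smooth_map_on A W B f" "p \<in> W" "c \<in> charts_at A p" "d \<in> charts_at B (f p)"
  shows "(chart_rep c d f has_derivative chart_diff c d f p) (at (snd c p))"
  unfolding chart_diff_def
  by (rule smooth_on_has_derivative[OF smooth_map_onD(2)[OF assms(1)]])
     (use assms in \<open>auto simp: charts_at_def\<close>)

lemma linear_chart_diff:
  assumes "smooth_map_on A W B f" "p \<in> W" "c \<in> charts_at A p" "d \<in> charts_at B (f p)"
  shows "linear (chart_diff c d f p)"
  using chart_rep_has_derivative[OF assms] has_derivative_linear by blast

text \<open>The chain rule for representations in charts. Inserting the identity for
  \<open>f\<close> or \<open>g\<close> yields the rules for changing the source or the target
  chart.\<close>

lemma chart_diff_compose:
  assumes A: "smooth_atlas A" and B: "smooth_atlas B"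
    and f: "smooth_map_on A W B f" and g: "smooth_map_on B V C g"
    and p: "p \<in> W" "f p \<in> V"
    and c: "c \<in> charts_at A p" and d: "d \<in> charts_at B (f p)" and e: "e \<in> charts_at C (g (f p))"
  shows "chart_diff c e (\<lambda>q. g (f q)) p v = chart_diff d e g (f p) (chart_diff c d f p v)"
proof -
  note c' = charts_atD[OF c] and d' = charts_atD[OF d]
  have g': "(chart_rep d e g has_derivative chart_diff d e g (f p)) (at (chart_rep c d f (snd c p)))"
    using chart_rep_has_derivative[OF g p(2) d e] c' by (simp add: chart_rep_chart[OF A])
  have "((\<lambda>x. chart_rep d e g (chart_rep c d f x)) has_derivative (\<lambda>v. chart_diff d e g (f p) (chart_diff c d f p v))) (at (snd c p))"
    by (rule has_derivative_compose[OF chart_rep_has_derivative[OF f p(1) c d] g'])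
  then have "(chart_rep c e (\<lambda>q. g (f q)) has_derivative (\<lambda>v. chart_diff d e g (f p) (chart_diff c d f p v))) (at (snd c p))"
  proof (rule has_derivative_transform_within_open[OF _ smooth_map_onD(1)[OF f c'(1) d'(1)]])
    show "snd c p \<in> snd c ` (W \<inter> fst c \<inter> f -` fst d)" using p c' d' by blast
    show "chart_rep d e g (chart_rep c d f x) = chart_rep c e (\<lambda>q. g (f q)) x" if "x \<in> snd c ` (W \<inter> fst c \<inter> f -` fst d)" for x
      using that c' d' by (auto simp: chart_rep_chart[OF A] chart_rep_chart[OF B])
  qed
  then show ?thesis unfolding chart_diff_def[of c e] using frechet_derivative_at by metis
qed

lemma chart_diff_cong:
  assumes A: "smooth_atlas A" and W: "openin (manifold_topology A) W" "p \<in> W"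
    and fg: "\<And>q. q \<in> W \<Longrightarrow> f q = g q" and c: "c \<in> charts_at A p"
  shows "chart_diff c d f p = chart_diff c d g p"
  unfolding chart_diff_def
proof (rule frechet_derivative_cong_open[of "snd c ` (W \<inter> fst c)"])
  show "open (snd c ` (W \<inter> fst c))" using W(1) charts_atD[OF c] by (simp add: openin_manifold[OF A])
  show "snd c p \<in> snd c ` (W \<inter> fst c)" using W charts_atD[OF c] by blast
  show "chart_rep c d f y = chart_rep c d g y" if "y \<in> snd c ` (W \<inter> fst c)" for y
    using that fg charts_atD[OF c] by (auto simp: chart_rep_chart[OF A])
qed

lemma chart_diff_id_same:
  assumes A: "smooth_atlas A" and c: "c \<in> charts_at A p"
  shows "chart_diff c c (\<lambda>x. x) p v = v"
proof -
  note c' = charts_atD[OF c]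
  have "chart_diff c c (\<lambda>x. x) p = frechet_derivative (\<lambda>x. x) (at (snd c p))"
    unfolding chart_diff_def
    by (rule frechet_derivative_cong_open[OF open_chart_image[OF A c'(1)]])
      (use c' in \<open>auto simp: chart_rep_chart[OF A]\<close>)
  then show ?thesis by simp
qed

lemma mem_tangent_space:
  "u \<in> tangent_space A p \<longleftrightarrow> fst u = p \<and>
     (\<forall>c\<in>charts_at A p. \<forall>d\<in>charts_at A p. snd u d = chart_diff c d (\<lambda>x. x) p (snd u c)) \<and>
     (\<forall>c. c \<notin> charts_at A p \<longrightarrow> snd u c = 0)"
  unfolding tangent_space_def chart_diff_def chart_rep_def by (cases u) (auto simp: comp_def)

lemma tangent_transition:
  "u \<in> tangent_space A p \<Longrightarrow> c \<in> charts_at A p \<Longrightarrow> d \<in> charts_at A p \<Longrightarrow>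
    snd u d = chart_diff c d (\<lambda>x. x) p (snd u c)"
  unfolding mem_tangent_space by blast

lemma tangent_outside: "u \<in> tangent_space A p \<Longrightarrow> c \<notin> charts_at A p \<Longrightarrow> snd u c = 0"
  unfolding mem_tangent_space by blast

lemma fst_tangent: "u \<in> tangent_space A p \<Longrightarrow> fst u = p"
  by (simp add: mem_tangent_space)

text \<open>The transition rule determines the coordinates in all other charts at \<open>p\<close>,
  and the convention \<open>0\<close> those in the remaining charts. Identities between tangent
  vectors can thus be checked in a single chart.\<close>

lemma tangent_eqI:
  assumes "u \<in> tangent_space A p" "v \<in> tangent_space A p" "c \<in> charts_at A p" "snd u c = snd v c"
  shows "u = v"
proof (rule prod_eqI)
  show "fst u = fst v" using assms(1,2) unfolding mem_tangent_space by simp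
  show "snd u = snd v"
  proof
    fix d show "snd u d = snd v d"
      using assms unfolding mem_tangent_space by (cases "d \<in> charts_at A p") metis+
  qed
qed

text \<open>For fixed \<open>a\<close> and varying \<open>p\<close> these are the
  constant-coefficient fields of the chart \<open>c\<close>.\<close>

definition chart_vector :: "('a, 'e::euclidean_space) atlas \<Rightarrow> ('a, 'e) chart \<Rightarrow> 'a \<Rightarrow> 'e \<Rightarrow> ('a, 'e) tvec" where
  "chart_vector A c p a = (p, \<lambda>d. if d \<in> charts_at A p then chart_diff c d (\<lambda>x. x) p a else 0)"

lemma chart_diff_eq_id_compose:
  assumes A: "smooth_atlas A" and f: "smooth_map_on A W B f" and p: "p \<in> W"
    and c: "c \<in> charts_at A p" and c': "c' \<in> charts_at A p" and d: "d \<in> charts_at B (f p)"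
  shows "chart_diff c' d f p (chart_diff c c' (\<lambda>x. x) p v) = chart_diff c d f p v"
  using chart_diff_compose[OF A A smooth_map_on_id[OF A] f _ p c c' d, of v] charts_at_imp_points[OF c] by simp

lemma id_chart_diff_compose:
  assumes A: "smooth_atlas A" and B: "smooth_atlas B" and f: "smooth_map_on A W B f" and p: "p \<in> W"
    and c: "c \<in> charts_at A p" and d: "d \<in> charts_at B (f p)" and d': "d' \<in> charts_at B (f p)"
  shows "chart_diff d d' (\<lambda>x. x) (f p) (chart_diff c d f p v) = chart_diff c d' f p v"
  using chart_diff_compose[OF A B f smooth_map_on_id[OF B] p _ c d d', of v] charts_at_imp_points[OF d] by simp

lemma chart_vector:
  assumes A: "smooth_atlas A" and c: "c \<in> charts_at A p"
  shows "chart_vector A c p a \<in> tangent_space A p" and "snd (chart_vector A c p a) c = a"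
proof -
  have "p \<in> points A" using charts_at_imp_points[OF c] .
  then show "chart_vector A c p a \<in> tangent_space A p"
    using id_chart_diff_compose[OF A A smooth_map_on_id[OF A] _ c]
    by (auto simp: mem_tangent_space chart_vector_def)
  show "snd (chart_vector A c p a) c = a"
    using c by (simp add: chart_vector_def chart_diff_id_same[OF A])
qed

lemma linear_chart_diff_id:
  assumes A: "smooth_atlas A" and "c \<in> charts_at A p" "d \<in> charts_at A p"
  shows "linear (chart_diff c d (\<lambda>x. x) p)"
  using linear_chart_diff[OF smooth_map_on_id[OF A] _ assms(2,3)] charts_at_imp_points[OF assms(2)] by simp

context
  fixes A :: "('a, 'e::euclidean_space) atlas"
  assumes A: "smooth_atlas A"
begin

lemma tadd_tangent:
  "u \<in> tangent_space A p \<Longrightarrow> v \<in> tangent_space A p \<Longrightarrow> tadd u v \<in> tangent_space A p"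
  unfolding mem_tangent_space[of "tadd u v"]
proof (intro conjI ballI allI impI)
  assume u: "u \<in> tangent_space A p" and v: "v \<in> tangent_space A p"
  show "fst (tadd u v) = p" using u by (simp add: tadd_def fst_tangent)
  show "snd (tadd u v) d = chart_diff c d (\<lambda>x. x) p (snd (tadd u v) c)"
    if "c \<in> charts_at A p" "d \<in> charts_at A p" for c d
    using tangent_transition[OF u that] tangent_transition[OF v that]
    by (simp add: tadd_def linear_add[OF linear_chart_diff_id[OF A that]])
  show "snd (tadd u v) c = 0" if "c \<notin> charts_at A p" for c
    using u v that by (simp add: tadd_def tangent_outside)
qed

lemma tdiff_tangent:
  "u \<in> tangent_space A p \<Longrightarrow> v \<in> tangent_space A p \<Longrightarrow> tdiff u v \<in> tangent_space A p"
  unfolding mem_tangent_space[of "tdiff u v"]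
proof (intro conjI ballI allI impI)
  assume u: "u \<in> tangent_space A p" and v: "v \<in> tangent_space A p"
  show "fst (tdiff u v) = p" using u by (simp add: tdiff_def fst_tangent)
  show "snd (tdiff u v) d = chart_diff c d (\<lambda>x. x) p (snd (tdiff u v) c)"
    if "c \<in> charts_at A p" "d \<in> charts_at A p" for c d
    using tangent_transition[OF u that] tangent_transition[OF v that]
    by (simp add: tdiff_def linear_diff[OF linear_chart_diff_id[OF A that]])
  show "snd (tdiff u v) c = 0" if "c \<notin> charts_at A p" for c
    using u v that by (simp add: tdiff_def tangent_outside)
qed

lemma tscale_tangent: "v \<in> tangent_space A p \<Longrightarrow> tscale t v \<in> tangent_space A p"
  unfolding mem_tangent_space[of "tscale t v"]
proof (intro conjI ballI allI impI)
  assume v: "v \<in> tangent_space A p"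
  show "fst (tscale t v) = p" using v by (simp add: tscale_def fst_tangent)
  show "snd (tscale t v) d = chart_diff c d (\<lambda>x. x) p (snd (tscale t v) c)"
    if "c \<in> charts_at A p" "d \<in> charts_at A p" for c d
    using tangent_transition[OF v that]
    by (simp add: tscale_def linear_scale[OF linear_chart_diff_id[OF A that]])
  show "snd (tscale t v) c = 0" if "c \<notin> charts_at A p" for c
    using v that by (simp add: tscale_def tangent_outside)
qed

end

text \<open>The definition goes through an arbitrarily chosen chart; the transition rule for
  \<open>u\<close> and the chain rule eliminate that choice.\<close>

lemma differential_eq:
  assumes A: "smooth_atlas A" and f: "smooth_map_on A W B f" and p: "p \<in> W"
    and u: "u \<in> tangent_space A p" and c: "c \<in> charts_at A p"
  shows "differential A B f u = (f p, \<lambda>d. if d \<in> charts_at B (f p) then chart_diff c d f p (snd u c) else 0)"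
proof -
  define c0 where "c0 = (SOME c. c \<in> charts_at A p)"
  have c0: "c0 \<in> charts_at A p" unfolding c0_def using c by (rule someI)
  have u': "fst u = p" "snd u c = chart_diff c0 c (\<lambda>x. x) p (snd u c0)"
    using fst_tangent[OF u] tangent_transition[OF u c0 c] .
  show ?thesis
    unfolding differential_def Let_def u'(1) c0_def[symmetric] u'(2)
    by (auto simp: fun_eq_iff chart_diff_eq_id_compose[OF A f p c0 c]) (simp add: chart_diff_def chart_rep_def)
qed

lemma snd_differential:
  assumes "smooth_atlas A" "smooth_map_on A W B f" "p \<in> W"
    "u \<in> tangent_space A p" "c \<in> charts_at A p" "d \<in> charts_at B (f p)"
  shows "snd (differential A B f u) d = chart_diff c d f p (snd u c)"
  using differential_eq[OF assms(1-5)] assms(6) by simp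

lemma differential_tangent:
  assumes A: "smooth_atlas A" and B: "smooth_atlas B" and f: "smooth_map_on A W B f" and p: "p \<in> W"
    and u: "u \<in> tangent_space A p" and pA: "p \<in> points A"
  shows "differential A B f u \<in> tangent_space B (f p)"
proof -
  obtain c where c: "c \<in> charts_at A p" using pA by (rule pointsE)
  show ?thesis
    unfolding differential_eq[OF A f p u c] mem_tangent_space
    using id_chart_diff_compose[OF A B f p c] by auto
qed

lemma differential_compose:
  assumes A: "smooth_atlas A" and B: "smooth_atlas B" and f: "smooth_map_on A W B f"
    and g: "smooth_map_on B V C g" and C: "smooth_atlas C" and fW: "f ` W \<subseteq> V" and p: "p \<in> W"
    and u: "u \<in> tangent_space A p" and W: "W \<subseteq> points A"
  shows "differential A C (\<lambda>q. g (f q)) u = differential B C g (differential A B f u)"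
proof -
  have pA: "p \<in> points A" and fp: "f p \<in> V" using p fW W by auto
  obtain c where c: "c \<in> charts_at A p" using pA by (rule pointsE)
  obtain d where d: "d \<in> charts_at B (f p)" using smooth_map_on_points[OF f p] by (rule pointsE)
  note fu = differential_tangent[OF A B f p u pA]
  show ?thesis
    unfolding differential_eq[OF A smooth_map_on_compose[OF A B C f g fW W] p u c]
       differential_eq[OF B g fp fu d] snd_differential[OF A f p u c d]
    using chart_diff_compose[OF A B f g p fp c d] by (auto simp: fun_eq_iff)
qed

lemma differential_cong:
  fixes A :: "('a, 'e::euclidean_space) atlas" and B :: "('b, 'f::euclidean_space) atlas"
  assumes A: "smooth_atlas A" and W: "openin (manifold_topology A) W" "fst u \<in> W"
    and fg: "\<And>q. q \<in> W \<Longrightarrow> f q = g q"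
  shows "differential A B f u = differential A B g u"
proof -
  define c0 where "c0 = (SOME c. c \<in> charts_at A (fst u))"
  have "fst u \<in> points A" using W openin_manifold[OF A] by blast
  then have c0: "c0 \<in> charts_at A (fst u)" unfolding c0_def by (meson pointsE someI)
  have "chart_diff c0 d f (fst u) = chart_diff c0 d g (fst u)" for d :: "('b, 'f) chart"
    using chart_diff_cong[OF A W _ c0] fg by blast
  then show ?thesis
    using fg[OF W(2)] unfolding differential_def Let_def c0_def[symmetric] chart_diff_def chart_rep_def
    by (simp cong: if_cong)
qed

lemma differential_linear:
  assumes A: "smooth_atlas A" and f: "smooth_map_on A W B f" and p: "p \<in> W" "p \<in> points A"
    and u: "u \<in> tangent_space A p" and v: "v \<in> tangent_space A p"
  shows "differential A B f (tadd u v) = tadd (differential A B f u) (differential A B f v)"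
    and "differential A B f (tdiff u v) = tdiff (differential A B f u) (differential A B f v)"
    and "differential A B f (tscale r u) = tscale r (differential A B f u)"
proof -
  obtain c where c: "c \<in> charts_at A p" using p(2) by (rule pointsE)
  note lin = linear_chart_diff[OF f p(1) c]
  show "differential A B f (tadd u v) = tadd (differential A B f u) (differential A B f v)"
    unfolding differential_eq[OF A f p(1) u c] differential_eq[OF A f p(1) v c]
      differential_eq[OF A f p(1) tadd_tangent[OF A u v] c]
    by (auto simp: tadd_def fun_eq_iff linear_add[OF lin])
  show "differential A B f (tdiff u v) = tdiff (differential A B f u) (differential A B f v)"
    unfolding differential_eq[OF A f p(1) u c] differential_eq[OF A f p(1) v c]
      differential_eq[OF A f p(1) tdiff_tangent[OF A u v] c]
    by (auto simp: tdiff_def fun_eq_iff linear_diff[OF lin])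
  show "differential A B f (tscale r u) = tscale r (differential A B f u)"
    unfolding differential_eq[OF A f p(1) u c] differential_eq[OF A f p(1) tscale_tangent[OF A u] c]
    by (auto simp: tscale_def fun_eq_iff linear_scale[OF lin])
qed

section \<open>The tangent bundle as a manifold\<close>

context
  fixes A :: "('a, 'e::euclidean_space) atlas"
  assumes A: "smooth_atlas A"
begin

lemma mem_fst_tangent_chart: "u \<in> fst (tangent_chart A c) \<longleftrightarrow> fst u \<in> fst c \<and> u \<in> tangent_space A (fst u)"
proof
  assume "u \<in> fst (tangent_chart A c)"
  then obtain p where p: "p \<in> fst c" "u \<in> tangent_space A p" by (auto simp: tangent_chart_def)
  from p fst_tangent[OF p(2)] show "fst u \<in> fst c \<and> u \<in> tangent_space A (fst u)" by simp
qed (auto simp: tangent_chart_def)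

lemma mem_tangent_chart: "u \<in> tangent_space A p \<Longrightarrow> u \<in> fst (tangent_chart A c) \<longleftrightarrow> p \<in> fst c"
  unfolding mem_fst_tangent_chart using fst_tangent[of u A p] by auto

lemma snd_tangent_chart: "snd (tangent_chart A c) u = (snd c (fst u), snd u c)"
  by (simp add: tangent_chart_def)

lemma tangent_chart_at:
  assumes "u \<in> tangent_space A p" "c \<in> charts_at A p"
  shows "tangent_chart A c \<in> charts_at (tangent_bundle A) u"
  using assms(2) mem_tangent_chart[OF assms(1)] by (simp add: charts_at_def tangent_bundle_def)

lemma tangent_chart_atE:
  assumes "C \<in> charts_at (tangent_bundle A) u" "u \<in> tangent_space A p"
  obtains c where "c \<in> charts_at A p" "C = tangent_chart A c"
  using assms(1) mem_tangent_chart[OF assms(2)] by (auto simp: charts_at_def tangent_bundle_def)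

lemma points_tangent_bundle: "u \<in> points (tangent_bundle A) \<longleftrightarrow> fst u \<in> points A \<and> u \<in> tangent_space A (fst u)"
  by (auto simp: points_def tangent_bundle_def mem_fst_tangent_chart)

lemma tangent_chart_image:
  assumes c: "c \<in> A" and X: "X \<subseteq> fst c"
  shows "snd (tangent_chart A c) ` {u. fst u \<in> X \<and> u \<in> tangent_space A (fst u)} = snd c ` X \<times> UNIV"
proof (intro set_eqI iffI)
  fix z assume "z \<in> snd (tangent_chart A c) ` {u. fst u \<in> X \<and> u \<in> tangent_space A (fst u)}"
  then show "z \<in> snd c ` X \<times> UNIV" by (auto simp: snd_tangent_chart)
next
  fix z assume "z \<in> snd c ` X \<times> (UNIV :: 'e set)"
  then obtain p a where p: "p \<in> X" "z = (snd c p, a)" by blast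
  note v = chart_vector[OF A charts_atI[OF c subsetD[OF X p(1)]], of a]
  have "snd (tangent_chart A c) (chart_vector A c p a) = z"
    using v p fst_tangent[OF v(1)] by (simp add: snd_tangent_chart)
  then show "z \<in> snd (tangent_chart A c) ` {u. fst u \<in> X \<and> u \<in> tangent_space A (fst u)}"
    using v(1) p(1) fst_tangent[OF v(1)] by (metis (mono_tags, lifting) imageI mem_Collect_eq)
qed

lemma inj_on_tangent_chart:
  assumes c: "c \<in> A"
  shows "inj_on (snd (tangent_chart A c)) (fst (tangent_chart A c))"
proof (rule inj_onI)
  fix u v assume u: "u \<in> fst (tangent_chart A c)" and v: "v \<in> fst (tangent_chart A c)"
    and eq: "snd (tangent_chart A c) u = snd (tangent_chart A c) v"
  have "fst u = fst v"
    using u v eq chart_eq_iff[OF A c] by (simp add: mem_fst_tangent_chart snd_tangent_chart)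
  then show "u = v"
    using u v eq by (intro tangent_eqI[of u A "fst u" v c] charts_atI[OF c])
      (simp_all add: mem_fst_tangent_chart snd_tangent_chart)
qed

lemma inv_tangent_chart:
  "c \<in> A \<Longrightarrow> u \<in> fst (tangent_chart A c) \<Longrightarrow> inv_chart (tangent_chart A c) (snd (tangent_chart A c) u) = u"
  by (simp add: inv_chart_def inj_on_tangent_chart)

text \<open>If \<open>\<phi>\<close> is the coordinate change of the base, that of the bundle sends
  \<open>(x, a)\<close> to the pair of \<open>\<phi> x\<close> and the derivative of
  \<open>\<phi>\<close> at \<open>x\<close> in direction \<open>a\<close>.\<close>

lemma smooth_atlas_tangent_bundle: "smooth_atlas (tangent_bundle A)"
  unfolding smooth_atlas_def tangent_bundle_def ball_simps(9)
proof (intro conjI ballI)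
  fix c assume c: "c \<in> A"
  show "inj_on (snd (tangent_chart A c)) (fst (tangent_chart A c))"
    by (rule inj_on_tangent_chart[OF c])
  have "fst (tangent_chart A c) = {u. fst u \<in> fst c \<and> u \<in> tangent_space A (fst u)}"
    using mem_fst_tangent_chart by blast
  then show "open (snd (tangent_chart A c) ` fst (tangent_chart A c))"
    using tangent_chart_image[OF c, of "fst c"] open_chart_image[OF A c] by (simp add: open_Times)
  fix d assume d: "d \<in> A"
  let ?X = "fst c \<inter> fst d"
  have "fst (tangent_chart A c) \<inter> fst (tangent_chart A d) = {u. fst u \<in> ?X \<and> u \<in> tangent_space A (fst u)}"
    using mem_fst_tangent_chart by blast
  then have im: "snd (tangent_chart A c) ` (fst (tangent_chart A c) \<inter> fst (tangent_chart A d)) = snd c ` ?X \<times> UNIV"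
    using tangent_chart_image[OF c, of ?X] by simp
  have op: "open (snd c ` ?X \<times> (UNIV :: 'e set))"
    using open_transition_domain[OF A c d] by (simp add: open_Times)
  show "open (snd (tangent_chart A c) ` (fst (tangent_chart A c) \<inter> fst (tangent_chart A d)))"
    using im op by simp
  let ?f = "chart_rep c d (\<lambda>x. x)"
  have smooth_fst: "smooth_on (snd c ` ?X \<times> (UNIV :: 'e set)) fst"
    by (rule smooth_on_bounded_linear[OF bounded_linear_fst smooth_on_ident])
  have "smooth_on (snd c ` ?X \<times> UNIV) (\<lambda>z. (?f (fst z), frechet_derivative ?f (at (fst z)) (snd z)))"
  proof (rule smooth_on_Pair)
    show "smooth_on (snd c ` ?X \<times> UNIV) (\<lambda>z::'e \<times> 'e. ?f (fst z))"
      by (rule smooth_on_compose[OF op smooth_transition[OF A c d] smooth_fst]) auto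
    show "smooth_on (snd c ` ?X \<times> UNIV) (\<lambda>z::'e \<times> 'e. frechet_derivative ?f (at (fst z)) (snd z))"
      by (rule smooth_on_frechet_derivative[OF op smooth_transition[OF A c d] smooth_fst _
            smooth_on_bounded_linear[OF bounded_linear_snd smooth_on_ident] open_transition_domain[OF A c d]]) auto
  qed
  then show "smooth_on (snd (tangent_chart A c) ` (fst (tangent_chart A c) \<inter> fst (tangent_chart A d)))
     (snd (tangent_chart A d) \<circ> inv_chart (tangent_chart A c))"
    unfolding im
  proof (rule smooth_on_cong[OF op, rotated])
    fix z assume z: "z \<in> snd c ` ?X \<times> (UNIV :: 'e set)"
    then obtain u where u: "fst u \<in> ?X" "u \<in> tangent_space A (fst u)" "z = snd (tangent_chart A c) u"
      using tangent_chart_image[OF c, of ?X] by blast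
    have inv: "inv_chart (tangent_chart A c) z = u"
      using u inv_tangent_chart[OF c] by (simp add: mem_fst_tangent_chart)
    have "snd u d = chart_diff c d (\<lambda>x. x) (fst u) (snd u c)"
      using u c d by (intro tangent_transition[OF u(2)] charts_atI) auto
    then show "(?f (fst z), frechet_derivative ?f (at (fst z)) (snd z)) =
        (snd (tangent_chart A d) \<circ> inv_chart (tangent_chart A c)) z"
      using inv u c by (simp add: u(3) snd_tangent_chart chart_rep_chart[OF A] chart_diff_def)
  qed
qed

section \<open>Vertical vectors\<close>

lemma vertical_curve:
  "snd (tangent_chart A c) (tadd u (tscale t v)) = (snd c (fst u), snd u c + t *\<^sub>R snd v c)"
  by (simp add: snd_tangent_chart tadd_def tscale_def)

lemma vertical_curve_derivative:
  "((\<lambda>t. snd (tangent_chart A c) (tadd u (tscale t v))) has_vector_derivative (0, snd v c)) (at 0)"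
  unfolding vertical_curve by (auto simp: has_vector_derivative_def intro!: derivative_eq_intros)

lemma tadd_tscale_0: "tadd u (tscale 0 v) = u"
  by (simp add: tadd_def tscale_def)

lemma fst_vertical: "fst (vertical A u v) = u"
  by (simp add: vertical_def velocity_def tadd_tscale_0)

lemma vertical_coord:
  assumes u: "u \<in> tangent_space A p" and c: "c \<in> charts_at A p"
  shows "snd (vertical A u v) (tangent_chart A c) = (0, snd v c)"
  using vertical_curve_derivative[of c u v]
  by (simp add: vertical_def velocity_def tadd_tscale_0 tangent_chart_at[OF u c] comp_def vector_derivative_at)

end

text \<open>If \<open>F\<close> maps the line through \<open>u\<close> in direction \<open>v\<close>
  to the line through \<open>F u\<close> in direction \<open>w\<close>, differentiating both lines
  at 0 shows that vertical vectors go to vertical vectors. The general \<open>F\<close> covers two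
  uses: the identity, which gives the transformation rule for vertical vectors, and the differential
  of a smooth map.\<close>

lemma chart_diff_vertical:
  assumes A: "smooth_atlas A" and B: "smooth_atlas B"
    and F: "smooth_map_on (tangent_bundle A) V (tangent_bundle B) F" and u: "u \<in> V" "u \<in> tangent_space A p"
    and v: "v \<in> tangent_space A p" and Fu: "F u \<in> tangent_space B q"
    and lin: "\<And>t. F (tadd u (tscale t v)) = tadd (F u) (tscale t w)"
    and c: "c \<in> charts_at A p" and d: "d \<in> charts_at B q"
  shows "chart_diff (tangent_chart A c) (tangent_chart B d) F u (0, snd v c) = (0, snd w d)"
proof -
  let ?C = "tangent_chart A c" and ?D = "tangent_chart B d"
  note C = tangent_chart_at[OF A u(2) c] and D = tangent_chart_at[OF B Fu d]
  \<comment> \<open>The line moves only within the fibre, so it stays in the domain of the tangent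
    chart for all \<open>t\<close>.\<close>
  have curve: "tadd u (tscale t v) \<in> fst ?C" for t
    using mem_tangent_chart[OF A tadd_tangent[OF A u(2) tscale_tangent[OF A v]]] charts_atD(2)[OF c] by simp
  have der: "(chart_rep ?C ?D F has_derivative chart_diff ?C ?D F u) (at (snd ?C (tadd u (tscale 0 v))))"
    unfolding tadd_tscale_0[OF A] by (rule chart_rep_has_derivative[OF F u(1) C D])
  have "((\<lambda>t. chart_rep ?C ?D F (snd ?C (tadd u (tscale t v)))) has_derivative
      (\<lambda>h. chart_diff ?C ?D F u (h *\<^sub>R (0, snd v c)))) (at 0)"
    by (rule has_derivative_compose[OF vertical_curve_derivative[OF A, unfolded has_vector_derivative_def] der])
  then have "((\<lambda>t. snd ?D (tadd (F u) (tscale t w))) has_derivative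
      (\<lambda>h. chart_diff ?C ?D F u (h *\<^sub>R (0, snd v c)))) (at 0)"
    using curve charts_atD(1)[OF C] by (simp add: chart_rep_chart[OF smooth_atlas_tangent_bundle[OF A]] lin)
  from has_derivative_unique[OF this vertical_curve_derivative[OF B, unfolded has_vector_derivative_def]]
  have "chart_diff ?C ?D F u (1 *\<^sub>R (0, snd v c)) = 1 *\<^sub>R (0, snd w d)" by metis
  then show ?thesis by simp
qed

context
  fixes A :: "('a, 'e::euclidean_space) atlas"
  assumes A: "smooth_atlas A"
begin

text \<open>The transformation rule under a change of tangent charts is
  \<open>chart_diff_vertical\<close> for the identity map.\<close>

lemma vertical_tangent:
  assumes u: "u \<in> tangent_space A p" and v: "v \<in> tangent_space A p"
  shows "vertical A u v \<in> tangent_space (tangent_bundle A) u"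
  unfolding mem_tangent_space
proof (intro conjI ballI allI impI)
  show "fst (vertical A u v) = u" by (rule fst_vertical[OF A])
  fix C assume "C \<notin> charts_at (tangent_bundle A) u"
  then show "snd (vertical A u v) C = 0" by (simp add: vertical_def velocity_def tadd_tscale_0[OF A])
next
  fix C D assume C: "C \<in> charts_at (tangent_bundle A) u" and D: "D \<in> charts_at (tangent_bundle A) u"
  obtain c where c: "c \<in> charts_at A p" "C = tangent_chart A c" using tangent_chart_atE[OF A C u] by blast
  obtain d where d: "d \<in> charts_at A p" "D = tangent_chart A d" using tangent_chart_atE[OF A D u] by blast
  have "chart_diff C D (\<lambda>x. x) u (0, snd v c) = (0, snd v d)"
    unfolding c(2) d(2)
    by (rule chart_diff_vertical[OF A A smooth_map_on_id[OF smooth_atlas_tangent_bundle[OF A]]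
          charts_at_imp_points[OF C] u v u refl c(1) d(1)])
  then show "snd (vertical A u v) D = chart_diff C D (\<lambda>x. x) u (snd (vertical A u v) C)"
    using vertical_coord[OF A u c(1)] vertical_coord[OF A u d(1)] c(2) d(2) by simp
qed

lemma tangent_bundle_eqI:
  assumes "X \<in> tangent_space (tangent_bundle A) u" "Y \<in> tangent_space (tangent_bundle A) u"
    "u \<in> tangent_space A p" "c \<in> charts_at A p"
    "snd X (tangent_chart A c) = snd Y (tangent_chart A c)"
  shows "X = Y"
  using tangent_eqI[OF assms(1,2) tangent_chart_at[OF A assms(3,4)] assms(5)] .

lemma vertical_tadd:
  assumes "u \<in> tangent_space A p" "v \<in> tangent_space A p" "w \<in> tangent_space A p" "c \<in> charts_at A p"
  shows "vertical A u (tadd v w) = tadd (vertical A u v) (vertical A u w)"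
proof (rule tangent_bundle_eqI[OF _ _ assms(1,4)])
  show "tadd (vertical A u v) (vertical A u w) \<in> tangent_space (tangent_bundle A) u"
    by (rule tadd_tangent[OF smooth_atlas_tangent_bundle[OF A] vertical_tangent[OF assms(1,2)] vertical_tangent[OF assms(1,3)]])
  show "vertical A u (tadd v w) \<in> tangent_space (tangent_bundle A) u"
    by (rule vertical_tangent[OF assms(1) tadd_tangent[OF A assms(2,3)]])
  show "snd (vertical A u (tadd v w)) (tangent_chart A c) =
      snd (tadd (vertical A u v) (vertical A u w)) (tangent_chart A c)"
    unfolding vertical_coord[OF A assms(1,4)] tadd_def snd_conv by (simp add: vertical_coord[OF A assms(1,4)])
qed

end

section \<open>Derivatives of functions along tangent vectors, and local vector fields\<close>

lemma smooth_atlas_real_line: "smooth_atlas real_line"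
proof -
  have "inv_chart (UNIV, \<lambda>t::real. t) = (\<lambda>t. t)"
    by (rule ext) (simp add: inv_chart_def inv_f_eq)
  then show ?thesis
    by (simp add: smooth_atlas_def real_line_def comp_def smooth_on_ident)
qed

lemma charts_at_real_line: "charts_at real_line t = {(UNIV, \<lambda>t. t)}"
  by (auto simp: charts_at_def real_line_def)

lemma chart_rep_real_line: "chart_rep c (UNIV, \<lambda>t. t) f = (\<lambda>x. f (inv_chart c x))"
  by (auto simp: chart_rep_def)

lemma dir_deriv_eq:
  assumes A: "smooth_atlas A" and f: "smooth_fun_on A W f" and p: "p \<in> W"
    and x: "x \<in> tangent_space A p" and c: "c \<in> charts_at A p"
  shows "dir_deriv A x f = frechet_derivative (\<lambda>z. f (inv_chart c z)) (at (snd c p)) (snd x c)"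
  unfolding dir_deriv_def
  using snd_differential[OF A f[unfolded smooth_fun_on_def] p x c, of "(UNIV, \<lambda>t. t)"]
  by (simp add: charts_at_real_line chart_diff_def chart_rep_real_line)

lemma dir_deriv_cong:
  assumes "smooth_atlas A" "openin (manifold_topology A) W" "fst x \<in> W" "\<And>q. q \<in> W \<Longrightarrow> f q = g q"
  shows "dir_deriv A x f = dir_deriv A x g"
  unfolding dir_deriv_def using differential_cong[OF assms, where B = real_line] by simp

lemma dir_deriv_compose:
  assumes "smooth_atlas A" "smooth_atlas B" "smooth_map_on A W B f" "smooth_fun_on B V F"
    "f ` W \<subseteq> V" "p \<in> W" "x \<in> tangent_space A p" "W \<subseteq> points A"
  shows "dir_deriv A x (\<lambda>q. F (f q)) = dir_deriv B (differential A B f x) F"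
  unfolding dir_deriv_def
  using differential_compose[OF assms(1-3) assms(4)[unfolded smooth_fun_on_def] smooth_atlas_real_line assms(5-8)]
  by simp

lemma smooth_fun_on_chartI:
  assumes A: "smooth_atlas A" and c: "c \<in> A" and W: "W \<subseteq> fst c" "open (snd c ` W)"
    and f: "smooth_on (snd c ` W) \<phi>" "\<And>q. q \<in> W \<Longrightarrow> f q = \<phi> (snd c q)"
  shows "smooth_fun_on A W f"
  unfolding smooth_fun_on_def
proof (rule smooth_map_onI[OF A smooth_atlas_real_line])
  fix p assume p: "p \<in> W"
  have "smooth_on (snd c ` W) (chart_rep c (UNIV, \<lambda>t. t) f)"
    by (rule smooth_on_cong[OF W(2) _ f(1)])
      (use W c f(2) in \<open>auto simp: chart_rep_real_line inv_chart_chart[OF A] subset_iff\<close>)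
  moreover have "W \<inter> fst c = W" using W(1) by blast
  ultimately show "\<exists>c\<in>charts_at A p. \<exists>d\<in>charts_at real_line (f p).
      \<exists>S. open S \<and> snd c p \<in> S \<and> S \<subseteq> snd c ` (W \<inter> fst c \<inter> f -` fst d) \<and> smooth_on S (chart_rep c d f)"
    using p c W by (intro bexI[of _ c] bexI[of _ "(UNIV, \<lambda>t. t)"] exI[of _ "snd c ` W"])
      (auto simp: charts_at_def real_line_def)
qed

definition coord_fun :: "('a, 'e::euclidean_space) chart \<Rightarrow> 'e \<Rightarrow> 'a \<Rightarrow> real" where
  "coord_fun c b q = snd c q \<bullet> b"

lemma smooth_coord_fun:
  assumes A: "smooth_atlas A" and c: "c \<in> A"
  shows "smooth_fun_on A (fst c) (coord_fun c b)"
  by (rule smooth_fun_on_chartI[OF A c order_refl open_chart_image[OF A c], where \<phi> = "\<lambda>x. x \<bullet> b"])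
    (simp_all add: coord_fun_def smooth_on_bounded_linear[OF bounded_linear_inner_left smooth_on_ident])

text \<open>This recovers a vector from its action on functions, and so turns torsion-freeness,
  which is about derivatives of functions, into identities of vectors.\<close>

lemma dir_deriv_coord_fun:
  assumes A: "smooth_atlas A" and c: "c \<in> charts_at A p" and x: "x \<in> tangent_space A p"
  shows "dir_deriv A x (coord_fun c b) = snd x c \<bullet> b"
proof -
  note c' = charts_atD[OF c]
  have "dir_deriv A x (coord_fun c b) =
      frechet_derivative (\<lambda>z. coord_fun c b (inv_chart c z)) (at (snd c p)) (snd x c)"
    by (rule dir_deriv_eq[OF A smooth_coord_fun[OF A c'(1)] c'(2) x c])
  also have "frechet_derivative (\<lambda>z. coord_fun c b (inv_chart c z)) (at (snd c p)) =
      frechet_derivative (\<lambda>z. z \<bullet> b) (at (snd c p))"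
    by (rule frechet_derivative_cong_open[OF open_chart_image[OF A c'(1)]])
      (use c' in \<open>auto simp: coord_fun_def inv_chart_chart[OF A]\<close>)
  also have "\<dots> = (\<lambda>z. z \<bullet> b)"
    using frechet_derivative_at[OF bounded_linear_imp_has_derivative[OF bounded_linear_inner_left]] by metis
  finally show ?thesis .
qed

lemma dir_deriv_const:
  assumes A: "smooth_atlas A" and W: "openin (manifold_topology A) W" "p \<in> W"
    and x: "x \<in> tangent_space A p" and k: "\<And>q. q \<in> W \<Longrightarrow> f q = k"
  shows "dir_deriv A x f = 0"
proof -
  have p: "p \<in> points A" using W openin_manifold[OF A] by blast
  then obtain c where c: "c \<in> charts_at A p" by (rule pointsE)
  note c' = charts_atD[OF c]
  have "dir_deriv A x f = dir_deriv A x (\<lambda>q. k)"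
    by (rule dir_deriv_cong[OF A W(1)]) (use W(2) fst_tangent[OF x] k in auto)
  also have "\<dots> = frechet_derivative (\<lambda>z. k) (at (snd c p)) (snd x c)"
    by (rule dir_deriv_eq[OF A _ c'(2) x c])
      (rule smooth_fun_on_chartI[OF A c'(1) order_refl open_chart_image[OF A c'(1)] smooth_on_const refl])
  finally show ?thesis by simp
qed

lemma chart_field:
  assumes A: "smooth_atlas A" and c: "c \<in> A" and W: "W \<subseteq> fst c" "open (snd c ` W)"
    and a: "smooth_on (snd c ` W) a"
  shows "vector_field_on A W (\<lambda>q. chart_vector A c q (a (snd c q)))" (is "vector_field_on A W ?Y")
  unfolding vector_field_on_def
proof (intro conjI ballI)
  have cq: "c \<in> charts_at A q" if "q \<in> W" for q by (rule charts_atI[OF c subsetD[OF W(1) that]])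
  show tan: "?Y q \<in> tangent_space A q" if "q \<in> W" for q
    by (rule chart_vector(1)[OF A cq[OF that]])
  show "smooth_map_on A W (tangent_bundle A) ?Y"
  proof (rule smooth_map_onI[OF A smooth_atlas_tangent_bundle[OF A]])
    fix p assume p: "p \<in> W"
    have "smooth_on (snd c ` W) (\<lambda>x. (x, a x))" by (rule smooth_on_Pair[OF smooth_on_ident a])
    then have "smooth_on (snd c ` W) (chart_rep c (tangent_chart A c) ?Y)"
    proof (rule smooth_on_cong[OF W(2), rotated])
      fix x assume "x \<in> snd c ` W"
      then obtain q where q: "q \<in> W" "x = snd c q" by blast
      show "(x, a x) = chart_rep c (tangent_chart A c) ?Y x"
        using chart_vector(2)[OF A cq[OF q(1)]] fst_tangent[OF tan[OF q(1)]]
        by (simp add: q(2) chart_rep_chart[OF A c subsetD[OF W(1) q(1)]] snd_tangent_chart[OF A])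
    qed
    moreover have "W \<inter> fst c \<inter> ?Y -` fst (tangent_chart A c) = W"
      using W(1) tan fst_tangent[OF tan] by (auto simp: mem_fst_tangent_chart[OF A])
    ultimately show "\<exists>c\<in>charts_at A p. \<exists>d\<in>charts_at (tangent_bundle A) (?Y p). \<exists>S. open S \<and> snd c p \<in> S \<and>
       S \<subseteq> snd c ` (W \<inter> fst c \<inter> ?Y -` fst d) \<and> smooth_on S (chart_rep c d ?Y)"
      using p cq[OF p] tangent_chart_at[OF A tan[OF p] cq[OF p]] W(2)
      by (intro bexI[of _ c] bexI[of _ "tangent_chart A c"] exI[of _ "snd c ` W"]) auto
  qed
qed

lemma const_chart_field:
  assumes A: "smooth_atlas A" and c: "c \<in> A"
  shows "vector_field_on A (fst c) (\<lambda>q. chart_vector A c q a)"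
  using chart_field[OF A c order_refl open_chart_image[OF A c] smooth_on_const] .

lemma vector_field_onD:
  assumes "vector_field_on A W Y"
  shows "q \<in> W \<Longrightarrow> Y q \<in> tangent_space A q" "smooth_map_on A W (tangent_bundle A) Y"
  using assms by (simp_all add: vector_field_on_def)

lemma vector_field_on_subset:
  assumes "smooth_atlas A" "vector_field_on A W Y" "openin (manifold_topology A) W'" "W' \<subseteq> W"
  shows "vector_field_on A W' Y"
  using assms smooth_map_on_subset[OF assms(1) _ assms(3,4)] by (auto simp: vector_field_on_def)

lemma smooth_fun_on_subset:
  assumes "smooth_atlas A" "smooth_fun_on A W f" "openin (manifold_topology A) W'" "W' \<subseteq> W"
  shows "smooth_fun_on A W' f"
  using assms smooth_map_on_subset[OF assms(1) _ assms(3,4)] by (auto simp: smooth_fun_on_def)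

section \<open>Covariant derivatives and horizontal lifts\<close>

lemma fst_differential: "fst (differential A B f u) = f (fst u)"
  by (simp add: differential_def Let_def)

text \<open>It makes the differential of the differential meaningful. Locally the map pairs
  \<open>chart_rep c d f\<close> with its derivative, the same shape as a coordinate change of the
  bundle.\<close>

lemma smooth_differential:
  fixes A :: "('a, 'e::euclidean_space) atlas" and B :: "('b, 'f::euclidean_space) atlas"
  assumes A: "smooth_atlas A" and B: "smooth_atlas B" and f: "smooth_map_on A (points A) B f"
  shows "smooth_map_on (tangent_bundle A) (points (tangent_bundle A)) (tangent_bundle B) (differential A B f)"
proof (rule smooth_map_onI[OF smooth_atlas_tangent_bundle[OF A] smooth_atlas_tangent_bundle[OF B]])
  fix u assume "u \<in> points (tangent_bundle A)"
  then have u: "fst u \<in> points A" "u \<in> tangent_space A (fst u)" by (simp_all add: points_tangent_bundle[OF A])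
  obtain c where c: "c \<in> charts_at A (fst u)" using u(1) by (rule pointsE)
  obtain d where d: "d \<in> charts_at B (f (fst u))" using smooth_map_on_points[OF f u(1)] by (rule pointsE)
  note c' = charts_atD[OF c] and d' = charts_atD[OF d]
  note du = differential_tangent[OF A B f u(1) u(2) u(1)]
  define X where "X = points A \<inter> fst c \<inter> f -` fst d"
  have X: "open (snd c ` X)" "smooth_on (snd c ` X) (chart_rep c d f)" "X \<subseteq> fst c" "X \<subseteq> points A" "fst u \<in> X"
    using smooth_map_onD[OF f c'(1) d'(1)] u c' d' by (auto simp: X_def)
  let ?S = "snd c ` X \<times> (UNIV :: 'e set)"
  let ?g = "chart_rep c d f"
  have S: "open ?S" using X(1) by (simp add: open_Times)
  have elt: "\<exists>v. z = snd (tangent_chart A c) v \<and> fst v \<in> X \<and> v \<in> tangent_space A (fst v)" if "z \<in> ?S" for z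
    using that tangent_chart_image[OF A c'(1) X(3)] by blast
  have smooth_fst: "smooth_on ?S fst"
    by (rule smooth_on_bounded_linear[OF bounded_linear_fst smooth_on_ident])
  have "smooth_on ?S (\<lambda>z. (?g (fst z), frechet_derivative ?g (at (fst z)) (snd z)))"
  proof (rule smooth_on_Pair)
    show "smooth_on ?S (\<lambda>z. ?g (fst z))"
      by (rule smooth_on_compose[OF S X(2) smooth_fst]) auto
    show "smooth_on ?S (\<lambda>z. frechet_derivative ?g (at (fst z)) (snd z))"
      by (rule smooth_on_frechet_derivative[OF S X(2) smooth_fst _
            smooth_on_bounded_linear[OF bounded_linear_snd smooth_on_ident] X(1)]) auto
  qed
  then have sm: "smooth_on ?S (chart_rep (tangent_chart A c) (tangent_chart B d) (differential A B f))"
  proof (rule smooth_on_cong[OF S, rotated])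
    fix z assume "z \<in> ?S"
    then obtain v where v: "z = snd (tangent_chart A c) v" "fst v \<in> X" "v \<in> tangent_space A (fst v)"
      using elt by blast
    have cv: "c \<in> charts_at A (fst v)" by (rule charts_atI[OF c'(1) subsetD[OF X(3) v(2)]])
    have dv: "d \<in> charts_at B (f (fst v))" using v(2) d'(1) by (intro charts_atI) (auto simp: X_def)
    have "chart_rep (tangent_chart A c) (tangent_chart B d) (differential A B f) z =
        (snd d (f (fst v)), chart_diff c d f (fst v) (snd v c))"
      using inv_tangent_chart[OF A c'(1)] charts_atD[OF cv] v(3)
        snd_differential[OF A f subsetD[OF X(4) v(2)] v(3) cv dv]
      by (simp add: chart_rep_def v(1) snd_tangent_chart[OF B] fst_differential mem_fst_tangent_chart[OF A])
    then show "(?g (fst z), frechet_derivative ?g (at (fst z)) (snd z)) =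
      chart_rep (tangent_chart A c) (tangent_chart B d) (differential A B f) z"
      using charts_atD[OF cv] by (simp add: v(1) snd_tangent_chart[OF A] chart_diff_def chart_rep_chart[OF A])
  qed
  have "snd (tangent_chart A c) u \<in> ?S" using X(5) by (simp add: snd_tangent_chart[OF A])
  moreover have "?S \<subseteq> snd (tangent_chart A c) `
      (points (tangent_bundle A) \<inter> fst (tangent_chart A c) \<inter> differential A B f -` fst (tangent_chart B d))"
  proof
    fix z assume "z \<in> ?S"
    then obtain v where v: "z = snd (tangent_chart A c) v" "fst v \<in> X" "v \<in> tangent_space A (fst v)"
      using elt by blast
    have "differential A B f v \<in> tangent_space B (f (fst v))"
      using differential_tangent[OF A B f _ v(3)] v(2) X(4) by blast
    then have "v \<in> points (tangent_bundle A) \<inter> fst (tangent_chart A c) \<inter> differential A B f -` fst (tangent_chart B d)"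
      using v(2,3) X(3,4) by (auto simp: X_def points_tangent_bundle[OF A] mem_fst_tangent_chart[OF A]
         mem_fst_tangent_chart[OF B] fst_differential)
    with v(1) show "z \<in> snd (tangent_chart A c) `
      (points (tangent_bundle A) \<inter> fst (tangent_chart A c) \<inter> differential A B f -` fst (tangent_chart B d))" by blast
  qed
  ultimately show "\<exists>C\<in>charts_at (tangent_bundle A) u. \<exists>D\<in>charts_at (tangent_bundle B) (differential A B f u).
       \<exists>S. open S \<and> snd C u \<in> S \<and>
       S \<subseteq> snd C ` (points (tangent_bundle A) \<inter> fst C \<inter> differential A B f -` fst D) \<and>
       smooth_on S (chart_rep C D (differential A B f))"
    by (intro bexI[OF _ tangent_chart_at[OF A u(2) c]] bexI[OF _ tangent_chart_at[OF B du d]] exI[of _ ?S] conjI S sm)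
qed

text \<open>The differential is linear on fibres, hence takes the line defining a vertical vector to
  a line of the same kind.\<close>

lemma differential_vertical:
  assumes A: "smooth_atlas A" and B: "smooth_atlas B" and f: "smooth_map_on A (points A) B f"
    and p: "p \<in> points A" and u: "u \<in> tangent_space A p" and v: "v \<in> tangent_space A p"
  shows "differential (tangent_bundle A) (tangent_bundle B) (differential A B f) (vertical A u v) =
    vertical B (differential A B f u) (differential A B f v)"
proof -
  obtain c where c: "c \<in> charts_at A p" using p by (rule pointsE)
  obtain d where d: "d \<in> charts_at B (f p)" using smooth_map_on_points[OF f p] by (rule pointsE)
  note TA = smooth_atlas_tangent_bundle[OF A] and TB = smooth_atlas_tangent_bundle[OF B]
  note du = differential_tangent[OF A B f p u p] and dv = differential_tangent[OF A B f p v p]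
  have pu: "u \<in> points (tangent_bundle A)"
    using p u fst_tangent[OF u] by (simp add: points_tangent_bundle[OF A])
  note F = smooth_differential[OF A B f] and vt = vertical_tangent[OF A u v]
  note C = tangent_chart_at[OF A u c] and D = tangent_chart_at[OF B du d]
  show ?thesis
  proof (rule tangent_bundle_eqI[OF B differential_tangent[OF TA TB F pu vt pu] vertical_tangent[OF B du dv] du d])
    have "differential A B f (tadd u (tscale t v)) = tadd (differential A B f u) (tscale t (differential A B f v))" for t
      using differential_linear[OF A f p p] u tscale_tangent[OF A v] v by simp
    from chart_diff_vertical[OF A B F pu u v du this c d]
    show "snd (differential (tangent_bundle A) (tangent_bundle B) (differential A B f) (vertical A u v)) (tangent_chart B d)
        = snd (vertical B (differential A B f u) (differential A B f v)) (tangent_chart B d)"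
      by (simp add: snd_differential[OF TA F pu vt C D] vertical_coord[OF A u c] vertical_coord[OF B du d])
  qed
qed

lemma smooth_projection:
  fixes A :: "('a, 'e::euclidean_space) atlas"
  assumes A: "smooth_atlas A"
  shows "smooth_map_on (tangent_bundle A) (points (tangent_bundle A)) A fst"
proof (rule smooth_map_onI[OF smooth_atlas_tangent_bundle[OF A] A])
  fix u assume "u \<in> points (tangent_bundle A)"
  then have u: "fst u \<in> points A" "u \<in> tangent_space A (fst u)" by (simp_all add: points_tangent_bundle[OF A])
  obtain c where c: "c \<in> charts_at A (fst u)" using u(1) by (rule pointsE)
  note c' = charts_atD[OF c]
  let ?S = "snd c ` fst c \<times> (UNIV :: 'e set)"
  have S: "open ?S" using open_chart_image[OF A c'(1)] by (simp add: open_Times)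
  have elt: "\<exists>v. z = snd (tangent_chart A c) v \<and> fst v \<in> fst c \<and> v \<in> tangent_space A (fst v)" if "z \<in> ?S" for z
    using that tangent_chart_image[OF A c'(1) order_refl] by blast
  have "smooth_on ?S (chart_rep (tangent_chart A c) c fst)"
  proof (rule smooth_on_cong[OF S _ smooth_on_bounded_linear[OF bounded_linear_fst smooth_on_ident]])
    fix z assume "z \<in> ?S"
    then obtain v where v: "z = snd (tangent_chart A c) v" "fst v \<in> fst c" "v \<in> tangent_space A (fst v)"
      using elt by blast
    then show "fst z = chart_rep (tangent_chart A c) c fst z"
      using inv_tangent_chart[OF A c'(1)]
      by (simp add: chart_rep_def snd_tangent_chart[OF A] mem_fst_tangent_chart[OF A])
  qed
  moreover have "snd (tangent_chart A c) u \<in> ?S" using c' by (simp add: snd_tangent_chart[OF A])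
  moreover have "?S \<subseteq> snd (tangent_chart A c) ` (points (tangent_bundle A) \<inter> fst (tangent_chart A c) \<inter> fst -` fst c)"
  proof
    fix z assume "z \<in> ?S"
    then obtain v where v: "z = snd (tangent_chart A c) v" "fst v \<in> fst c" "v \<in> tangent_space A (fst v)"
      using elt by blast
    moreover have "fst v \<in> points A" by (rule charts_at_imp_points[OF charts_atI[OF c'(1) v(2)]])
    ultimately show "z \<in> snd (tangent_chart A c) ` (points (tangent_bundle A) \<inter> fst (tangent_chart A c) \<inter> fst -` fst c)"
      by (auto simp: points_tangent_bundle[OF A] mem_fst_tangent_chart[OF A])
  qed
  ultimately show "\<exists>C\<in>charts_at (tangent_bundle A) u. \<exists>d\<in>charts_at A (fst u). \<exists>S. open S \<and> snd C u \<in> S \<and>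
       S \<subseteq> snd C ` (points (tangent_bundle A) \<inter> fst C \<inter> fst -` fst d) \<and> smooth_on S (chart_rep C d fst)"
    by (intro bexI[OF _ tangent_chart_at[OF A u(2) c]] bexI[OF _ c] exI[of _ ?S] conjI S)
qed

text \<open>Between a tangent chart and the chart beneath it the projection is the linear map
  \<open>fst\<close>, which is its own derivative.\<close>

lemma snd_differential_projection:
  assumes A: "smooth_atlas A" and p: "p \<in> points A" and u: "u \<in> tangent_space A p"
    and X: "X \<in> tangent_space (tangent_bundle A) u" and c: "c \<in> charts_at A p"
  shows "snd (differential (tangent_bundle A) A fst X) c = fst (snd X (tangent_chart A c))"
proof -
  note TA = smooth_atlas_tangent_bundle[OF A]
  have pu: "u \<in> points (tangent_bundle A)"
    using p u fst_tangent[OF u] by (simp add: points_tangent_bundle[OF A])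
  have c1: "c \<in> charts_at A (fst u)" using c fst_tangent[OF u] by simp
  note C = tangent_chart_at[OF A u c]
  let ?C = "tangent_chart A c"
  have "chart_diff ?C c fst u = frechet_derivative fst (at (snd ?C u))"
    unfolding chart_diff_def
  proof (rule frechet_derivative_cong_open[OF open_chart_image[OF TA charts_atD(1)[OF C]]])
    show "snd ?C u \<in> snd ?C ` fst ?C" using charts_atD(2)[OF C] by blast
    show "chart_rep ?C c fst z = fst z" if z: "z \<in> snd ?C ` fst ?C" for z
    proof -
      obtain v where v: "v \<in> fst ?C" "z = snd ?C v" using z by blast
      show ?thesis using inv_tangent_chart[OF A charts_atD(1)[OF c] v(1)]
        by (simp add: chart_rep_def v(2) snd_tangent_chart[OF A])
    qed
  qed
  also have "\<dots> = fst"
    using frechet_derivative_at[OF bounded_linear_imp_has_derivative[OF bounded_linear_fst]] by metis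
  finally show ?thesis
    using snd_differential[OF TA smooth_projection[OF A] pu X C c1] by simp
qed

section \<open>Coordinates of vector fields and of their covariant derivatives\<close>

text \<open>A field sends each point into the fibre above it, so all of
  \<open>W \<inter> fst c\<close> lands in the tangent chart over \<open>c\<close>, and the domain
  condition of \<open>smooth_map_on\<close> collapses.\<close>

lemma smooth_field_chart_rep:
  assumes A: "smooth_atlas A" and Y: "vector_field_on A W Y" and c: "c \<in> A"
  shows "open (snd c ` (W \<inter> fst c))"
    and "smooth_on (snd c ` (W \<inter> fst c)) (chart_rep c (tangent_chart A c) Y)"
proof -
  have "W \<inter> fst c \<inter> Y -` fst (tangent_chart A c) = W \<inter> fst c"
    using vector_field_onD(1)[OF Y] mem_tangent_chart[OF A] by blast
  moreover have "tangent_chart A c \<in> tangent_bundle A" using c by (simp add: tangent_bundle_def)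
  ultimately show "open (snd c ` (W \<inter> fst c))"
    and "smooth_on (snd c ` (W \<inter> fst c)) (chart_rep c (tangent_chart A c) Y)"
    using smooth_map_onD[OF vector_field_onD(2)[OF Y] c] by metis+
qed

lemma chart_rep_field:
  assumes A: "smooth_atlas A" and Y: "vector_field_on A W Y" and c: "c \<in> A" and q: "q \<in> W" "q \<in> fst c"
  shows "chart_rep c (tangent_chart A c) Y (snd c q) = (snd c q, snd (Y q) c)"
  using fst_tangent[OF vector_field_onD(1)[OF Y q(1)]]
  by (simp add: chart_rep_chart[OF A c q(2)] snd_tangent_chart[OF A])

lemma chart_rep_field_has_derivative:
  assumes A: "smooth_atlas A" and Y: "vector_field_on A W Y" and p: "p \<in> W" and c: "c \<in> charts_at A p"
  shows "(chart_rep c (tangent_chart A c) Y has_derivative chart_diff c (tangent_chart A c) Y p) (at (snd c p))"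
  by (rule chart_rep_has_derivative[OF vector_field_onD(2)[OF Y] p c
        tangent_chart_at[OF A vector_field_onD(1)[OF Y p] c]])

text \<open>A field is a section of the projection: its base coordinate is the identity, and so is
  the derivative of that coordinate.\<close>

lemma fst_chart_diff_field:
  assumes A: "smooth_atlas A" and Y: "vector_field_on A W Y" and p: "p \<in> W" and c: "c \<in> charts_at A p"
  shows "fst (chart_diff c (tangent_chart A c) Y p v) = v"
proof -
  note c' = charts_atD[OF c]
  have "((\<lambda>z. fst (chart_rep c (tangent_chart A c) Y z)) has_derivative
      (\<lambda>v. fst (chart_diff c (tangent_chart A c) Y p v))) (at (snd c p))"
    by (rule has_derivative_fst[OF chart_rep_field_has_derivative[OF assms]])
  then have "((\<lambda>z. z) has_derivative (\<lambda>v. fst (chart_diff c (tangent_chart A c) Y p v))) (at (snd c p))"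
  proof (rule has_derivative_transform_within_open[OF _ smooth_field_chart_rep(1)[OF A Y c'(1)]])
    show "snd c p \<in> snd c ` (W \<inter> fst c)" using p c' by blast
    show "fst (chart_rep c (tangent_chart A c) Y x) = x" if "x \<in> snd c ` (W \<inter> fst c)" for x
      using that chart_rep_field[OF A Y c'(1)] by auto
  qed
  from has_derivative_unique[OF this has_derivative_ident] show ?thesis by metis
qed

lemma smooth_field_coord:
  assumes A: "smooth_atlas A" and Y: "vector_field_on A W Y" and c: "c \<in> A"
  shows "smooth_fun_on A (W \<inter> fst c) (\<lambda>q. snd (Y q) c \<bullet> b)"
proof (rule smooth_fun_on_chartI[OF A c _ smooth_field_chart_rep(1)[OF A Y c]])
  show "smooth_on (snd c ` (W \<inter> fst c)) (\<lambda>z. snd (chart_rep c (tangent_chart A c) Y z) \<bullet> b)"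
    by (intro smooth_on_bounded_linear[OF bounded_linear_inner_left]
        smooth_on_bounded_linear[OF bounded_linear_snd] smooth_field_chart_rep[OF A Y c])
qed (use chart_rep_field[OF A Y c] in auto)

lemma dir_deriv_field_coord:
  assumes A: "smooth_atlas A" and Y: "vector_field_on A W Y" and W: "openin (manifold_topology A) W"
    and p: "p \<in> W" and c: "c \<in> charts_at A p" and x: "x \<in> tangent_space A p"
  shows "dir_deriv A x (\<lambda>q. snd (Y q) c \<bullet> b) = snd (chart_diff c (tangent_chart A c) Y p (snd x c)) \<bullet> b"
proof -
  note c' = charts_atD[OF c]
  let ?\<phi> = "\<lambda>z. snd (chart_rep c (tangent_chart A c) Y z) \<bullet> b"
  have eq: "snd (Y q) c \<bullet> b = ?\<phi> (snd c q)" if "q \<in> W \<inter> fst c" for q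
    using that chart_rep_field[OF A Y c'(1)] by simp
  have "dir_deriv A x (\<lambda>q. snd (Y q) c \<bullet> b) =
      frechet_derivative (\<lambda>z. snd (Y (inv_chart c z)) c \<bullet> b) (at (snd c p)) (snd x c)"
    by (rule dir_deriv_eq[OF A smooth_field_coord[OF A Y c'(1)] _ x c]) (use p c' in simp)
  also have "frechet_derivative (\<lambda>z. snd (Y (inv_chart c z)) c \<bullet> b) (at (snd c p)) = frechet_derivative ?\<phi> (at (snd c p))"
    by (rule frechet_derivative_cong_open[OF smooth_field_chart_rep(1)[OF A Y c'(1)]])
      (use p c' eq in \<open>auto simp: inv_chart_chart[OF A]\<close>)
  also have "\<dots> = (\<lambda>v. snd (chart_diff c (tangent_chart A c) Y p v) \<bullet> b)"
    by (rule frechet_derivative_at[symmetric])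
      (rule has_derivative_inner_left[OF has_derivative_snd[OF chart_rep_field_has_derivative[OF A Y p c]]])
  finally show ?thesis .
qed

lemma affine_connection_tangent:
  assumes "affine_connection A D" "openin (manifold_topology A) W" "vector_field_on A W Y" "p \<in> W"
    "x \<in> tangent_space A p"
  shows "D x Y \<in> tangent_space A p"
  using assms(1)[unfolded affine_connection_def, THEN spec, THEN spec, THEN mp, THEN conjunct1] assms(2-5)
  by blast

lemma torsion_freeD:
  assumes "torsion_free A D" "openin (manifold_topology A) W" "vector_field_on A W X" "vector_field_on A W Y"
    "smooth_fun_on A W f" "p \<in> W"
  shows "dir_deriv A (tdiff (D (X p) Y) (D (Y p) X)) f =
           dir_deriv A (X p) (\<lambda>q. dir_deriv A (Y q) f) - dir_deriv A (Y p) (\<lambda>q. dir_deriv A (X q) f)"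
  using assms unfolding torsion_free_def by blast

text \<open>Let \<open>X\<close> be the constant-coefficient field through \<open>x\<close>. The
  coordinates of the bracket of \<open>X\<close> and \<open>Y\<close> are then the plain derivatives
  of those of \<open>Y\<close>, so torsion-freeness trades \<open>D x Y\<close> for
  \<open>D (Y p) X\<close>, in which \<open>Y\<close> enters only through its value at
  \<open>p\<close>. This last term is the Christoffel symbol applied to \<open>Y p\<close> and
  \<open>x\<close>.\<close>

lemma covariant_derivative_coord:
  assumes A: "smooth_atlas A" and D: "affine_connection A D" "torsion_free A D"
    and W: "openin (manifold_topology A) W" and p: "p \<in> W" and Y: "vector_field_on A W Y"
    and x: "x \<in> tangent_space A p" and c: "c \<in> charts_at A p"
  shows "snd (D x Y) c = snd (chart_diff c (tangent_chart A c) Y p (snd x c)) +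
     snd (D (Y p) (\<lambda>q. chart_vector A c q (snd x c))) c"
proof (rule euclidean_eqI)
  fix b :: 'b assume "b \<in> Basis"
  note c' = charts_atD[OF c]
  define X where "X q = chart_vector A c q (snd x c)" for q
  define U where "U = W \<inter> fst c"
  have U: "openin (manifold_topology A) U" unfolding U_def using W openin_chart[OF A c'(1)] by blast
  have pU: "p \<in> U" using p c' by (simp add: U_def)
  have cU: "c \<in> charts_at A q" if "q \<in> U" for q using that c'(1) by (intro charts_atI) (auto simp: U_def)
  have vX: "vector_field_on A U X" unfolding X_def
    by (rule vector_field_on_subset[OF A const_chart_field[OF A c'(1)] U]) (simp add: U_def)
  have vY: "vector_field_on A U Y" by (rule vector_field_on_subset[OF A Y U]) (simp add: U_def)
  have F: "smooth_fun_on A U (coord_fun c b)"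
    by (rule smooth_fun_on_subset[OF A smooth_coord_fun[OF A c'(1)] U]) (simp add: U_def)
  have Xp: "X p = x"
    using tangent_eqI[OF chart_vector(1)[OF A c] x c] chart_vector(2)[OF A c] by (simp add: X_def)
  note Yp = vector_field_onD(1)[OF vY pU]
  have Fd: "dir_deriv A (Z q) (coord_fun c b) = snd (Z q) c \<bullet> b" if "vector_field_on A U Z" "q \<in> U" for Z q
    by (rule dir_deriv_coord_fun[OF A cU[OF that(2)] vector_field_onD(1)[OF that]])
  have tan: "D x Y \<in> tangent_space A p" "D (Y p) X \<in> tangent_space A p"
    using affine_connection_tangent[OF D(1) U _ pU] vX vY x Yp by auto
  have "snd (tdiff (D x Y) (D (Y p) X)) c \<bullet> b = dir_deriv A (tdiff (D x Y) (D (Y p) X)) (coord_fun c b)"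
    by (rule dir_deriv_coord_fun[OF A c tdiff_tangent[OF A tan], symmetric])
  also have "\<dots> = dir_deriv A x (\<lambda>q. dir_deriv A (Y q) (coord_fun c b)) -
       dir_deriv A (Y p) (\<lambda>q. dir_deriv A (X q) (coord_fun c b))"
    using torsion_freeD[OF D(2) U vX vY F pU] by (simp add: Xp)
  \<comment> \<open>The coordinates of \<open>X\<close> are constant, so this half of the bracket
    vanishes.\<close>
  also have "dir_deriv A (Y p) (\<lambda>q. dir_deriv A (X q) (coord_fun c b)) = 0"
    by (rule dir_deriv_const[OF A U pU Yp, of _ "snd x c \<bullet> b"])
      (simp add: Fd[OF vX], simp add: X_def chart_vector(2)[OF A cU])
  also have "dir_deriv A x (\<lambda>q. dir_deriv A (Y q) (coord_fun c b)) = dir_deriv A x (\<lambda>q. snd (Y q) c \<bullet> b)"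
    by (rule dir_deriv_cong[OF A U]) (use pU fst_tangent[OF x] Fd[OF vY] in auto)
  also have "\<dots> = snd (chart_diff c (tangent_chart A c) Y p (snd x c)) \<bullet> b"
    by (rule dir_deriv_field_coord[OF A Y W p c x])
  finally show "snd (D x Y) c \<bullet> b = (snd (chart_diff c (tangent_chart A c) Y p (snd x c)) +
     snd (D (Y p) (\<lambda>q. chart_vector A c q (snd x c))) c) \<bullet> b"
    by (simp add: tdiff_def X_def[abs_def] inner_diff_left inner_add_left)
qed

text \<open>In a tangent chart the defining expression for a field \<open>Z\<close> has base
  coordinate \<open>x\<close> and fibre coordinate minus the Christoffel term of \<open>Z p\<close>
  and \<open>x\<close>: the derivative of \<open>Z\<close> cancels against the one inside
  \<open>D x Z\<close>. Hence fields with the same value at \<open>p\<close> give the same vector,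
  while the given \<open>Y\<close> forces any candidate in the \<open>THE\<close> to be this
  one.\<close>

lemma horizontal_eq:
  assumes A: "smooth_atlas A" and D: "affine_connection A D" "torsion_free A D"
    and W: "openin (manifold_topology A) W" and p: "p \<in> W" and Y: "vector_field_on A W Y"
    and x: "x \<in> tangent_space A p"
  shows "horizontal A D (Y p) x = tdiff (differential A (tangent_bundle A) Y x) (vertical A (Y p) (D x Y))"
    and "horizontal A D (Y p) x \<in> tangent_space (tangent_bundle A) (Y p)"
    and "c \<in> charts_at A p \<Longrightarrow> fst (snd (horizontal A D (Y p) x) (tangent_chart A c)) = snd x c"
proof -
  note TA = smooth_atlas_tangent_bundle[OF A]
  let ?\<xi> = "\<lambda>Z. tdiff (differential A (tangent_bundle A) Z x) (vertical A (Z p) (D x Z))"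
  have pA: "p \<in> points A" using p W openin_manifold[OF A] by blast
  then obtain c where c: "c \<in> charts_at A p" by (rule pointsE)
  have tan: "?\<xi> Z \<in> tangent_space (tangent_bundle A) (Z p)"
    if "openin (manifold_topology A) U" "p \<in> U" "vector_field_on A U Z" for U Z
    by (rule tdiff_tangent[OF TA differential_tangent[OF A TA vector_field_onD(2)[OF that(3)] that(2) x pA]
          vertical_tangent[OF A vector_field_onD(1)[OF that(3,2)] affine_connection_tangent[OF D(1) that(1,3,2) x]]])
  have coord: "snd (?\<xi> Z) (tangent_chart A c) =
      (snd x c, - snd (D (Z p) (\<lambda>q. chart_vector A c q (snd x c))) c)"
    if "openin (manifold_topology A) U" "p \<in> U" "vector_field_on A U Z" "c \<in> charts_at A p" for U Z c
  proof -
    note Zp = vector_field_onD(1)[OF that(3,2)] and c = that(4)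
    have "snd (?\<xi> Z) (tangent_chart A c) = chart_diff c (tangent_chart A c) Z p (snd x c) - (0, snd (D x Z) c)"
      unfolding tdiff_def snd_conv
      by (simp add: snd_differential[OF A vector_field_onD(2)[OF that(3)] that(2) x c tangent_chart_at[OF A Zp c]]
          vertical_coord[OF A Zp c])
    also have "\<dots> = (snd x c, - snd (D (Z p) (\<lambda>q. chart_vector A c q (snd x c))) c)"
      using fst_chart_diff_field[OF A that(3,2) c, of "snd x c"] covariant_derivative_coord[OF A D that(1,2,3) x c]
      by (simp add: prod_eq_iff)
    finally show ?thesis .
  qed
  have p_eq: "fst (Y p) = p" by (rule fst_tangent[OF vector_field_onD(1)[OF Y p]])
  have unique: "?\<xi> Z = ?\<xi> Y"
    if "openin (manifold_topology A) U" "p \<in> U" "vector_field_on A U Z" "Z p = Y p" for U Z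
    by (rule tangent_bundle_eqI[OF A _ tan[OF W p Y] vector_field_onD(1)[OF Y p] c])
      (use tan[OF that(1-3)] coord[OF that(1-3) c] coord[OF W p Y c] that(4) in simp_all)
  show eq: "horizontal A D (Y p) x = ?\<xi> Y"
    unfolding horizontal_def p_eq
  proof (rule the_equality)
    show "?\<xi> Y \<in> tangent_space (tangent_bundle A) (Y p) \<and>
        (\<forall>U Z. openin (manifold_topology A) U \<and> p \<in> U \<and> vector_field_on A U Z \<and> Z p = Y p \<longrightarrow>
           ?\<xi> Y = tdiff (differential A (tangent_bundle A) Z x) (vertical A (Y p) (D x Z)))"
      using tan[OF W p Y] unique by metis
  qed (use W p Y in blast)
  show "horizontal A D (Y p) x \<in> tangent_space (tangent_bundle A) (Y p)"
    unfolding eq by (rule tan[OF W p Y])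
  show "fst (snd (horizontal A D (Y p) x) (tangent_chart A c)) = snd x c" if "c \<in> charts_at A p" for c
    unfolding eq coord[OF W p Y that] by simp
qed

section \<open>Related fields and the second fundamental form\<close>

lemma chart_vector_coord:
  assumes A: "smooth_atlas A" and c: "c \<in> charts_at A p" and u: "u \<in> tangent_space A p"
  shows "chart_vector A c p (snd u c) = u"
  using tangent_eqI[OF chart_vector(1)[OF A c] u c] chart_vector(2)[OF A c] by simp

text \<open>Any \<open>u\<close> is the value of a constant-coefficient field, so the description by
  fields applies at every point of the bundle.\<close>

lemma horizontal_tangent:
  assumes A: "smooth_atlas A" and D: "affine_connection A D" "torsion_free A D"
    and c: "c \<in> charts_at A p" and u: "u \<in> tangent_space A p" and x: "x \<in> tangent_space A p"
  shows "horizontal A D u x \<in> tangent_space (tangent_bundle A) u"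
    and "fst (snd (horizontal A D u x) (tangent_chart A c)) = snd x c"
  using horizontal_eq(2,3)[OF A D openin_chart[OF A charts_atD(1)[OF c]] charts_atD(2)[OF c]
      const_chart_field[OF A charts_atD(1)[OF c], where a = "snd u c"] x] c chart_vector_coord[OF A c u] by simp_all

text \<open>\<open>X\<close> and the horizontal lift of its projection have the same base
  coordinate, so their difference has base coordinate 0, which characterises vertical vectors;
  \<open>w\<close> is the difference of the fibre coordinates.\<close>

lemma horizontal_vertical_decomposition:
  assumes A: "smooth_atlas A" and D: "affine_connection A D" "torsion_free A D"
    and p: "p \<in> points A" and u: "u \<in> tangent_space A p" and X: "X \<in> tangent_space (tangent_bundle A) u"
  obtains w where "w \<in> tangent_space A p"
    "X = tadd (horizontal A D u (differential (tangent_bundle A) A fst X)) (vertical A u w)"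
proof -
  note TA = smooth_atlas_tangent_bundle[OF A]
  obtain c where c: "c \<in> charts_at A p" using p by (rule pointsE)
  have pu: "u \<in> points (tangent_bundle A)"
    using p u fst_tangent[OF u] by (simp add: points_tangent_bundle[OF A])
  let ?x = "differential (tangent_bundle A) A fst X"
  have x: "?x \<in> tangent_space A p"
    using differential_tangent[OF TA A smooth_projection[OF A] pu X pu] fst_tangent[OF u] by simp
  note h = horizontal_tangent[OF A D c u x]
  let ?w = "chart_vector A c p (snd (snd X (tangent_chart A c)) -
      snd (snd (horizontal A D u ?x) (tangent_chart A c)))"
  note w = chart_vector[OF A c]
  show ?thesis
  proof (rule that[OF w(1)])
    show "X = tadd (horizontal A D u ?x) (vertical A u ?w)"
    proof (rule tangent_bundle_eqI[OF A X tadd_tangent[OF TA h(1) vertical_tangent[OF A u w(1)]] u c])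
      show "snd X (tangent_chart A c) = snd (tadd (horizontal A D u ?x) (vertical A u ?w)) (tangent_chart A c)"
        unfolding tadd_def snd_conv vertical_coord[OF A u c] w(2)
        by (simp add: prod_eq_iff h(2) snd_differential_projection[OF A p u X c])
    qed
  qed
qed

section \<open>Algebra of Riemannian and Sasaki metrics\<close>

context
  fixes A :: "('a, 'e::euclidean_space) atlas" and g p
  assumes g: "riemannian_metric A g" and p: "p \<in> points A"
begin

lemma metric_sym: "u \<in> tangent_space A p \<Longrightarrow> v \<in> tangent_space A p \<Longrightarrow> g u v = g v u"
  using g p unfolding riemannian_metric_def by blast

lemma metric_tadd_left:
  "u \<in> tangent_space A p \<Longrightarrow> v \<in> tangent_space A p \<Longrightarrow> w \<in> tangent_space A p \<Longrightarrow>
    g (tadd u v) w = g u w + g v w"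
  using g p unfolding riemannian_metric_def by blast

lemma metric_tscale_left:
  "u \<in> tangent_space A p \<Longrightarrow> v \<in> tangent_space A p \<Longrightarrow> g (tscale r u) v = r * g u v"
  using g p unfolding riemannian_metric_def by blast

lemma metric_tadd_right:
  "smooth_atlas A \<Longrightarrow> u \<in> tangent_space A p \<Longrightarrow> v \<in> tangent_space A p \<Longrightarrow> w \<in> tangent_space A p \<Longrightarrow>
    g w (tadd u v) = g w u + g w v"
  by (simp add: metric_sym[of w] metric_tadd_left tadd_tangent)

lemma metric_tdiff_left:
  assumes "smooth_atlas A" "u \<in> tangent_space A p" "v \<in> tangent_space A p" "w \<in> tangent_space A p"
  shows "g (tdiff u v) w = g u w - g v w"
proof -
  have "tdiff u v = tadd u (tscale (-1) v)" by (simp add: tdiff_def tadd_def tscale_def)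
  then show ?thesis
    using metric_tadd_left[OF assms(2) tscale_tangent[OF assms(1,3)] assms(4)] metric_tscale_left[OF assms(3,4)]
    by simp
qed

end

lemma riemannian_metric_smooth:
  assumes "riemannian_metric A g" "openin (manifold_topology A) W" "vector_field_on A W X" "vector_field_on A W Y"
  shows "smooth_fun_on A W (\<lambda>q. g (X q) (Y q))"
  using assms unfolding riemannian_metric_def by blast

lemma metric_connectionD:
  assumes "metric_connection A g D" "openin (manifold_topology A) W" "vector_field_on A W Y" "vector_field_on A W Z"
    "p \<in> W" "x \<in> tangent_space A p"
  shows "dir_deriv A x (\<lambda>q. g (Y q) (Z q)) = g (D x Y) (Z p) + g (Y p) (D x Z)"
  using assms unfolding metric_connection_def by blast

text \<open>Bilinearity extends the Sasaki conditions to sums. They prescribe the mixed product in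
  one order only; symmetry of \<open>G\<close> supplies the other.\<close>

lemma sasaki_metric_expand:
  assumes A: "smooth_atlas A" and D: "affine_connection A D" "torsion_free A D" and G: "sasaki_metric A g D G"
    and p: "p \<in> points A" and u: "u \<in> tangent_space A p"
    and x: "x \<in> tangent_space A p" and x': "x' \<in> tangent_space A p"
    and w: "w \<in> tangent_space A p" and w': "w' \<in> tangent_space A p"
  shows "G (tadd (horizontal A D u x) (vertical A u w)) (tadd (horizontal A D u x') (vertical A u w')) =
    g x x' + g w w'"
proof -
  note TA = smooth_atlas_tangent_bundle[OF A]
  obtain c where c: "c \<in> charts_at A p" using p by (rule pointsE)
  have pu: "u \<in> points (tangent_bundle A)"
    using p u fst_tangent[OF u] by (simp add: points_tangent_bundle[OF A])
  have m: "riemannian_metric (tangent_bundle A) G" using G by (simp add: sasaki_metric_def)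
  have S: "G (horizontal A D u v) (horizontal A D u v') = g v v'"
    "G (vertical A u v) (vertical A u v') = g v v'"
    "G (vertical A u v) (horizontal A D u v') = 0"
    if "v \<in> tangent_space A p" "v' \<in> tangent_space A p" for v v'
    using G p u that unfolding sasaki_metric_def by blast+
  note h = horizontal_tangent(1)[OF A D c u] and v = vertical_tangent[OF A u]
  note add = metric_tadd_left[OF m pu] metric_tadd_right[OF m pu TA] tadd_tangent[OF TA]
  show ?thesis
    using S[OF x x'] S[OF w w'] S[OF w x'] S[OF w' x] metric_sym[OF m pu h[OF x] v[OF w']]
    by (simp add: add h[OF x] h[OF x'] v[OF w] v[OF w'])
qed

section \<open>Vector fields related by a map\<close>

text \<open>The usual \<open>f\<close>-related fields, bundled with their open domains so as to
  match the existential statement inside \<open>second_fundamental_form\<close>.\<close>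

definition related_fields ::
  "('a, 'e::euclidean_space) atlas \<Rightarrow> ('b, 'f::euclidean_space) atlas \<Rightarrow> ('a \<Rightarrow> 'b) \<Rightarrow> 'a set \<Rightarrow> 'b set \<Rightarrow>
     ('a \<Rightarrow> ('a, 'e) tvec) \<Rightarrow> ('b \<Rightarrow> ('b, 'f) tvec) \<Rightarrow> bool"
where
  "related_fields A B f W V y Y \<longleftrightarrow>
     openin (manifold_topology A) W \<and> openin (manifold_topology B) V \<and> f ` W \<subseteq> V \<and>
     vector_field_on A W y \<and> vector_field_on B V Y \<and> (\<forall>q\<in>W. Y (f q) = differential A B f (y q))"

lemma openin_chart_domain:
  assumes A: "smooth_atlas A" and f: "smooth_map_on A W B f" and c: "c \<in> A" and d: "d \<in> B"
  shows "openin (manifold_topology A) (W \<inter> fst c \<inter> f -` fst d)"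
proof -
  let ?X = "W \<inter> fst c \<inter> f -` fst d"
  have "fst c \<inter> snd c -` (snd c ` ?X) = ?X"
    using chart_mem_image_iff[OF A c, of _ ?X] by blast
  then show ?thesis using openin_chart_vimage[OF A c smooth_map_onD(1)[OF f c d]] by simp
qed

lemma related_fields_restrict:
  assumes "smooth_atlas A" "smooth_atlas B" "related_fields A B f W V y Y"
    "openin (manifold_topology A) W'" "openin (manifold_topology B) V'" "W' \<subseteq> W" "V' \<subseteq> V" "f ` W' \<subseteq> V'"
  shows "related_fields A B f W' V' y Y"
  using assms(3-8) vector_field_on_subset[OF assms(1) _ assms(4,6)] vector_field_on_subset[OF assms(2) _ assms(5,7)]
  unfolding related_fields_def by blast

lemma related_fields_common:
  assumes "smooth_atlas A" "smooth_atlas B" "related_fields A B f W V y Y" "related_fields A B f W' V' z Z"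
  shows "related_fields A B f (W \<inter> W') (V \<inter> V') y Y" "related_fields A B f (W \<inter> W') (V \<inter> V') z Z"
proof -
  have W: "openin (manifold_topology A) (W \<inter> W')" and V: "openin (manifold_topology B) (V \<inter> V')"
    and f: "f ` (W \<inter> W') \<subseteq> V \<inter> V'"
    using assms(3,4) unfolding related_fields_def by (auto intro: openin_Int)
  show "related_fields A B f (W \<inter> W') (V \<inter> V') y Y" "related_fields A B f (W \<inter> W') (V \<inter> V') z Z"
    using related_fields_restrict[OF assms(1,2,3) W V _ _ f] related_fields_restrict[OF assms(1,2,4) W V _ _ f]
    by auto
qed

text \<open>A constant-coefficient field extends \<open>v\<close>, and its push-forward is continued
  off the image with the help of the left inverse \<open>r\<close>. The sets \<open>W\<close> and
  \<open>V\<close> come from \<open>r\<close> alone and therefore serve all \<open>v\<close> at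
  once.\<close>

lemma related_fields_exist:
  fixes A :: "('a, 'e::euclidean_space) atlas" and B :: "('b, 'f::euclidean_space) atlas"
  assumes A: "smooth_atlas A" and B: "smooth_atlas B" and f: "smooth_map_on A (points A) B f"
    and p: "p \<in> points A" and inj: "inj_on (differential A B f) (tangent_space A p)"
  shows "\<exists>W V. p \<in> W \<and> (\<forall>v\<in>tangent_space A p. \<exists>y Y. related_fields A B f W V y Y \<and> y p = v)"
proof -
  obtain c where c: "c \<in> charts_at A p" using p by (rule pointsE)
  obtain d where d: "d \<in> charts_at B (f p)" using smooth_map_on_points[OF f p] by (rule pointsE)
  note c' = charts_atD[OF c] and d' = charts_atD[OF d]
  define X where "X = points A \<inter> fst c \<inter> f -` fst d"
  let ?g = "chart_rep c d f"
  have S: "open (snd c ` X)" "smooth_on (snd c ` X) ?g"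
    using smooth_map_onD[OF f c'(1) d'(1)] by (simp_all add: X_def)
  have pX: "snd c p \<in> snd c ` X" using p c' d' by (simp add: X_def)
  have injg: "inj (frechet_derivative ?g (at (snd c p)))"
  proof (rule injI)
    fix \<alpha> \<beta> assume eq: "frechet_derivative ?g (at (snd c p)) \<alpha> = frechet_derivative ?g (at (snd c p)) \<beta>"
    note v = chart_vector[OF A c]
    have "differential A B f (chart_vector A c p \<alpha>) = differential A B f (chart_vector A c p \<beta>)"
      by (rule tangent_eqI[OF differential_tangent[OF A B f p v(1) p] differential_tangent[OF A B f p v(1) p] d])
        (use eq in \<open>simp add: snd_differential[OF A f p v(1) c d] v(2) chart_diff_def\<close>)
    then have "chart_vector A c p \<alpha> = chart_vector A c p \<beta>"
      using inj_onD[OF inj _ v(1) v(1)] by blast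
    then show "\<alpha> = \<beta>" using v(2) by metis
  qed
  obtain U V0 r where U: "open U" "snd c p \<in> U" "U \<subseteq> snd c ` X" "open V0" "?g ` U \<subseteq> V0" "smooth_on V0 r"
     "r ` V0 \<subseteq> U" "\<And>x. x \<in> U \<Longrightarrow> r (?g x) = x"
    using smooth_left_inverse[OF S pX injg] by metis
  define W where "W = fst c \<inter> snd c -` U"
  define V where "V = fst d \<inter> snd d -` V0"
  have W: "openin (manifold_topology A) W" unfolding W_def by (rule openin_chart_vimage[OF A c'(1) U(1)])
  have V: "openin (manifold_topology B) V" unfolding V_def by (rule openin_chart_vimage[OF B d'(1) U(4)])
  have WX: "W \<subseteq> X"
  proof
    fix q assume q: "q \<in> W"
    then have "snd c q \<in> snd c ` X" using U(3) by (auto simp: W_def)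
    then show "q \<in> X" using chart_mem_image_iff[OF A c'(1), of q X] q by (auto simp: W_def X_def)
  qed
  have g: "snd d (f q) = ?g (snd c q)" if "q \<in> W" for q
    using that c'(1) by (simp add: W_def chart_rep_chart[OF A])
  have fW: "f ` W \<subseteq> V"
    using WX U(5) g by (auto simp: V_def X_def W_def)
  have oV: "open (snd d ` V)"
  proof -
    have "V \<inter> fst d = V" by (auto simp: V_def)
    then show ?thesis using V openin_manifold[OF B] d'(1) by metis
  qed
  have "\<exists>y Y. related_fields A B f W V y Y \<and> y p = v" if v: "v \<in> tangent_space A p" for v
  proof (intro exI conjI)
    \<comment> \<open>At \<open>?g x\<close> with \<open>x\<close> in \<open>U\<close> the left
      inverse returns \<open>x\<close>, so there \<open>a\<close> is the push-forward of the
      constant vector; elsewhere it is a smooth continuation. That \<open>r\<close> takes values in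
      \<open>U\<close> keeps the derivative of \<open>?g\<close> within its domain of
      smoothness.\<close>
    define a where "a = (\<lambda>x. frechet_derivative ?g (at (r x)) (snd v c))"
    let ?y = "\<lambda>q. chart_vector A c q (snd v c)"
    let ?Y = "\<lambda>z. chart_vector B d z (a (snd d z))"
    show "?y p = v" by (rule chart_vector_coord[OF A c v])
    have y: "vector_field_on A W ?y"
      by (rule vector_field_on_subset[OF A const_chart_field[OF A c'(1)] W]) (simp add: W_def)
    have sa: "smooth_on (snd d ` V) a" unfolding a_def
    proof (rule smooth_on_frechet_derivative[OF oV S(2) _ _ smooth_on_const S(1)])
      show "smooth_on (snd d ` V) r" by (rule smooth_on_subset[OF U(6)]) (auto simp: V_def)
      show "r ` snd d ` V \<subseteq> snd c ` X" using U(3,7) by (auto simp: V_def)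
    qed
    have Y: "vector_field_on B V ?Y"
      by (rule chart_field[OF B d'(1) _ oV sa]) (auto simp: V_def)
    have "?Y (f q) = differential A B f (?y q)" if q: "q \<in> W" for q
    proof -
      have qX: "q \<in> points A" "q \<in> fst c" "f q \<in> fst d" using WX q by (auto simp: X_def)
      note cq = charts_atI[OF c'(1) qX(2)] and dq = charts_atI[OF d'(1) qX(3)]
      have "snd (?Y (f q)) d = frechet_derivative ?g (at (r (?g (snd c q)))) (snd v c)"
        by (simp add: chart_vector(2)[OF B dq] a_def g[OF q])
      also have "\<dots> = chart_diff c d f q (snd v c)" using U(8) q by (simp add: W_def chart_diff_def)
      also have "\<dots> = snd (differential A B f (?y q)) d"
        by (simp add: snd_differential[OF A f qX(1) chart_vector(1)[OF A cq] cq dq] chart_vector(2)[OF A cq])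
      finally show ?thesis
        by (rule tangent_eqI[OF chart_vector(1)[OF B dq]
            differential_tangent[OF A B f qX(1) chart_vector(1)[OF A cq] qX(1)] dq])
    qed
    then show "related_fields A B f W V ?y ?Y"
      using W V fW y Y unfolding related_fields_def by blast
  qed
  moreover have "p \<in> W" using c' U(2) by (simp add: W_def)
  ultimately show ?thesis by blast
qed

section \<open>Symmetry and well-definedness of the second fundamental form\<close>

text \<open>No metric appears here: symmetry and well-definedness of the second fundamental form are
  facts about torsion-free connections. Metrics enter with the normality.\<close>

locale smooth_immersion_connections =
  fixes A :: "('a, 'e::euclidean_space) atlas" and B :: "('b, 'f::euclidean_space) atlas" and f :: "'a \<Rightarrow> 'b"
    and D :: "('a, 'e) cov_deriv" and D' :: "('b, 'f) cov_deriv"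
  assumes A: "smooth_atlas A" and B: "smooth_atlas B" and f: "smooth_map_on A (points A) B f"
    and inj: "\<And>p. p \<in> points A \<Longrightarrow> inj_on (differential A B f) (tangent_space A p)"
    and D: "affine_connection A D" "torsion_free A D"
    and D': "affine_connection B D'" "torsion_free B D'"
begin

abbreviation df where "df \<equiv> differential A B f"

text \<open>The value of the second fundamental form computed from one particular pair of fields,
  before independence of that pair is known. The name anticipates
  \<open>normal_part_orthogonal\<close>.\<close>

definition normal_part where
  "normal_part x y Y = tdiff (D' (df x) Y) (df (D x y))"

lemma related_fieldsD:
  assumes "related_fields A B f W V y Y" "p \<in> W"
  shows "openin (manifold_topology A) W" "openin (manifold_topology B) V" "f p \<in> V"
    "vector_field_on A W y" "vector_field_on B V Y" "Y (f p) = df (y p)" "p \<in> points A" "W \<subseteq> points A"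
    "y p \<in> tangent_space A p" "df (y p) \<in> tangent_space B (f p)"
proof -
  show *: "openin (manifold_topology A) W" "openin (manifold_topology B) V" "f p \<in> V"
    "vector_field_on A W y" "vector_field_on B V Y" "Y (f p) = df (y p)"
    using assms by (auto simp: related_fields_def)
  show **: "W \<subseteq> points A" "p \<in> points A" using *(1) assms(2) openin_manifold[OF A] by blast+
  show "y p \<in> tangent_space A p" by (rule vector_field_onD(1)[OF *(4) assms(2)])
  then show "df (y p) \<in> tangent_space B (f p)" by (rule differential_tangent[OF A B f **(2) _ **(2)])
qed

lemma normal_part_tangent:
  assumes r: "related_fields A B f W V y Y" and p: "p \<in> W" and x: "x \<in> tangent_space A p"
  shows "D' (df x) Y \<in> tangent_space B (f p)" "D x y \<in> tangent_space A p"
    "df (D x y) \<in> tangent_space B (f p)" "normal_part x y Y \<in> tangent_space B (f p)"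
proof -
  note R = related_fieldsD[OF r p]
  note dx = differential_tangent[OF A B f R(7) x R(7)]
  show *: "D' (df x) Y \<in> tangent_space B (f p)"
    by (rule affine_connection_tangent[OF D'(1) R(2,5,3) dx])
  show **: "D x y \<in> tangent_space A p" by (rule affine_connection_tangent[OF D(1) R(1,4) p x])
  show ***: "df (D x y) \<in> tangent_space B (f p)" by (rule differential_tangent[OF A B f R(7) ** R(7)])
  show "normal_part x y Y \<in> tangent_space B (f p)" unfolding normal_part_def
    by (rule tdiff_tangent[OF B * ***])
qed

text \<open>Behind this lies that brackets of related fields are related. Instead of forming
  brackets, a coordinate function \<open>F\<close> near \<open>f p\<close> is used: its iterated
  derivatives along \<open>Y\<close> and \<open>Z\<close> at \<open>f p\<close> are those of
  \<open>F \<circ> f\<close> along \<open>y\<close> and \<open>z\<close> at \<open>p\<close>, and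
  torsion-freeness on both sides converts them into covariant derivatives.\<close>

lemma normal_part_sym_common:
  assumes r: "related_fields A B f W V y Y" and s: "related_fields A B f W V z Z" and p: "p \<in> W"
  shows "normal_part (y p) z Z = normal_part (z p) y Y"
proof -
  note R = related_fieldsD[OF r p] and S = related_fieldsD[OF s p]
  obtain c where c: "c \<in> charts_at A p" using R(7) by (rule pointsE)
  obtain d where d: "d \<in> charts_at B (f p)" using smooth_map_on_points[OF f R(7)] by (rule pointsE)
  note c' = charts_atD[OF c] and d' = charts_atD[OF d]
  \<comment> \<open>The test functions are coordinates of the chart \<open>d\<close>, so the domains
    are cut down until images lie in the domain of \<open>d\<close>.\<close>
  define W' where "W' = W \<inter> fst c \<inter> f -` fst d"
  define V' where "V' = V \<inter> fst d"
  have W': "openin (manifold_topology A) W'" unfolding W'_def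
    by (rule openin_chart_domain[OF A smooth_map_on_subset[OF A f R(1,8)] c'(1) d'(1)])
  have V': "openin (manifold_topology B) V'" unfolding V'_def using R(2) openin_chart[OF B d'(1)] by blast
  have fW': "f ` W' \<subseteq> V'" using r by (auto simp: related_fields_def W'_def V'_def)
  have sub: "W' \<subseteq> W" "V' \<subseteq> V" by (auto simp: W'_def V'_def)
  have pW: "p \<in> W'" using p c' d' by (simp add: W'_def)
  have f': "smooth_map_on A W' B f" by (rule smooth_map_on_subset[OF A f W']) (use sub R(8) in blast)
  have W'p: "W' \<subseteq> points A" using sub R(8) by blast
  note r' = related_fields_restrict[OF A B r W' V' sub fW'] and s' = related_fields_restrict[OF A B s W' V' sub fW']
  have main: "snd (tdiff (D' (df (y p)) Z) (D' (df (z p)) Y)) d \<bullet> b = snd (df (tdiff (D (y p) z) (D (z p) y))) d \<bullet> b" for b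
  proof -
    define F where "F = coord_fun d b"
    have F: "smooth_fun_on B V' F" unfolding F_def
      by (rule smooth_fun_on_subset[OF B smooth_coord_fun[OF B d'(1)] V']) (simp add: V'_def)
    have Ff: "smooth_fun_on A W' (\<lambda>q. F (f q))"
      unfolding smooth_fun_on_def
      by (rule smooth_map_on_compose[OF A B smooth_atlas_real_line f' F[unfolded smooth_fun_on_def] fW' W'p])
    have dV: "d \<in> charts_at B q" if "q \<in> V'" for q
      using that d'(1) by (intro charts_atI) (auto simp: V'_def)
    \<comment> \<open>Pulling the outer derivative back along \<open>f\<close> requires the inner
      derivative to be a smooth function on \<open>V'\<close>; it is one, being a coordinate of the
      field.\<close>
    have second: "dir_deriv B (df x) (\<lambda>q. dir_deriv B (Y q) F) = dir_deriv A x (\<lambda>q. dir_deriv A (y q) (\<lambda>q. F (f q)))"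
      if t: "related_fields A B f W' V' y Y" and x: "x \<in> tangent_space A p" for x y Y
    proof -
      note T = related_fieldsD[OF t pW]
      have k: "dir_deriv B (Y q) F = snd (Y q) d \<bullet> b" if "q \<in> V'" for q
        unfolding F_def by (rule dir_deriv_coord_fun[OF B dV[OF that] vector_field_onD(1)[OF T(5) that]])
      have sm: "smooth_fun_on B V' (\<lambda>q. snd (Y q) d \<bullet> b)"
        using smooth_field_coord[OF B T(5) d'(1), of b] by (simp add: V'_def Int_absorb2 Int_assoc)
      have "dir_deriv B (df x) (\<lambda>q. dir_deriv B (Y q) F) = dir_deriv B (df x) (\<lambda>q. snd (Y q) d \<bullet> b)"
        by (rule dir_deriv_cong[OF B V']) (use k T(3) fst_tangent[OF x] in \<open>auto simp: fst_differential\<close>)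
      also have "\<dots> = dir_deriv A x (\<lambda>q. snd (Y (f q)) d \<bullet> b)"
        by (rule dir_deriv_compose[OF A B f' sm fW' pW x W'p, symmetric])
      also have "\<dots> = dir_deriv A x (\<lambda>q. dir_deriv A (y q) (\<lambda>q. F (f q)))"
      proof (rule dir_deriv_cong[OF A W'])
        show "fst x \<in> W'" using pW fst_tangent[OF x] by simp
        fix q assume q: "q \<in> W'"
        note Q = related_fieldsD[OF t q]
        have "dir_deriv A (y q) (\<lambda>q. F (f q)) = dir_deriv B (df (y q)) F"
          by (rule dir_deriv_compose[OF A B f' F fW' q Q(9) W'p])
        also have "\<dots> = snd (Y (f q)) d \<bullet> b" using k[OF Q(3)] Q(6) by simp
        finally show "snd (Y (f q)) d \<bullet> b = dir_deriv A (y q) (\<lambda>q. F (f q))" by simp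
      qed
      finally show ?thesis .
    qed
    note R' = related_fieldsD[OF r' pW] and S' = related_fieldsD[OF s' pW]
    note tS = normal_part_tangent[OF s' pW R(9)] and tR = normal_part_tangent[OF r' pW S(9)]
    have "snd (tdiff (D' (df (y p)) Z) (D' (df (z p)) Y)) d \<bullet> b =
        dir_deriv B (tdiff (D' (df (y p)) Z) (D' (df (z p)) Y)) F"
      unfolding F_def by (rule dir_deriv_coord_fun[OF B d tdiff_tangent[OF B tS(1) tR(1)], symmetric])
    also have "\<dots> = dir_deriv B (df (y p)) (\<lambda>q. dir_deriv B (Z q) F) - dir_deriv B (df (z p)) (\<lambda>q. dir_deriv B (Y q) F)"
      using torsion_freeD[OF D'(2) V' R'(5) S'(5) F R'(3)] R'(6) S'(6) by simp
    also have "\<dots> = dir_deriv A (y p) (\<lambda>q. dir_deriv A (z q) (\<lambda>q. F (f q))) -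
        dir_deriv A (z p) (\<lambda>q. dir_deriv A (y q) (\<lambda>q. F (f q)))"
      using second[OF s' R(9)] second[OF r' S(9)] by simp
    also have "\<dots> = dir_deriv A (tdiff (D (y p) z) (D (z p) y)) (\<lambda>q. F (f q))"
      by (rule torsion_freeD[OF D(2) W' R'(4) S'(4) Ff pW, symmetric])
    also have "\<dots> = dir_deriv B (df (tdiff (D (y p) z) (D (z p) y))) F"
      by (rule dir_deriv_compose[OF A B f' F fW' pW tdiff_tangent[OF A tS(2) tR(2)] W'p])
    also have "\<dots> = snd (df (tdiff (D (y p) z) (D (z p) y))) d \<bullet> b"
      unfolding F_def
      by (rule dir_deriv_coord_fun[OF B d differential_tangent[OF A B f R(7) tdiff_tangent[OF A tS(2) tR(2)] R(7)]])
    finally show ?thesis .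
  qed
  note tS = normal_part_tangent[OF s p R(9)] and tR = normal_part_tangent[OF r p S(9)]
  have "snd (tdiff (D' (df (y p)) Z) (D' (df (z p)) Y)) d = snd (df (tdiff (D (y p) z) (D (z p) y))) d"
    by (rule euclidean_eqI) (rule main)
  then have "snd (D' (df (y p)) Z) d - snd (D' (df (z p)) Y) d = snd (df (D (y p) z)) d - snd (df (D (z p) y)) d"
    unfolding differential_linear(2)[OF A f R(7,7) tS(2) tR(2)] by (simp only: tdiff_def snd_conv)
  then have "snd (normal_part (y p) z Z) d = snd (normal_part (z p) y Y) d"
    unfolding normal_part_def tdiff_def snd_conv by (simp add: algebra_simps)
  then show ?thesis by (rule tangent_eqI[OF tS(4) tR(4) d])
qed

lemma normal_part_sym:
  assumes r: "related_fields A B f W V y Y" and s: "related_fields A B f W' V' z Z" and p: "p \<in> W" "p \<in> W'"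
  shows "normal_part (y p) z Z = normal_part (z p) y Y"
  using normal_part_sym_common[OF related_fields_common[OF A B r s]] p by blast

text \<open>Extend \<open>x\<close> to a related pair \<open>(z, Z)\<close>. By symmetry the value
  equals \<open>normal_part (y p) z Z\<close>, in which the pair \<open>(y, Y)\<close> survives only
  through \<open>y p\<close>. So symmetry delivers the uniqueness that \<open>THE\<close>
  demands.\<close>

lemma second_fundamental_form_eq:
  assumes r: "related_fields A B f W V y Y" and p: "p \<in> W" and x: "x \<in> tangent_space A p"
  shows "second_fundamental_form A D B D' f x (y p) = normal_part x y Y"
proof -
  note R = related_fieldsD[OF r p]
  obtain W0 V0 where "p \<in> W0" "\<forall>v\<in>tangent_space A p. \<exists>y Y. related_fields A B f W0 V0 y Y \<and> y p = v"
    using related_fields_exist[OF A B f R(7) inj[OF R(7)]] by (elim exE conjE)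
  then obtain z Z where s: "p \<in> W0" "related_fields A B f W0 V0 z Z" "z p = x"
    using x by (elim ballE exE conjE) auto
  have indep: "normal_part x y' Y' = normal_part x y Y" if "related_fields A B f W' V' y' Y'" "p \<in> W'" "y' p = y p"
    for W' V' y' Y'
    using normal_part_sym[OF s(2) r s(1) p] normal_part_sym[OF s(2) that(1) s(1) that(2)] s(3) that(3) by simp
  show ?thesis
    unfolding second_fundamental_form_def fst_tangent[OF x]
  proof (rule the_equality)
    show "\<exists>W V y' Y'. openin (manifold_topology A) W \<and> p \<in> W \<and> openin (manifold_topology B) V \<and> f ` W \<subseteq> V \<and>
        vector_field_on A W y' \<and> y' p = y p \<and> vector_field_on B V Y' \<and> (\<forall>q\<in>W. Y' (f q) = df (y' q)) \<and>
        normal_part x y Y = tdiff (D' (df x) Y') (df (D x y'))"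
      using r p unfolding related_fields_def normal_part_def by blast
  next
    fix b assume "\<exists>W V y' Y'. openin (manifold_topology A) W \<and> p \<in> W \<and> openin (manifold_topology B) V \<and> f ` W \<subseteq> V \<and>
        vector_field_on A W y' \<and> y' p = y p \<and> vector_field_on B V Y' \<and> (\<forall>q\<in>W. Y' (f q) = df (y' q)) \<and>
        b = tdiff (D' (df x) Y') (df (D x y'))"
    then obtain W' V' y' Y' where "related_fields A B f W' V' y' Y'" "p \<in> W'" "y' p = y p" "b = normal_part x y' Y'"
      unfolding related_fields_def normal_part_def by blast
    then show "b = normal_part x y Y" using indep by metis
  qed
qed

end

section \<open>Normality, and the image of horizontal vectors\<close>

context smooth_immersion_connections
begin

text \<open>By isometry the product of \<open>y\<close> and \<open>z\<close> under \<open>g\<close>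
  is the product of \<open>Y\<close> and \<open>Z\<close> under \<open>h\<close>, pulled back by
  \<open>f\<close>. Differentiate it along \<open>x\<close>: metric compatibility evaluates both
  sides, and isometry matches the terms coming from \<open>D\<close>, leaving the normal
  parts.\<close>

lemma normal_part_antisym:
  assumes g: "metric_connection A g D" "riemannian_metric A g"
    and h: "metric_connection B h D'" "riemannian_metric B h"
    and iso: "\<forall>p\<in>points A. \<forall>u\<in>tangent_space A p. \<forall>v\<in>tangent_space A p. g u v = h (df u) (df v)"
    and r: "related_fields A B f W V y Y" and s: "related_fields A B f W V z Z" and p: "p \<in> W"
    and x: "x \<in> tangent_space A p"
  shows "h (normal_part x y Y) (df (z p)) + h (normal_part x z Z) (df (y p)) = 0"
proof -
  note R = related_fieldsD[OF r p] and S = related_fieldsD[OF s p]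
  note tR = normal_part_tangent[OF r p x] and tS = normal_part_tangent[OF s p x]
  have f': "smooth_map_on A W B f" by (rule smooth_map_on_subset[OF A f R(1,8)])
  have fW: "f ` W \<subseteq> V" using r by (simp add: related_fields_def)
  note fp = smooth_map_on_points[OF f R(7)]
  have "g (D x y) (z p) + g (y p) (D x z) = dir_deriv A x (\<lambda>q. g (y q) (z q))"
    by (rule metric_connectionD[OF g(1) R(1,4) S(4) p x, symmetric])
  also have "\<dots> = dir_deriv A x (\<lambda>q. h (Y (f q)) (Z (f q)))"
  proof (rule dir_deriv_cong[OF A R(1)])
    show "fst x \<in> W" using p fst_tangent[OF x] by simp
    show "g (y q) (z q) = h (Y (f q)) (Z (f q))" if "q \<in> W" for q
      using related_fieldsD[OF r that] related_fieldsD[OF s that] iso by simp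
  qed
  also have "\<dots> = dir_deriv B (df x) (\<lambda>q. h (Y q) (Z q))"
    by (rule dir_deriv_compose[OF A B f' riemannian_metric_smooth[OF h(2) R(2,5) S(5)] fW p x R(8)])
  also have "\<dots> = h (D' (df x) Y) (Z (f p)) + h (Y (f p)) (D' (df x) Z)"
    by (rule metric_connectionD[OF h(1) R(2,5) S(5) R(3) differential_tangent[OF A B f R(7) x R(7)]])
  finally have "h (df (D x y)) (df (z p)) + h (df (y p)) (df (D x z)) =
      h (D' (df x) Y) (df (z p)) + h (df (y p)) (D' (df x) Z)"
    using iso[rule_format, OF R(7) tR(2) S(9)] iso[rule_format, OF R(7) R(9) tS(2)] R(6) S(6) by simp
  then show ?thesis
    unfolding normal_part_def metric_tdiff_left[OF h(2) fp B tR(1,3) S(10)] metric_tdiff_left[OF h(2) fp B tS(1,3) R(10)]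
    using metric_sym[OF h(2) fp R(10) tS(1)] metric_sym[OF h(2) fp R(10) tS(3)] by simp
qed

text \<open>The permutation argument known from the uniqueness of the Levi-Civita connection:
  alternating the two exchanges runs through all six orders of \<open>u\<close>, \<open>v\<close>,
  \<open>w\<close> and returns to the start with three sign changes.\<close>

lemma normal_part_orthogonal:
  assumes g: "metric_connection A g D" "riemannian_metric A g"
    and h: "metric_connection B h D'" "riemannian_metric B h"
    and iso: "\<forall>p\<in>points A. \<forall>u\<in>tangent_space A p. \<forall>v\<in>tangent_space A p. g u v = h (df u) (df v)"
    and fields: "\<And>v. v \<in> tangent_space A p \<Longrightarrow> related_fields A B f W V (y v) (Y v)"
      "\<And>v. v \<in> tangent_space A p \<Longrightarrow> y v p = v" and p: "p \<in> W"
    and u: "u \<in> tangent_space A p" and v: "v \<in> tangent_space A p" and w: "w \<in> tangent_space A p"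
  shows "h (normal_part u (y v) (Y v)) (df w) = 0"
proof -
  define T where "T a b c = h (normal_part a (y b) (Y b)) (df c)" for a b c
  have sym: "T a b c = T b a c" if "a \<in> tangent_space A p" "b \<in> tangent_space A p" for a b c
    using normal_part_sym[OF fields(1)[OF that(1)] fields(1)[OF that(2)] p p] fields(2) that by (simp add: T_def)
  have anti: "T a b c = - T a c b" if "a \<in> tangent_space A p" "b \<in> tangent_space A p" "c \<in> tangent_space A p" for a b c
    using normal_part_antisym[OF g h iso fields(1)[OF that(2)] fields(1)[OF that(3)] p that(1)] fields(2) that
    by (simp add: T_def)
  have "T u v w = - T u w v" by (rule anti[OF u v w])
  also have "T u w v = T w u v" by (rule sym[OF u w])
  also have "T w u v = - T w v u" by (rule anti[OF w u v])
  also have "T w v u = T v w u" by (rule sym[OF w v])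
  also have "T v w u = - T v u w" by (rule anti[OF v w u])
  also have "T v u w = T u v w" by (rule sym[OF v u])
  finally show ?thesis by (simp add: T_def)
qed

text \<open>Since \<open>df \<circ> y\<close> and \<open>Y \<circ> f\<close> agree on
  \<open>W\<close>, the chain rule carries the derivative of \<open>y\<close> along \<open>x\<close>
  to that of \<open>Y\<close> along \<open>df x\<close>. The vertical corrections do not match: the
  image carries \<open>df (D x y)\<close>, whereas the horizontal lift in the target subtracts
  \<open>D' (df x) Y\<close>. Their difference is the normal part.\<close>

lemma differential_horizontal:
  assumes r: "related_fields A B f W V y Y" and p: "p \<in> W" and x: "x \<in> tangent_space A p"
  shows "differential (tangent_bundle A) (tangent_bundle B) df (horizontal A D (y p) x) =
    tadd (horizontal B D' (df (y p)) (df x)) (vertical B (df (y p)) (normal_part x y Y))"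
proof -
  note TA = smooth_atlas_tangent_bundle[OF A] and TB = smooth_atlas_tangent_bundle[OF B]
  note F = smooth_differential[OF A B f]
  note R = related_fieldsD[OF r p] and t = normal_part_tangent[OF r p x]
  note dx = differential_tangent[OF A B f R(7) x R(7)]
  have pu: "y p \<in> points (tangent_bundle A)"
    using R(7,9) fst_tangent[OF R(9)] by (simp add: points_tangent_bundle[OF A])
  let ?u = "df (y p)"
  let ?TT = "differential (tangent_bundle A) (tangent_bundle B) df"
  have f': "smooth_map_on A W B f" by (rule smooth_map_on_subset[OF A f R(1,8)])
  have fW: "f ` W \<subseteq> V" and rel: "\<And>q. q \<in> W \<Longrightarrow> Y (f q) = df (y q)"
    using r by (auto simp: related_fields_def)
  obtain d where d: "d \<in> charts_at B (f p)" using smooth_map_on_points[OF f R(7)] by (rule pointsE)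
  have yW: "y ` W \<subseteq> points (tangent_bundle A)"
    using smooth_map_on_points[OF vector_field_onD(2)[OF R(4)]] by blast
  have "?TT (differential A (tangent_bundle A) y x) = differential A (tangent_bundle B) (\<lambda>q. df (y q)) x"
    by (rule differential_compose[OF A TA vector_field_onD(2)[OF R(4)] F TB yW p x R(8), symmetric])
  also have "\<dots> = differential A (tangent_bundle B) (\<lambda>q. Y (f q)) x"
    by (rule differential_cong[OF A R(1)]) (use p rel fst_tangent[OF x] in auto)
  also have "\<dots> = differential B (tangent_bundle B) Y (df x)"
    by (rule differential_compose[OF A B f' vector_field_onD(2)[OF R(5)] TB fW p x R(8)])
  finally have 1: "?TT (differential A (tangent_bundle A) y x) = differential B (tangent_bundle B) Y (df x)" .
  have 2: "?TT (vertical A (y p) (D x y)) = vertical B ?u (df (D x y))"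
    by (rule differential_vertical[OF A B f R(7,9) t(2)])
  have "?TT (horizontal A D (y p) x) = tdiff (differential B (tangent_bundle B) Y (df x)) (vertical B ?u (df (D x y)))"
    unfolding horizontal_eq(1)[OF A D R(1) p R(4) x]
    using differential_linear(2)[OF TA F pu pu differential_tangent[OF A TA vector_field_onD(2)[OF R(4)] p x R(7)]
        vertical_tangent[OF A R(9) t(2)]] 1 2 by simp
  moreover have "horizontal B D' ?u (df x) = tdiff (differential B (tangent_bundle B) Y (df x)) (vertical B ?u (D' (df x) Y))"
    using horizontal_eq(1)[OF B D' R(2,3,5) dx] R(6) by simp
  moreover have "vertical B ?u (D' (df x) Y) = tadd (vertical B ?u (normal_part x y Y)) (vertical B ?u (df (D x y)))"
  proof -
    have "D' (df x) Y = tadd (normal_part x y Y) (df (D x y))"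
      by (simp add: normal_part_def tadd_def tdiff_def)
    then show ?thesis using vertical_tadd[OF B R(10) t(4,3) d] by simp
  qed
  ultimately show ?thesis by (simp add: tadd_def tdiff_def)
qed

lemma differential_horizontal_vertical:
  assumes r: "related_fields A B f W V y Y" and p: "p \<in> W" and x: "x \<in> tangent_space A p" and w: "w \<in> tangent_space A p"
  shows "differential (tangent_bundle A) (tangent_bundle B) df (tadd (horizontal A D (y p) x) (vertical A (y p) w)) =
    tadd (horizontal B D' (df (y p)) (df x)) (vertical B (df (y p)) (tadd (df w) (normal_part x y Y)))"
proof -
  note TA = smooth_atlas_tangent_bundle[OF A] and F = smooth_differential[OF A B f]
  note R = related_fieldsD[OF r p] and t = normal_part_tangent[OF r p x]
  have pu: "y p \<in> points (tangent_bundle A)"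
    using R(7,9) fst_tangent[OF R(9)] by (simp add: points_tangent_bundle[OF A])
  obtain d where d: "d \<in> charts_at B (f p)" using smooth_map_on_points[OF f R(7)] by (rule pointsE)
  note dw = differential_tangent[OF A B f R(7) w R(7)]
  show ?thesis
    unfolding differential_linear(1)[OF TA F pu pu horizontal_eq(2)[OF A D R(1) p R(4) x] vertical_tangent[OF A R(9) w]]
      differential_horizontal[OF r p x] differential_vertical[OF A B f R(7,9) w] vertical_tadd[OF B R(10) dw t(4) d]
    by (simp add: tadd_def add_ac)
qed

end

section \<open>The pullback of the Sasaki metric\<close>

theorem theorem4p4:
  fixes M :: "('a, 'e::euclidean_space) atlas" and g :: "('a, 'e) metric_tensor"
    and N :: "('b, 'f::euclidean_space) atlas" and h :: "('b, 'f) metric_tensor"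
    and \<iota> :: "'a \<Rightarrow> 'b"
    and D :: "('a, 'e) cov_deriv" and D' :: "('b, 'f) cov_deriv"
    and gS :: "(('a, 'e) tvec, 'e \<times> 'e) metric_tensor"
    and hS :: "(('b, 'f) tvec, 'f \<times> 'f) metric_tensor"
  assumes "riemannian_manifold M g"
    and "riemannian_manifold N h"
    and "isometric_immersion M g N h \<iota>"
    and "levi_civita M g D"
    and "levi_civita N h D'"
    and "sasaki_metric M g D gS"
    and "sasaki_metric N h D' hS"
  shows "\<forall>u \<in> points (tangent_bundle M).
     \<forall>X \<in> tangent_space (tangent_bundle M) u. \<forall>Y \<in> tangent_space (tangent_bundle M) u.
       pullback (tangent_bundle M) (tangent_bundle N) (differential M N \<iota>) hS X Y =
         gS X Y +
         h (second_fundamental_form M D N D' \<iota> u (differential (tangent_bundle M) M fst X))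
           (second_fundamental_form M D N D' \<iota> u (differential (tangent_bundle M) M fst Y))"
proof (intro ballI)
  have A: "smooth_atlas M" "smooth_atlas N"
    using assms(1,2) by (simp_all add: riemannian_manifold_def smooth_manifold_imp_smooth_atlas)
  have rm: "riemannian_metric M g" "riemannian_metric N h"
    using assms(1,2) by (simp_all add: riemannian_manifold_def)
  have D: "affine_connection M D" "torsion_free M D" "metric_connection M g D"
    and D': "affine_connection N D'" "torsion_free N D'" "metric_connection N h D'"
    using assms(4,5) by (simp_all add: levi_civita_def)
  have \<iota>: "smooth_map_on M (points M) N \<iota>"
      "\<And>p. p \<in> points M \<Longrightarrow> inj_on (differential M N \<iota>) (tangent_space M p)"
    and iso: "\<forall>p\<in>points M. \<forall>u\<in>tangent_space M p. \<forall>v\<in>tangent_space M p.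
       g u v = h (differential M N \<iota> u) (differential M N \<iota> v)"
    using assms(3) by (auto simp: isometric_immersion_def immersion_def pullback_def)
  interpret im: smooth_immersion_connections M N \<iota> D D'
    by unfold_locales (use A D D' \<iota> in auto)
  fix u X X' assume pu: "u \<in> points (tangent_bundle M)"
    and X: "X \<in> tangent_space (tangent_bundle M) u" and X': "X' \<in> tangent_space (tangent_bundle M) u"
  define p where "p = fst u"
  have p: "p \<in> points M" and u: "u \<in> tangent_space M p"
    using pu by (simp_all add: points_tangent_bundle[OF A(1)] p_def)
  obtain W V where pW: "p \<in> W" and "\<forall>v\<in>tangent_space M p. \<exists>y Y. related_fields M N \<iota> W V y Y \<and> y p = v"
    using related_fields_exist[OF A \<iota>(1) p \<iota>(2)[OF p]] by (elim exE conjE)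
  then obtain y Y where r: "\<And>v. v \<in> tangent_space M p \<Longrightarrow> related_fields M N \<iota> W V (y v) (Y v)"
    "\<And>v. v \<in> tangent_space M p \<Longrightarrow> y v p = v" by metis
  let ?d = "differential M N \<iota>" and ?\<pi> = "differential (tangent_bundle M) M fst"
  note TM = smooth_atlas_tangent_bundle[OF A(1)]
  have \<pi>: "?\<pi> Z \<in> tangent_space M p" if "Z \<in> tangent_space (tangent_bundle M) u" for Z
    using differential_tangent[OF TM A(1) smooth_projection[OF A(1)] pu that pu] by (simp add: p_def)
  obtain w where w: "w \<in> tangent_space M p" "X = tadd (horizontal M D u (?\<pi> X)) (vertical M u w)"
    using horizontal_vertical_decomposition[OF A(1) D(1,2) p u X] .
  obtain w' where w': "w' \<in> tangent_space M p" "X' = tadd (horizontal M D u (?\<pi> X')) (vertical M u w')"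
    using horizontal_vertical_decomposition[OF A(1) D(1,2) p u X'] .
  let ?B = "\<lambda>x. im.normal_part x (y u) (Y u)"
  \<comment> \<open>The formula has \<open>u\<close> in the first argument, while the image of a
    horizontal lift produces it in the second, where the field through \<open>u\<close> stands;
    symmetry reconciles the two.\<close>
  have sff: "second_fundamental_form M D N D' \<iota> u x = ?B x" if x: "x \<in> tangent_space M p" for x
    using im.second_fundamental_form_eq[OF r(1)[OF x] pW u] im.normal_part_sym[OF r(1)[OF u] r(1)[OF x] pW pW] r(2) u x
    by simp
  have push: "differential (tangent_bundle M) (tangent_bundle N) ?d (tadd (horizontal M D u x) (vertical M u w)) =
      tadd (horizontal N D' (?d u) (?d x)) (vertical N (?d u) (tadd (?d w) (?B x)))"
    if "x \<in> tangent_space M p" "w \<in> tangent_space M p" for x w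
    using im.differential_horizontal_vertical[OF r(1)[OF u] pW that] r(2)[OF u] by simp
  note dt = differential_tangent[OF A \<iota>(1) p _ p] and Bt = im.normal_part_tangent(4)[OF r(1)[OF u] pW]
  note \<iota>p = smooth_map_on_points[OF \<iota>(1) p]
  have orth: "h (?B x) (?d v) = 0" "h (?d v) (?B x) = 0" if "x \<in> tangent_space M p" "v \<in> tangent_space M p" for x v
  proof -
    show "h (?B x) (?d v) = 0"
      by (rule im.normal_part_orthogonal[OF D(3) rm(1) D'(3) rm(2) iso r pW that(1) u that(2)])
    then show "h (?d v) (?B x) = 0" using metric_sym[OF rm(2) \<iota>p dt[OF that(2)] Bt[OF that(1)]] by simp
  qed
  have "pullback (tangent_bundle M) (tangent_bundle N) ?d hS X X' =
      h (?d (?\<pi> X)) (?d (?\<pi> X')) + h (tadd (?d w) (?B (?\<pi> X))) (tadd (?d w') (?B (?\<pi> X')))"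
    unfolding pullback_def
    \<comment> \<open>Both decompositions contain the decomposed vector again on the right, so each
      serves for a single rewriting step.\<close>
    by (subst w(2), subst w'(2), unfold push[OF \<pi>[OF X] w(1)] push[OF \<pi>[OF X'] w'(1)])
      (intro sasaki_metric_expand[OF A(2) D'(1,2) assms(7) \<iota>p] tadd_tangent[OF A(2)] dt Bt u \<pi> X X' w(1) w'(1))
  \<comment> \<open>Products of \<open>?B\<close> with \<open>?d\<close> vanish by normality, those
    of \<open>?d\<close> with \<open>?d\<close> become \<open>g\<close> by isometry, and the product
    of the two \<open>?B\<close> terms is the excess over \<open>gS\<close>.\<close>
  also have "\<dots> = g (?\<pi> X) (?\<pi> X') + g w w' + h (?B (?\<pi> X)) (?B (?\<pi> X'))"
    using \<pi>[OF X] \<pi>[OF X'] w(1) w'(1)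
    by (simp add: iso[rule_format, OF p] metric_tadd_left[OF rm(2) \<iota>p] metric_tadd_right[OF rm(2) \<iota>p A(2)]
        tadd_tangent[OF A(2)] dt Bt orth)
  also have "g (?\<pi> X) (?\<pi> X') + g w w' = gS X X'"
    using sasaki_metric_expand[OF A(1) D(1,2) assms(6) p u \<pi>[OF X] \<pi>[OF X'] w(1) w'(1)] w(2) w'(2) by simp
  finally show "pullback (tangent_bundle M) (tangent_bundle N) ?d hS X X' = gS X X' +
         h (second_fundamental_form M D N D' \<iota> u (?\<pi> X)) (second_fundamental_form M D N D' \<iota> u (?\<pi> X'))"
    using sff[OF \<pi>[OF X]] sff[OF \<pi>[OF X']] by simp
qed

end
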